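(* Let $\vec p=(p_1,\dots,p_n)$ with $1<\vec p<\infty$ and let $1<\frac{n}{\sum_{i=1}^n 1/p_i}<t<r<\infty$. Then the dual of $M_{\vec p}^{t,r}$ is $\mathcal H_{\vec p\,'}^{t',r'}$ in the following sense: if $g\in\mathcal H_{\vec p\,'}^{t',r'}$, then $L_g:f\mapsto\int_{\mathbb R^n}f(x)g(x)\,dx$ is an element of $(M_{\vec p}^{t,r})^*$; moreover, for any $L\in(M_{\vec p}^{t,r})^*$ there exists $g\in\mathcal H_{\vec p\,'}^{t',r'}$ such that $L=L_g$.
   Context: Functions are complex-valued and measurable on $\mathbb R^n$, identified when equal almost everywhere. Inequalities for vectors are componentwise. For $1\le s\le\infty$, $s'$ is the conjugate exponent, and $\vec p\,'=(p_1',\dots,p_n')$. Mixed Lebesgue space: $L^{\vec p}$ is the set of measurable $f$ with $$\|f\|_{L^{\vec p}}=\Big(\int_{\mathbb R}\cdots\Big(\int_{\mathbb R}|f(x_1,\dots,x_n)|^{p_1}dx_1\Big)^{p_2/p_1}\cdots dx_n\Big)^{1/p_n}<\infty.$$ Dyadic cubes: $Q_{j,m}=\prod_{i=1}^n[2^{-j}m_i,2^{-j}(m_i+1))$, $j\in\mathbb Z$, $m\in\mathbb Z^n$; $\mathcal D=\{Q_{j,m}\}$. Mixed Bourgain-Morrey space: $M_{\vec p}^{t,r}$ is the set of measurable $f$ with $$\|f\|_{M_{\vec p}^{t,r}}=\Big(\sum_{Q\in\mathcal D}|Q|^{\frac rt-\frac rn\sum_{i=1}^n\frac1{p_i}}\|f\chi_Q\|_{L^{\vec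 p}}^r\Big)^{1/r}<\infty.$$ Blocks: a measurable function $b$ is a $(\vec p\,',t')$-block supported on a cube $Q$ if $b$ is supported in $Q$ and $\|b\|_{L^{\vec p\,'}}\le|Q|^{\frac1t-\frac1n\sum_{i=1}^n\frac1{p_i}}$. Block space: $\mathcal H_{\vec p\,'}^{t',r'}$ is the set of measurable $f$ that can be written as $f=\sum_{(j,k)\in\mathbb Z\times\mathbb Z^n}\lambda_{j,k}b_{j,k}$, converging almost everywhere on $\mathbb R^n$, with $\lambda=\{\lambda_{j,k}\}\in\ell^{r'}(\mathbb Z^{n+1})$ and each $b_{j,k}$ a $(\vec p\,',t')$-block supported on $Q_{j,k}$. Its norm is $\|f\|_{\mathcal H_{\vec p\,'}^{t',r'}}=\inf_\lambda\|\lambda\|_{\ell^{r'}}$, the infimum being over all $\lambda$ admitting such a representation of $f$. *)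

theory Defs
  imports "HOL-Analysis.Analysis"
begin

text \<open>
  Points of n-dimensional space are vectors of type \<open>real ^ 'n\<close>, where \<open>'n\<close> is an arbitrary finite
  linearly ordered index type.  The linear order fixes the order of the coordinates, and with it the
  order of the iterated integrals in the mixed norm.  Functions identified almost everywhere are
  represented by Lebesgue measurable functions; everything below is invariant under changing a
  function on a null set.
\<close>

type_synonym 'n cfun = "(real, 'n) vec \<Rightarrow> complex"

definition conj_exp :: "real \<Rightarrow> real" where
  "conj_exp s = s / (s - 1)"   \<comment> \<open>conjugate exponent of \<open>1 < s < \<infinity>\<close>\<close>

definition conj_vec :: "real ^ 'n \<Rightarrow> real ^ 'n" where
  "conj_vec p = (\<chi> i. conj_exp (p $ i))"

definition sum_recip :: "real ^ 'n \<Rightarrow> real" where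
  "sum_recip p = (\<Sum>i\<in>UNIV. 1 / p $ i)"

text \<open>Real powers on \<open>[0, \<infinity>]\<close>; used for exponents \<open>a > 0\<close> only.\<close>

definition ennpow :: "ennreal \<Rightarrow> real \<Rightarrow> ennreal" where
  "ennpow x a = (if x = \<infinity> then \<infinity> else ennreal (enn2real x powr a))"

text \<open>The \<open>L\<^sup>s\<close> norm of \<open>F\<close> in the \<open>i\<close>-th variable, the other variables being those of \<open>x\<close>.\<close>

definition coord_norm ::
  "'n \<Rightarrow> real \<Rightarrow> (real ^ 'n \<Rightarrow> ennreal) \<Rightarrow> real ^ 'n \<Rightarrow> ennreal" where
  "coord_norm i s F x =
     ennpow (\<integral>\<^sup>+ y. ennpow (F (\<chi> j. if j = i then y else x $ j)) s \<partial>lebesgue) (1 / s)"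

text \<open>
  The coordinate norms are applied successively, the least index being innermost.  The resulting
  function does not depend on its argument any more, so it is evaluated at \<open>0\<close>.
\<close>

definition mixed_norm :: "real ^ 'n::{finite,linorder} \<Rightarrow> 'n cfun \<Rightarrow> ennreal" where
  "mixed_norm p f =
     fold (\<lambda>i. coord_norm i (p $ i)) (sorted_list_of_set UNIV) (\<lambda>x. ennreal (norm (f x))) 0"

definition dyadic_cube :: "int \<Rightarrow> int ^ 'n \<Rightarrow> (real ^ 'n) set" where
  "dyadic_cube j m =
     {x. \<forall>i. 2 powi (- j) * of_int (m $ i) \<le> x $ i \<and> x $ i < 2 powi (- j) * (of_int (m $ i) + 1)}"

definition dyadic_cubes :: "(real ^ 'n) set set" where
  "dyadic_cubes = {dyadic_cube j m | j m. True}"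

definition bm_norm ::
  "real ^ 'n::{finite,linorder} \<Rightarrow> real \<Rightarrow> real \<Rightarrow> 'n cfun \<Rightarrow> ennreal" where
  "bm_norm p t r f =
     ennpow
       (\<Sum>\<^sub>\<infinity>Q\<in>dyadic_cubes.
          ennreal (measure lebesgue Q powr (r / t - r / real CARD('n) * sum_recip p)) *
          ennpow (mixed_norm p (\<lambda>x. f x * indicator Q x)) r)
       (1 / r)"

definition bm_space ::
  "real ^ 'n::{finite,linorder} \<Rightarrow> real \<Rightarrow> real \<Rightarrow> 'n cfun set" where
  "bm_space p t r = {f \<in> borel_measurable lebesgue. bm_norm p t r f < \<infinity>}"

text \<open>
  Bounded linear functionals on the mixed Bourgain-Morrey space.  Only the values of \<open>L\<close> on the
  space matter.  Boundedness forces \<open>L\<close> to agree on functions that are equal almost everywhere.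
\<close>

definition bm_dual ::
  "real ^ 'n::{finite,linorder} \<Rightarrow> real \<Rightarrow> real \<Rightarrow> ('n cfun \<Rightarrow> complex) set" where
  "bm_dual p t r =
     {L. (\<forall>f\<in>bm_space p t r. \<forall>g\<in>bm_space p t r. L (\<lambda>x. f x + g x) = L f + L g) \<and>
         (\<forall>c. \<forall>f\<in>bm_space p t r. L (\<lambda>x. c * f x) = c * L f) \<and>
         (\<exists>C. \<forall>f\<in>bm_space p t r. norm (L f) \<le> C * enn2real (bm_norm p t r f))}"

text \<open>The parameters are \<open>p\<close> and \<open>t\<close>: these are the \<open>(p', t')\<close>-blocks supported on \<open>Q\<close>.\<close>

definition is_block ::
  "real ^ 'n::{finite,linorder} \<Rightarrow> real \<Rightarrow> (real, 'n) vec set \<Rightarrow> 'n cfun \<Rightarrow> bool" where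
  "is_block p t Q b \<longleftrightarrow>
     b \<in> borel_measurable lebesgue \<and>
     (AE x in lebesgue. x \<notin> Q \<longrightarrow> b x = 0) \<and>
     mixed_norm (conj_vec p) b \<le>
       ennreal (measure lebesgue Q powr (1 / t - 1 / real CARD('n) * sum_recip p))"

text \<open>
  Likewise, this is the block space with the exponents \<open>p', t', r'\<close>.  As the index set of the series
  is not ordered, convergence means unconditional (equivalently, absolute) convergence.
\<close>

definition block_space ::
  "real ^ 'n::{finite,linorder} \<Rightarrow> real \<Rightarrow> real \<Rightarrow> 'n cfun set" where
  "block_space p t r =
     {f \<in> borel_measurable lebesgue.
        \<exists>(lam :: int \<times> (int, 'n) vec \<Rightarrow> complex) (b :: int \<times> (int, 'n) vec \<Rightarrow> 'n cfun).
          (\<lambda>jk. norm (lam jk) powr conj_exp r) summable_on UNIV \<and>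
          (\<forall>j k. is_block p t (dyadic_cube j k) (b (j, k))) \<and>
          (AE x in lebesgue. ((\<lambda>jk. lam jk * b jk x) has_sum f x) UNIV)}"

definition pairing :: "'n::finite cfun \<Rightarrow> 'n cfun \<Rightarrow> complex" where
  "pairing g f = (\<integral>x. f x * g x \<partial>lebesgue)"

end

theory Submission
  imports Defs
begin

text \<open>
  A function \<open>g = \<Sum> \<lambda>\<^sub>Q b\<^sub>Q\<close> in the block space acts on \<open>f\<close> by \<open>\<Sum> \<lambda>\<^sub>Q \<integral> f b\<^sub>Q\<close>.  Each integral only
  sees \<open>f\<close> on \<open>Q\<close>, and Hoelder's inequality, for the mixed norm on \<open>Q\<close> and for the sum over \<open>Q\<close>, bounds
  the total by \<open>\<parallel>\<lambda>\<parallel>\<close> times the Bourgain-Morrey norm of \<open>f\<close> (\<open>block_pairing_le\<close>).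

  For the converse, the function \<open>g\<close> is written down explicitly from a point at which the functional
  attains its norm.  The Bourgain-Morrey norm is an iteration of \<open>L\<^sup>s\<close> norms (one for each coordinate, then a weighted
  sequence norm over the cubes) with \<open>1 < s < \<infinity>\<close>.  Each of them satisfies
  \<open>\<parallel>(F\<^sup>q + G\<^sup>q)\<^sup>1\<^sup>/\<^sup>q\<parallel> \<le> (\<parallel>F\<parallel>\<^sup>q + \<parallel>G\<parallel>\<^sup>q)\<^sup>1\<^sup>/\<^sup>q\<close> for \<open>q \<le> s\<close>, and the reverse inequality for \<open>q \<ge> s\<close>.  These two
  inequalities survive iteration, so the whole norm satisfies the first for some \<open>a \<in> (1, 2]\<close> and the second
  for some \<open>b \<ge> 2\<close>.  Inequalities between two complex numbers, inserted pointwise, then make the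
  norm uniformly convex and uniformly smooth (\<open>uniformly_convex\<close>, \<open>uniformly_smooth\<close>).

  Let \<open>L\<close> be a functional of norm \<open>N > 0\<close>.  By uniform convexity a sequence in the unit ball along which \<open>L\<close>
  tends to its supremum is a Cauchy sequence, and the space is complete, so \<open>L f\<^sub>0 = N\<close> for some
  \<open>f\<^sub>0\<close> of norm one (\<open>norm_attained\<close>).  On the other hand Hoelder's inequality has a case of equality in
  every variable and in the sum over the cubes; multiplying the extremal factors produces a block series
  \<open>g\<close> with \<open>\<integral> f\<^sub>0 g = 1\<close> and \<open>\<bar>\<integral> f g\<bar> \<le> \<parallel>f\<parallel>\<close> for all \<open>f\<close> (\<open>ex_norming_block_series\<close>).  So \<open>L / N\<close> and integration
  against \<open>g\<close> both have norm one and value one at \<open>f\<^sub>0\<close>.  A smooth norm has only one such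
  functional (\<open>norming_functional_unique\<close>), hence \<open>L\<close> is integration against \<open>N g\<close>.

  Most of the work is done for Borel functions, whose sections are all measurable; a Lebesgue measurable
  function is replaced by a Borel representative.
\<close>

section \<open>Powers in the extended half-line and one-variable norms\<close>

lemma ennpow_0 [simp]: "ennpow 0 a = 0"
  by (simp add: ennpow_def)

lemma ennpow_top [simp]: "ennpow top a = top"
  by (simp add: ennpow_def)

lemma ennpow_ennreal: "0 \<le> x \<Longrightarrow> ennpow (ennreal x) a = ennreal (x powr a)"
  by (simp add: ennpow_def)

lemma ennpow_one_left [simp]: "ennpow 1 a = 1"
  using ennpow_ennreal[of 1 a] by simp

lemma ennpow_1 [simp]: "ennpow x 1 = x"
  by (cases x) (auto simp: ennpow_ennreal)

lemma ennpow_mono: "x \<le> y \<Longrightarrow> 0 \<le> a \<Longrightarrow> ennpow x a \<le> ennpow y a"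
  by (cases x; cases y) (auto simp: ennpow_ennreal top_unique intro!: ennreal_leI powr_mono2)

lemma ennpow_ennpow: "ennpow (ennpow x a) b = ennpow x (a * b)"
  by (cases x) (auto simp: ennpow_ennreal powr_powr)

lemma ennpow_inverse [simp]:
  "0 < a \<Longrightarrow> ennpow (ennpow x a) (1 / a) = x" "0 < a \<Longrightarrow> ennpow (ennpow x (1 / a)) a = x"
  by (simp_all add: ennpow_ennpow)

lemma ennpow_mult: "0 < a \<Longrightarrow> ennpow (x * y) a = ennpow x a * ennpow y a"
  by (cases x; cases y)
    (auto simp: ennpow_ennreal ennreal_mult[symmetric] powr_mult ennreal_mult_top
      ennreal_top_mult powr_ge_zero ennreal_mult_eq_top_iff)

lemma ennpow_eq_0_iff [simp]: "ennpow x a = 0 \<longleftrightarrow> x = 0"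
  by (cases x) (auto simp: ennpow_ennreal)

lemma ennpow_eq_top_iff [simp]: "ennpow x a = top \<longleftrightarrow> x = top"
  by (simp add: ennpow_def)

lemma ennpow_less_top_iff [simp]: "ennpow x a < top \<longleftrightarrow> x < top"
  by (simp add: less_top[symmetric])

lemma ennpow_le_iff: "0 < a \<Longrightarrow> ennpow x a \<le> y \<longleftrightarrow> x \<le> ennpow y (1 / a)"
  by (metis ennpow_inverse ennpow_mono less_le zero_less_divide_1_iff)

lemma le_ennpow_iff: "0 < a \<Longrightarrow> y \<le> ennpow x a \<longleftrightarrow> ennpow y (1 / a) \<le> x"
  by (metis ennpow_inverse ennpow_mono less_le zero_less_divide_1_iff)

text \<open>
  The power is an order isomorphism of \<open>[0, \<infinity>]\<close>, so it commutes with all suprema.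
\<close>
lemma ennpow_SUP: "0 < a \<Longrightarrow> ennpow (SUP k\<in>I. f k) a = (SUP k\<in>I. ennpow (f k) a)"
proof (rule antisym)
  assume a: "0 < a"
  have "f k \<le> ennpow (SUP k\<in>I. ennpow (f k) a) (1 / a)" if "k \<in> I" for k
    using that a by (subst ennpow_le_iff[symmetric]) (auto intro: SUP_upper)
  then show "ennpow (SUP k\<in>I. f k) a \<le> (SUP k\<in>I. ennpow (f k) a)"
    using a by (subst ennpow_le_iff) (auto intro: SUP_least)
qed (auto intro!: SUP_least ennpow_mono SUP_upper)

lemma measurable_ennpow [measurable (raw)]:
  "f \<in> borel_measurable M \<Longrightarrow> (\<lambda>x. ennpow (f x) a) \<in> borel_measurable M"
proof -
  have "(\<lambda>x::ennreal. ennpow x a) \<in> borel_measurable borel"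
    unfolding ennpow_def by measurable
  then show "f \<in> borel_measurable M \<Longrightarrow> (\<lambda>x. ennpow (f x) a) \<in> borel_measurable M"
    using measurable_compose by blast
qed

text \<open>
  Convexity and concavity of a norm with exponent \<open>q\<close> compare the norm of a pointwise \<open>q\<close>-sum with the \<open>q\<close>-sum of the norms.
\<close>
definition qsum :: "real \<Rightarrow> ennreal \<Rightarrow> ennreal \<Rightarrow> ennreal" where
  "qsum q x y = ennpow (ennpow x q + ennpow y q) (1 / q)"

definition lnorm :: "'a measure \<Rightarrow> real \<Rightarrow> ('a \<Rightarrow> ennreal) \<Rightarrow> ennreal" where
  "lnorm M s F = ennpow (\<integral>\<^sup>+ x. ennpow (F x) s \<partial>M) (1 / s)"

lemma qsum_one [simp]: "qsum 1 x y = x + y"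
  by (simp add: qsum_def)

lemma ennpow_qsum: "0 < q \<Longrightarrow> ennpow (qsum q x y) s = ennpow (ennpow x q + ennpow y q) (s / q)"
  by (simp add: qsum_def ennpow_ennpow)

lemma measurable_qsum [measurable (raw)]:
  assumes [measurable]: "f \<in> borel_measurable M" "g \<in> borel_measurable M"
  shows "(\<lambda>x. qsum q (f x) (g x)) \<in> borel_measurable M"
  unfolding qsum_def by measurable

lemma lnorm_mono:
  "0 < s \<Longrightarrow> (\<And>x. x \<in> space M \<Longrightarrow> F x \<le> G x) \<Longrightarrow> lnorm M s F \<le> lnorm M s G"
  unfolding lnorm_def by (intro ennpow_mono nn_integral_mono) auto

lemma lnorm_cmult:
  assumes "0 < s" and "F \<in> borel_measurable M"
  shows "lnorm M s (\<lambda>x. c * F x) = c * lnorm M s F"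
  using assms by (simp add: lnorm_def ennpow_mult nn_integral_cmult)

lemma lnorm_SUP:
  assumes "0 < s" and "\<And>k. F k \<in> borel_measurable M" and "incseq F"
  shows "lnorm M s (\<lambda>x. SUP k. F k x) = (SUP k. lnorm M s (F k))"
proof -
  have "(\<integral>\<^sup>+ x. (SUP k. ennpow (F k x) s) \<partial>M) = (SUP k. \<integral>\<^sup>+ x. ennpow (F k x) s \<partial>M)"
    using assms
    by (intro nn_integral_monotone_convergence_SUP)
      (auto simp: incseq_def le_fun_def intro!: ennpow_mono)
  then show ?thesis
    using assms(1) by (simp add: lnorm_def ennpow_SUP)
qed

text \<open>
  Convexity of the power at the convex combination \<open>A/(A+B) \<cdot> u/A + B/(A+B) \<cdot> v/B\<close>.  Integrated with
  \<open>A\<close> and \<open>B\<close> close to the norms of two functions, it gives Minkowski's inequality.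
\<close>
lemma powr_add_le_weighted:
  fixes u v A B \<sigma> :: real
  assumes "0 \<le> u" "0 \<le> v" "0 < A" "0 < B" "1 \<le> \<sigma>"
  shows "(u + v) powr \<sigma> \<le> (A + B) powr (\<sigma> - 1) * (A powr (1 - \<sigma>) * u powr \<sigma> + B powr (1 - \<sigma>) * v powr \<sigma>)"
proof -
  have one: "w powr \<sigma> \<le> (A' + B') powr (\<sigma> - 1) * (A' powr (1 - \<sigma>) * w powr \<sigma>)"
    if "0 \<le> w" "0 < A'" "0 < B'" for w A' B' :: real
  proof -
    \<comment> \<open>The same estimate when the other summand vanishes.\<close>
    have "1 = A' powr (\<sigma> - 1) * A' powr (1 - \<sigma>)"
      using that by (simp add: powr_add[symmetric])
    also have "\<dots> \<le> (A' + B') powr (\<sigma> - 1) * A' powr (1 - \<sigma>)"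
      using that assms by (intro mult_right_mono powr_mono2) auto
    finally show ?thesis
      using mult_right_mono[of 1 "(A' + B') powr (\<sigma> - 1) * A' powr (1 - \<sigma>)" "w powr \<sigma>"]
      by (simp add: mult.assoc)
  qed
  consider "u = 0" | "v = 0" | "0 < u" "0 < v" using assms by linarith
  then show ?thesis
  proof cases
    case 1 then show ?thesis using one[of v B A] assms by (simp add: add.commute)
  next
    case 2 then show ?thesis using one[of u A B] assms by simp
  next
    case 3
    define t where "t = B / (A + B)"
    have t: "0 \<le> t" "t \<le> 1" "1 - t = A / (A + B)"
      using assms by (auto simp: t_def field_simps)
    have "((1 - t) *\<^sub>R (u / A) + t *\<^sub>R (v / B)) powr \<sigma>
        \<le> (1 - t) * (u / A) powr \<sigma> + t * (v / B) powr \<sigma>"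
      using convex_onD[OF powr_convex[OF assms(5)], of t "u / A" "v / B"] t 3 assms by auto
    moreover have "(1 - t) *\<^sub>R (u / A) + t *\<^sub>R (v / B) = (u + v) / (A + B)"
      unfolding t(3) using assms by (simp add: t_def add_divide_distrib)
    ultimately have "((u + v) / (A + B)) powr \<sigma>
        \<le> (A / (A + B)) * (u / A) powr \<sigma> + (B / (A + B)) * (v / B) powr \<sigma>"
      using t by (simp add: t_def)
    then have "(u + v) powr \<sigma> / (A + B) powr \<sigma> \<le>
        (A / (A + B)) * (u powr \<sigma> / A powr \<sigma>) + (B / (A + B)) * (v powr \<sigma> / B powr \<sigma>)"
      using assms 3 by (simp add: powr_divide)
    then have "(u + v) powr \<sigma> \<le> (A + B) powr \<sigma> *
        ((A / (A + B)) * (u powr \<sigma> / A powr \<sigma>) + (B / (A + B)) * (v powr \<sigma> / B powr \<sigma>))"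
      using assms by (simp add: pos_divide_le_eq mult.commute)
    also have "\<dots> = (A + B) powr (\<sigma> - 1) * (A powr (1 - \<sigma>) * u powr \<sigma> + B powr (1 - \<sigma>) * v powr \<sigma>)"
      using assms by (simp add: powr_diff distrib_left mult_ac)
    finally show ?thesis .
  qed
qed

text \<open>
  This is the convex case for the exponent \<open>1 / \<sigma>\<close>, applied to the numbers whose powers are
  \<open>u\<close> and \<open>v\<close> up to the weights.
\<close>
lemma powr_add_ge_weighted:
  fixes u v A B \<sigma> :: real
  assumes "0 \<le> u" "0 \<le> v" "0 < A" "0 < B" "0 < \<sigma>" "\<sigma> \<le> 1"
  shows "(A + B) powr (\<sigma> - 1) * (A powr (1 - \<sigma>) * u powr \<sigma> + B powr (1 - \<sigma>) * v powr \<sigma>) \<le> (u + v) powr \<sigma>"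
proof -
  define U where "U = u powr \<sigma> * A powr (1 - \<sigma>)"
  define V where "V = v powr \<sigma> * B powr (1 - \<sigma>)"
  have e: "1 \<le> 1 / \<sigma>" using assms by simp
  have uu: "A powr (1 - 1 / \<sigma>) * U powr (1 / \<sigma>) = u"
    using assms unfolding U_def
    by (simp add: powr_mult powr_powr diff_divide_distrib powr_add[symmetric] flip: mult.assoc)
  have vv: "B powr (1 - 1 / \<sigma>) * V powr (1 / \<sigma>) = v"
    using assms unfolding V_def
    by (simp add: powr_mult powr_powr diff_divide_distrib powr_add[symmetric] flip: mult.assoc)
  have "(U + V) powr (1 / \<sigma>) \<le> (A + B) powr (1 / \<sigma> - 1) * (u + v)"
    using powr_add_le_weighted[of U V A B "1 / \<sigma>"] assms e uu vv by (simp add: U_def V_def)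
  then have "((U + V) powr (1 / \<sigma>)) powr \<sigma> \<le> ((A + B) powr (1 / \<sigma> - 1) * (u + v)) powr \<sigma>"
    using assms by (intro powr_mono2) (auto simp: U_def V_def)
  then have "U + V \<le> (A + B) powr (1 - \<sigma>) * (u + v) powr \<sigma>"
    using assms by (simp add: powr_powr powr_mult U_def V_def left_diff_distrib)
  then have "(A + B) powr (\<sigma> - 1) * (U + V) \<le> (A + B) powr (\<sigma> - 1) * ((A + B) powr (1 - \<sigma>) * (u + v) powr \<sigma>)"
    by (intro mult_left_mono) auto
  also have "\<dots> = (u + v) powr \<sigma>"
    using assms by (simp add: powr_add[symmetric] flip: mult.assoc)
  finally show ?thesis by (simp add: U_def V_def mult.commute)
qed

lemma ennpow_add_le_weighted:
  assumes "0 < A" "0 < B" "1 \<le> \<sigma>"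
  shows "ennpow (u + v) \<sigma> \<le> ennreal ((A + B) powr (\<sigma> - 1) * A powr (1 - \<sigma>)) * ennpow u \<sigma>
    + ennreal ((A + B) powr (\<sigma> - 1) * B powr (1 - \<sigma>)) * ennpow v \<sigma>"
proof (cases "u = top \<or> v = top")
  case True
  then show ?thesis using assms by (auto simp: ennreal_mult_top)
next
  case False
  then obtain a b where "u = ennreal a" "v = ennreal b" "0 \<le> a" "0 \<le> b"
    by (metis ennreal_cases)
  then show ?thesis
    using powr_add_le_weighted[of a b A B \<sigma>] assms
    by (simp add: ennpow_ennreal ennreal_plus[symmetric] ennreal_mult[symmetric] algebra_simps
        del: ennreal_plus)
qed

lemma ennpow_add_ge_weighted:
  assumes "0 < A" "0 < B" "0 < \<sigma>" "\<sigma> \<le> 1"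
  shows "ennreal ((A + B) powr (\<sigma> - 1) * A powr (1 - \<sigma>)) * ennpow u \<sigma>
    + ennreal ((A + B) powr (\<sigma> - 1) * B powr (1 - \<sigma>)) * ennpow v \<sigma> \<le> ennpow (u + v) \<sigma>"
proof (cases "u = top \<or> v = top")
  case True
  then show ?thesis by auto
next
  case False
  then obtain a b where "u = ennreal a" "v = ennreal b" "0 \<le> a" "0 \<le> b"
    by (metis ennreal_cases)
  then show ?thesis
    using powr_add_ge_weighted[of a b A B \<sigma>] assms
    by (simp add: ennpow_ennreal ennreal_plus[symmetric] ennreal_mult[symmetric] algebra_simps
        del: ennreal_plus)
qed

lemma weighted_constants:
  fixes A B \<sigma> :: real
  assumes "0 < A" "0 < B"
  shows "ennreal ((A + B) powr (\<sigma> - 1) * A powr (1 - \<sigma>)) * ennreal (A powr \<sigma>)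
    + ennreal ((A + B) powr (\<sigma> - 1) * B powr (1 - \<sigma>)) * ennreal (B powr \<sigma>) = ennreal ((A + B) powr \<sigma>)"
proof -
  have "(A + B) powr (\<sigma> - 1) * A powr (1 - \<sigma>) * A powr \<sigma> + (A + B) powr (\<sigma> - 1) * B powr (1 - \<sigma>) * B powr \<sigma>
      = (A + B) powr (\<sigma> - 1) * (A + B) powr 1"
    using assms by (simp add: mult.assoc powr_add[symmetric] distrib_left)
  also have "\<dots> = (A + B) powr \<sigma>"
    by (subst powr_add[symmetric]) simp
  finally show ?thesis
    by (simp add: ennreal_mult[symmetric] ennreal_plus[symmetric] del: ennreal_plus)
qed

text \<open>
  Normalising by bounds \<open>A\<close> and \<open>B\<close> strictly above the two norms avoids a separate treatment of
  functions of norm zero.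
\<close>
lemma Minkowski_lnorm:
  assumes "1 \<le> \<sigma>" and [measurable]: "U \<in> borel_measurable M" "V \<in> borel_measurable M"
  shows "lnorm M \<sigma> (\<lambda>x. U x + V x) \<le> lnorm M \<sigma> U + lnorm M \<sigma> V"
proof (cases "lnorm M \<sigma> U = top \<or> lnorm M \<sigma> V = top")
  case False
  then obtain a b where ab: "lnorm M \<sigma> U = ennreal a" "lnorm M \<sigma> V = ennreal b" "0 \<le> a" "0 \<le> b"
    by (metis ennreal_cases)
  have s: "0 < \<sigma>" using assms by simp
  have "lnorm M \<sigma> (\<lambda>x. U x + V x) \<le> ennreal (a + b) + ennreal e" if e: "0 < e" for e
  proof -
    define A where "A = a + e / 2"
    define B where "B = b + e / 2"
    have AB: "0 < A" "0 < B" using e ab by (auto simp: A_def B_def)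
    have "lnorm M \<sigma> U \<le> ennreal A" "lnorm M \<sigma> V \<le> ennreal B"
      using ab e by (auto simp: A_def B_def intro!: ennreal_leI)
    then have *: "(\<integral>\<^sup>+x. ennpow (U x) \<sigma> \<partial>M) \<le> ennreal (A powr \<sigma>)"
        "(\<integral>\<^sup>+x. ennpow (V x) \<sigma> \<partial>M) \<le> ennreal (B powr \<sigma>)"
      using s AB by (auto simp: lnorm_def ennpow_le_iff ennpow_ennreal)
    have "(\<integral>\<^sup>+x. ennpow (U x + V x) \<sigma> \<partial>M) \<le>
       (\<integral>\<^sup>+x. ennreal ((A + B) powr (\<sigma> - 1) * A powr (1 - \<sigma>)) * ennpow (U x) \<sigma>
    + ennreal ((A + B) powr (\<sigma> - 1) * B powr (1 - \<sigma>)) * ennpow (V x) \<sigma> \<partial>M)"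
      using AB assms by (intro nn_integral_mono ennpow_add_le_weighted) auto
    also have "\<dots> = ennreal ((A + B) powr (\<sigma> - 1) * A powr (1 - \<sigma>)) * (\<integral>\<^sup>+x. ennpow (U x) \<sigma> \<partial>M)
      + ennreal ((A + B) powr (\<sigma> - 1) * B powr (1 - \<sigma>)) * (\<integral>\<^sup>+x. ennpow (V x) \<sigma> \<partial>M)"
      by (simp add: nn_integral_add nn_integral_cmult)
    also have "\<dots> \<le> ennreal ((A + B) powr (\<sigma> - 1) * A powr (1 - \<sigma>)) * ennreal (A powr \<sigma>)
    + ennreal ((A + B) powr (\<sigma> - 1) * B powr (1 - \<sigma>)) * ennreal (B powr \<sigma>)"
      by (intro add_mono mult_left_mono *) auto
    also have "\<dots> = ennreal ((A + B) powr \<sigma>)"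
      by (rule weighted_constants[OF AB])
    finally have "lnorm M \<sigma> (\<lambda>x. U x + V x) \<le> ennreal (A + B)"
      using s AB by (simp add: lnorm_def ennpow_le_iff ennpow_ennreal del: ennreal_plus)
    also have "A + B = (a + b) + e"
      unfolding A_def B_def by linarith
    also have "\<dots> = ennreal (a + b) + ennreal e"
      using e ab by (intro ennreal_plus) auto
    finally show ?thesis .
  qed
  then have "lnorm M \<sigma> (\<lambda>x. U x + V x) \<le> ennreal (a + b)"
    by (rule ennreal_le_epsilon)
  then show ?thesis
    using ab by simp
qed auto

lemma Minkowski_reverse_lnorm:
  assumes \<sigma>: "0 < \<sigma>" "\<sigma> \<le> 1"
    and [measurable]: "U \<in> borel_measurable M" "V \<in> borel_measurable M"
  shows "lnorm M \<sigma> U + lnorm M \<sigma> V \<le> lnorm M \<sigma> (\<lambda>x. U x + V x)"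
proof -
  have mono: "lnorm M \<sigma> U \<le> lnorm M \<sigma> (\<lambda>x. U x + V x)" "lnorm M \<sigma> V \<le> lnorm M \<sigma> (\<lambda>x. U x + V x)"
    using \<sigma> by (auto intro!: lnorm_mono)
  consider "lnorm M \<sigma> U = 0" | "lnorm M \<sigma> V = 0" | "lnorm M \<sigma> U = top" | "lnorm M \<sigma> V = top"
    | a b where "lnorm M \<sigma> U = ennreal a" "lnorm M \<sigma> V = ennreal b" "0 < a" "0 < b"
    by (metis ennreal_cases ennreal_0 order_le_less)
  then show ?thesis
  proof cases
    case 5
    then have *: "(\<integral>\<^sup>+x. ennpow (U x) \<sigma> \<partial>M) = ennreal (a powr \<sigma>)"
        "(\<integral>\<^sup>+x. ennpow (V x) \<sigma> \<partial>M) = ennreal (b powr \<sigma>)"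
      using \<sigma> by (metis ennpow_ennreal ennpow_inverse(2) less_imp_le lnorm_def)+
    have "ennreal ((a + b) powr \<sigma>) = ennreal ((a + b) powr (\<sigma> - 1) * a powr (1 - \<sigma>)) * ennreal (a powr \<sigma>)
      + ennreal ((a + b) powr (\<sigma> - 1) * b powr (1 - \<sigma>)) * ennreal (b powr \<sigma>)"
      using weighted_constants[of a b \<sigma>] 5 by simp
    also have "\<dots> = (\<integral>\<^sup>+x. ennreal ((a + b) powr (\<sigma> - 1) * a powr (1 - \<sigma>)) * ennpow (U x) \<sigma>
        + ennreal ((a + b) powr (\<sigma> - 1) * b powr (1 - \<sigma>)) * ennpow (V x) \<sigma> \<partial>M)"
      by (simp add: nn_integral_add nn_integral_cmult *)
    also have "\<dots> \<le> (\<integral>\<^sup>+x. ennpow (U x + V x) \<sigma> \<partial>M)"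
      using 5 \<sigma> by (intro nn_integral_mono ennpow_add_ge_weighted) auto
    finally have "ennreal (a + b) \<le> lnorm M \<sigma> (\<lambda>x. U x + V x)"
      using \<sigma> 5 by (simp add: lnorm_def le_ennpow_iff ennpow_ennreal del: ennreal_plus)
    then show ?thesis using 5 by simp
  qed (use mono in \<open>auto simp: top_unique\<close>)
qed

lemma ennpow_lnorm: "0 < q \<Longrightarrow> 0 < s \<Longrightarrow> ennpow (lnorm M s F) q = lnorm M (s / q) (\<lambda>x. ennpow (F x) q)"
  by (simp add: lnorm_def ennpow_ennpow)

text \<open>
  The \<open>q\<close>-th power of an \<open>L\<^sup>s\<close> norm is the \<open>L\<^sup>s\<^sup>/\<^sup>q\<close> norm of the \<open>q\<close>-th power, so \<open>q\<close>-convexity is Minkowski's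
  inequality for the exponent \<open>s / q \<ge> 1\<close>.
\<close>
lemma lnorm_qsum_le:
  assumes "0 < q" "q \<le> s" and [measurable]: "F \<in> borel_measurable M" "G \<in> borel_measurable M"
  shows "lnorm M s (\<lambda>x. qsum q (F x) (G x)) \<le> qsum q (lnorm M s F) (lnorm M s G)"
proof -
  have "ennpow (lnorm M s (\<lambda>x. qsum q (F x) (G x))) q
      = lnorm M (s / q) (\<lambda>x. ennpow (F x) q + ennpow (G x) q)"
    using assms by (subst ennpow_lnorm) (auto simp: ennpow_qsum)
  also have "\<dots> \<le> ennpow (lnorm M s F) q + ennpow (lnorm M s G) q"
    using assms by (simp add: ennpow_lnorm Minkowski_lnorm)
  finally show ?thesis
    using assms by (simp add: ennpow_le_iff qsum_def)
qed

text \<open>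
  For \<open>s / q \<le> 1\<close> Minkowski's inequality is reversed, which gives \<open>q\<close>-concavity.
\<close>
lemma lnorm_qsum_ge:
  assumes "0 < s" "s \<le> q" and [measurable]: "F \<in> borel_measurable M" "G \<in> borel_measurable M"
  shows "qsum q (lnorm M s F) (lnorm M s G) \<le> lnorm M s (\<lambda>x. qsum q (F x) (G x))"
proof -
  have "ennpow (lnorm M s F) q + ennpow (lnorm M s G) q
      \<le> lnorm M (s / q) (\<lambda>x. ennpow (F x) q + ennpow (G x) q)"
    using assms by (simp add: ennpow_lnorm Minkowski_reverse_lnorm)
  also have "\<dots> = ennpow (lnorm M s (\<lambda>x. qsum q (F x) (G x))) q"
    using assms by (subst ennpow_lnorm) (auto simp: ennpow_qsum)
  finally show ?thesis
    using assms by (simp add: le_ennpow_iff qsum_def)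
qed

lemma conj_exp_pos: "1 < s \<Longrightarrow> 0 < conj_exp s" "1 < s \<Longrightarrow> 1 < conj_exp s"
  by (auto simp: conj_exp_def field_simps)

text \<open>
  Young's inequality for the normalised functions, integrated; the cases of norm \<open>0\<close> and \<open>\<infinity>\<close> are
  separate because of the convention \<open>0 \<cdot> \<infinity> = 0\<close>.
\<close>
lemma Hoelder_lnorm:
  assumes s: "1 < s" and [measurable]: "F \<in> borel_measurable M" "G \<in> borel_measurable M"
  shows "(\<integral>\<^sup>+x. F x * G x \<partial>M) \<le> lnorm M s F * lnorm M (conj_exp s) G"
proof -
  define s' where "s' = conj_exp s"
  have s': "0 < s'" "1 / s + 1 / s' = 1" "1 < s'"
    using s by (auto simp: s'_def conj_exp_def field_simps)
  have z: "(\<integral>\<^sup>+x. F x * G x \<partial>M) = 0" if "lnorm M s F = 0 \<or> lnorm M s' G = 0"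
  proof -
    have "AE x in M. F x * G x = 0"
      using that s s' by (auto simp: lnorm_def nn_integral_0_iff_AE elim: AE_mp)
    then show ?thesis by (simp add: nn_integral_0_iff_AE)
  qed
  consider "lnorm M s F = 0 \<or> lnorm M s' G = 0" | "lnorm M s F * lnorm M s' G = top"
    | a b where "lnorm M s F = ennreal a" "lnorm M s' G = ennreal b" "0 < a" "0 < b"
    by (metis ennreal_cases ennreal_0 order_le_less ennreal_mult_eq_top_iff)
  then have "(\<integral>\<^sup>+x. F x * G x \<partial>M) \<le> lnorm M s F * lnorm M s' G"
  proof cases
    case 1 then show ?thesis using z by simp
  next
    case 2 then show ?thesis by simp
  next
    case 3
    then have *: "(\<integral>\<^sup>+x. ennpow (F x) s \<partial>M) = ennreal (a powr s)"
        "(\<integral>\<^sup>+x. ennpow (G x) s' \<partial>M) = ennreal (b powr s')"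
      using s s' by (metis ennpow_ennreal ennpow_inverse(2) less_imp_le lnorm_def less_trans zero_less_one)+
    define c where "c = a * b * (a powr - s) / s"
    define d where "d = a * b * (b powr - s') / s'"
    have cd: "0 \<le> c" "0 \<le> d" using 3 s s' by (auto simp: c_def d_def)
    have pt: "u * v \<le> ennreal c * ennpow u s + ennreal d * ennpow v s'" for u v
    proof (cases "u = 0 \<or> v = 0 \<or> u = top \<or> v = top")
      case True
      then show ?thesis
        using 3 s s' by (auto simp: c_def d_def ennreal_mult_top)
    next
      case False
      then obtain x y where xy: "u = ennreal x" "v = ennreal y" "0 \<le> x" "0 \<le> y"
        by (metis ennreal_cases)
      have "(x / a) * (y / b) \<le> (x / a) powr s / s + (y / b) powr s' / s'"
        using s s' xy 3 by (intro Youngs_inequality) auto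
      then have "a * b * ((x / a) * (y / b)) \<le> a * b * ((x / a) powr s / s + (y / b) powr s' / s')"
        using 3 by (intro mult_left_mono) auto
      also have "a * b * ((x / a) * (y / b)) = x * y" using 3 by simp
      also have "a * b * ((x / a) powr s / s + (y / b) powr s' / s') = c * x powr s + d * y powr s'"
        using 3 xy by (simp add: c_def d_def powr_divide powr_minus field_simps)
      finally show ?thesis
        using xy cd by (simp add: ennpow_ennreal ennreal_mult[symmetric] ennreal_plus[symmetric]
           del: ennreal_plus)
    qed
    have "(\<integral>\<^sup>+x. F x * G x \<partial>M) \<le> (\<integral>\<^sup>+x. ennreal c * ennpow (F x) s + ennreal d * ennpow (G x) s' \<partial>M)"
      by (intro nn_integral_mono pt)
    also have "\<dots> = ennreal c * ennreal (a powr s) + ennreal d * ennreal (b powr s')"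
      by (simp add: nn_integral_add nn_integral_cmult *)
    also have "\<dots> = ennreal (c * a powr s + d * b powr s')"
      using cd by (simp add: ennreal_mult[symmetric] ennreal_plus[symmetric] del: ennreal_plus)
    also have "c * a powr s + d * b powr s' = a * b * (1 / s + 1 / s')"
      using 3 by (simp add: c_def d_def powr_minus field_simps)
    finally show ?thesis
      using 3 s' by (simp add: ennreal_mult)
  qed
  then show ?thesis by (simp add: s'_def)
qed

section \<open>Operators with the convexity of a mixed norm\<close>

lemma qsum_cmult: "0 < q \<Longrightarrow> qsum q (c * x) (c * y) = c * qsum q x y"
  unfolding qsum_def by (simp add: ennpow_mult distrib_left[symmetric] ennpow_inverse(1))

lemma qsum_mono: "0 < q \<Longrightarrow> x \<le> x' \<Longrightarrow> y \<le> y' \<Longrightarrow> qsum q x y \<le> qsum q x' y'"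
  unfolding qsum_def by (intro ennpow_mono add_mono) auto

text \<open>
  A monotone, homogeneous operator between nonnegative functions that is \<open>q\<close>-convex for all \<open>q \<le> a\<close> and \<open>q\<close>-concave for
  all \<open>q \<ge> b\<close>, with constant one.  A norm in one variable is such an operator, the remaining variables
  being parameters.  Operators rather than functionals are considered because this class
  is closed under composition, which yields the iterated norms.  An operator with values in the functions
  on the one-point space is a functional.
\<close>
locale norm_operator =
  fixes a b :: real and M :: "'a measure" and N :: "'b measure"
    and T :: "('a \<Rightarrow> ennreal) \<Rightarrow> 'b \<Rightarrow> ennreal"
  assumes measurable_T: "F \<in> borel_measurable M \<Longrightarrow> T F \<in> borel_measurable N"
    and mono_T: "(\<And>x. F x \<le> G x) \<Longrightarrow> T F y \<le> T G y"
    and cmult_T: "F \<in> borel_measurable M \<Longrightarrow> T (\<lambda>x. ennreal c * F x) y = ennreal c * T F y"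
    and SUP_T: "(\<And>k. H k \<in> borel_measurable M) \<Longrightarrow> incseq H \<Longrightarrow>
      T (\<lambda>x. SUP k. H k x) y = (SUP k::nat. T (H k) y)"
    and convex_T: "0 < q \<Longrightarrow> q \<le> a \<Longrightarrow> F \<in> borel_measurable M \<Longrightarrow> G \<in> borel_measurable M \<Longrightarrow>
      T (\<lambda>x. qsum q (F x) (G x)) y \<le> qsum q (T F y) (T G y)"
    and concave_T: "0 < q \<Longrightarrow> b \<le> q \<Longrightarrow> F \<in> borel_measurable M \<Longrightarrow> G \<in> borel_measurable M \<Longrightarrow>
      qsum q (T F y) (T G y) \<le> T (\<lambda>x. qsum q (F x) (G x)) y"
begin

lemma zero_T [simp]: "T (\<lambda>_. 0) y = 0"
  using cmult_T[of "\<lambda>_. 0" 0 y] by simp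

end

lemma norm_operator_comp:
  assumes "norm_operator a b M N T" and "norm_operator a b N K S"
  shows "norm_operator a b M K (\<lambda>F. S (T F))"
proof -
  interpret T: norm_operator a b M N T by fact
  interpret S: norm_operator a b N K S by fact
  show ?thesis
  proof
    fix F G :: "'a \<Rightarrow> ennreal" and y q
    assume m [measurable]: "F \<in> borel_measurable M" "G \<in> borel_measurable M"
    note [measurable] = T.measurable_T
    show "S (T (\<lambda>x. qsum q (F x) (G x))) y \<le> qsum q (S (T F) y) (S (T G) y)" if "0 < q" "q \<le> a"
    proof -
      have "S (T (\<lambda>x. qsum q (F x) (G x))) y \<le> S (\<lambda>x. qsum q (T F x) (T G x)) y"
        using that by (intro S.mono_T T.convex_T) auto
      also have "\<dots> \<le> qsum q (S (T F) y) (S (T G) y)"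
        using that by (intro S.convex_T) measurable
      finally show ?thesis .
    qed
    show "qsum q (S (T F) y) (S (T G) y) \<le> S (T (\<lambda>x. qsum q (F x) (G x))) y" if "0 < q" "b \<le> q"
    proof -
      have "qsum q (S (T F) y) (S (T G) y) \<le> S (\<lambda>x. qsum q (T F x) (T G x)) y"
        using that by (intro S.concave_T) measurable
      also have "\<dots> \<le> S (T (\<lambda>x. qsum q (F x) (G x))) y"
        using that by (intro S.mono_T T.concave_T) auto
      finally show ?thesis .
    qed
  next
    fix F :: "nat \<Rightarrow> 'a \<Rightarrow> ennreal" and y
    assume F: "\<And>k. F k \<in> borel_measurable M" "incseq F"
    have "T (\<lambda>x. SUP k. F k x) = (\<lambda>x. SUP k. T (F k) x)"
      using F by (intro ext T.SUP_T)
    moreover have "incseq (\<lambda>k. T (F k))"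
      using F by (auto simp: incseq_def le_fun_def intro!: T.mono_T)
    ultimately show "S (T (\<lambda>x. SUP k. F k x)) y = (SUP k. S (T (F k)) y)"
      using F T.measurable_T by (simp add: S.SUP_T)
  next
    fix F :: "'a \<Rightarrow> ennreal" and c y
    assume "F \<in> borel_measurable M"
    then have "T (\<lambda>x. ennreal c * F x) = (\<lambda>x. ennreal c * T F x)"
      by (intro ext T.cmult_T)
    then show "S (T (\<lambda>x. ennreal c * F x)) y = ennreal c * S (T F) y"
      using \<open>F \<in> _\<close> by (simp add: S.cmult_T T.measurable_T)
  qed (auto intro: S.measurable_T T.measurable_T S.mono_T T.mono_T)
qed

abbreviation upd :: "real ^ 'n \<Rightarrow> 'n \<Rightarrow> real \<Rightarrow> real ^ 'n" where
  "upd x i y \<equiv> (\<chi> j. if j = i then y else x $ j)"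

lemma measurable_upd [measurable]:
  "(\<lambda>(x :: real ^ 'n, y). upd x i y) \<in> borel_measurable (borel \<Otimes>\<^sub>M (borel :: real measure))"
proof -
  have "continuous_on UNIV (\<lambda>z :: (real ^ 'n) \<times> real. upd (fst z) i (snd z))"
  proof (rule continuous_on_vec_lambda)
    show "continuous_on UNIV (\<lambda>z :: (real ^ 'n) \<times> real. if j = i then snd z else fst z $ j)" for j
      by (cases "j = i") (auto intro!: continuous_intros)
  qed
  then show ?thesis
    by (simp add: borel_measurable_continuous_onI borel_prod case_prod_beta)
qed

lemma measurable_upd1 [measurable]: "upd x i \<in> borel_measurable (borel :: real measure)"
  using measurable_compose[OF measurable_Pair1' measurable_upd, of x i] by simp

lemma coord_norm_eq: "coord_norm i s F x = lnorm lborel s (\<lambda>y. F (upd x i y))"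
  by (simp add: coord_norm_def lnorm_def nn_integral_completion)

lemma coord_norm_const: "coord_norm i s F (upd x i y) = coord_norm i s F x"
  by (simp add: coord_norm_def if_distrib cong: if_cong)

lemma measurable_coord_norm:
  assumes [measurable]: "F \<in> borel_measurable borel"
  shows "coord_norm i s F \<in> borel_measurable borel"
proof -
  have "(\<lambda>(x, y). ennpow (F (upd x i y)) s) \<in> borel_measurable (borel \<Otimes>\<^sub>M (lborel :: real measure))"
    using measurable_compose[OF measurable_upd assms, of i]
    by (simp add: case_prod_beta measurable_ennpow cong: measurable_cong_sets)
  then have "(\<lambda>x. \<integral>\<^sup>+ y. ennpow (F (upd x i y)) s \<partial>lborel) \<in> borel_measurable borel"
    by (rule sigma_finite_measure.borel_measurable_nn_integral[OF sigma_finite_lborel])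
  then show ?thesis
    unfolding coord_norm_eq[abs_def] lnorm_def by measurable
qed

lemma norm_operator_coord_norm:
  fixes i :: "'n :: finite"
  assumes "0 < a" "a \<le> s" "s \<le> b"
  shows "norm_operator a b borel borel (coord_norm i s)"
proof
  have s: "0 < s" using assms by simp
  fix F G :: "real ^ 'n \<Rightarrow> ennreal" and y q
  assume "F \<in> borel_measurable borel" "G \<in> borel_measurable borel"
  then have [measurable]: "(\<lambda>z. F (upd y i z)) \<in> borel_measurable lborel"
      "(\<lambda>z. G (upd y i z)) \<in> borel_measurable lborel"
    using measurable_compose[OF measurable_upd1] by auto
  show "coord_norm i s (\<lambda>x. qsum q (F x) (G x)) y \<le> qsum q (coord_norm i s F y) (coord_norm i s G y)"
    if "0 < q" "q \<le> a"
    unfolding coord_norm_eq using that assms by (intro lnorm_qsum_le) auto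
  show "qsum q (coord_norm i s F y) (coord_norm i s G y) \<le> coord_norm i s (\<lambda>x. qsum q (F x) (G x)) y"
    if "0 < q" "b \<le> q"
    unfolding coord_norm_eq using that assms by (intro lnorm_qsum_ge) auto
  show "coord_norm i s (\<lambda>x. ennreal c * F x) y = ennreal c * coord_norm i s F y" for c
    unfolding coord_norm_eq using s by (intro lnorm_cmult) auto
next
  have s: "0 < s" using assms by simp
  fix F :: "nat \<Rightarrow> real ^ 'n \<Rightarrow> ennreal" and y
  assume [measurable]: "\<And>k. F k \<in> borel_measurable borel" and "incseq F"
  then show "coord_norm i s (\<lambda>x. SUP k. F k x) y = (SUP k. coord_norm i s (F k) y)"
    unfolding coord_norm_eq using s measurable_compose[OF measurable_upd1]
    by (intro lnorm_SUP) (auto simp: incseq_def le_fun_def)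
next
  have s: "0 < s" using assms by simp
  show "coord_norm i s F y \<le> coord_norm i s G y" if "\<And>x. F x \<le> G x" for F G and y :: "real ^ 'n"
    unfolding coord_norm_eq using s that by (intro lnorm_mono) auto
qed (rule measurable_coord_norm)

lemma norm_operator_id: "norm_operator a b M M (\<lambda>F. F)"
  by standard auto

definition iter_norm :: "real ^ 'n \<Rightarrow> 'n list \<Rightarrow> (real ^ 'n \<Rightarrow> ennreal) \<Rightarrow> real ^ 'n \<Rightarrow> ennreal" where
  "iter_norm p is = fold (\<lambda>i. coord_norm i (p $ i)) is"

lemma iter_norm_Nil [simp]: "iter_norm p [] F = F"
  by (simp add: iter_norm_def)

lemma iter_norm_snoc: "iter_norm p (is @ [i]) F = coord_norm i (p $ i) (iter_norm p is F)"
  by (simp add: iter_norm_def)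

lemma iter_norm_snoc_eq:
  "iter_norm p (is @ [i]) F x = lnorm lborel (p $ i) (\<lambda>y. iter_norm p is F (upd x i y))"
  by (simp add: iter_norm_snoc coord_norm_eq)

lemma norm_operator_iter_norm:
  assumes "0 < a" "\<And>i. a \<le> p $ i" "\<And>i. p $ i \<le> b"
  shows "norm_operator a b borel borel (iter_norm p is)"
proof (induction "is" rule: rev_induct)
  case Nil
  show ?case using norm_operator_id by simp
next
  case (snoc i "is")
  show ?case
    using norm_operator_comp[OF snoc norm_operator_coord_norm[OF assms(1,2,3)]]
    by (simp add: iter_norm_snoc)
qed

lemma norm_operator_lnorm:
  assumes "0 < a" "a \<le> s" "s \<le> b"
  shows "norm_operator a b M (count_space (UNIV :: unit set)) (\<lambda>F _. lnorm M s F)"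
  using assms
  by unfold_locales (auto intro!: lnorm_mono lnorm_cmult lnorm_SUP lnorm_qsum_le lnorm_qsum_ge)

text \<open>
  Restricting a function to the sets of a family and taking a weighted norm of each restriction; the
  Bourgain-Morrey norm is this operator for the dyadic cubes, followed by a sequence norm.
\<close>
lemma norm_operator_family:
  fixes T :: "'i \<Rightarrow> ('a \<Rightarrow> ennreal) \<Rightarrow> 'b \<Rightarrow> ennreal"
  assumes T: "\<And>i. norm_operator a b M N (T i)" and C: "\<And>i. C i \<in> sets M"
    and y: "y \<in> space N"
  shows "norm_operator a b M (count_space UNIV)
    (\<lambda>F i. ennreal (w i) * T i (\<lambda>x. F x * indicator (C i) x) y)"
proof
  fix F G :: "'a \<Rightarrow> ennreal" and i q
  interpret norm_operator a b M N "T i" by (rule T)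
  note [measurable] = C
  assume [measurable]: "F \<in> borel_measurable M" "G \<in> borel_measurable M"
  have ind: "(\<lambda>x. qsum q (F x) (G x) * indicator (C i) x)
      = (\<lambda>x. qsum q (F x * indicator (C i) x) (G x * indicator (C i) x))" if "0 < q"
    using qsum_cmult[OF that, of "indicator (C i) x" "F x" "G x" for x]
    by (simp add: mult.commute)
  show "ennreal (w i) * T i (\<lambda>x. qsum q (F x) (G x) * indicator (C i) x) y
      \<le> qsum q (ennreal (w i) * T i (\<lambda>x. F x * indicator (C i) x) y)
          (ennreal (w i) * T i (\<lambda>x. G x * indicator (C i) x) y)" if "0 < q" "q \<le> a"
    unfolding ind[OF that(1)] qsum_cmult[OF that(1)]
    using that by (intro mult_left_mono convex_T) auto
  show "qsum q (ennreal (w i) * T i (\<lambda>x. F x * indicator (C i) x) y)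
          (ennreal (w i) * T i (\<lambda>x. G x * indicator (C i) x) y)
      \<le> ennreal (w i) * T i (\<lambda>x. qsum q (F x) (G x) * indicator (C i) x) y" if "0 < q" "b \<le> q"
    unfolding ind[OF that(1)] qsum_cmult[OF that(1)]
    using that by (intro mult_left_mono concave_T) auto
  show "ennreal (w i) * T i (\<lambda>x. ennreal c * F x * indicator (C i) x) y
      = ennreal c * (ennreal (w i) * T i (\<lambda>x. F x * indicator (C i) x) y)" for c
    using cmult_T[of "\<lambda>x. F x * indicator (C i) x" c y] by (simp add: mult_ac)
next
  fix F G :: "'a \<Rightarrow> ennreal" and i
  interpret norm_operator a b M N "T i" by (rule T)
  assume "\<And>x. F x \<le> G x"
  then show "ennreal (w i) * T i (\<lambda>x. F x * indicator (C i) x) y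
      \<le> ennreal (w i) * T i (\<lambda>x. G x * indicator (C i) x) y"
    by (intro mult_left_mono mono_T mult_right_mono) auto
next
  fix F :: "nat \<Rightarrow> 'a \<Rightarrow> ennreal" and i
  interpret norm_operator a b M N "T i" by (rule T)
  assume [measurable]: "\<And>k. F k \<in> borel_measurable M" and inc: "incseq F"
  note [measurable] = C
  have "T i (\<lambda>x. (SUP k. F k x) * indicator (C i) x) y = T i (\<lambda>x. SUP k. F k x * indicator (C i) x) y"
    by (simp add: SUP_mult_right_ennreal)
  also have "\<dots> = (SUP k. T i (\<lambda>x. F k x * indicator (C i) x) y)"
    using inc by (intro SUP_T) (auto simp: incseq_def le_fun_def intro!: mult_right_mono)
  finally show "ennreal (w i) * T i (\<lambda>x. (SUP k. F k x) * indicator (C i) x) y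
    = (SUP k. ennreal (w i) * T i (\<lambda>x. F k x * indicator (C i) x) y)"
    by (simp add: SUP_mult_left_ennreal)
qed auto

section \<open>Iterated integrals, Hoelder and norming functions for the mixed norm\<close>

lemma upd_eq: "upd x i y = x + (y - x $ i) *\<^sub>R axis i 1"
  by (simp add: vec_eq_iff axis_def)

lemma nn_integral_lborel_shift:
  fixes f :: "'a::euclidean_space \<Rightarrow> ennreal"
  assumes [measurable]: "f \<in> borel_measurable borel"
  shows "(\<integral>\<^sup>+ x. f (c + x) \<partial>lborel) = (\<integral>\<^sup>+ x. f x \<partial>lborel)"
  by (subst (2) lborel_distr_plus[of c, symmetric]) (simp add: nn_integral_distr)

text \<open>
  The section through \<open>x\<close> in direction \<open>i\<close> is a translate of \<open>y \<mapsto> x + y e\<^sub>i\<close>.  For fixed \<open>y\<close> the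
  translation \<open>x \<mapsto> x + y e\<^sub>i\<close> preserves null sets, so Fubini's theorem on pairs \<open>(x, y)\<close> gives the
  claim.
\<close>
lemma AE_upd:
  fixes P :: "real ^ 'n \<Rightarrow> bool"
  assumes "AE x in lborel. P x"
  shows "AE x in lborel. AE y in lborel. P (upd x i y)"
proof -
  obtain N where N: "N \<in> null_sets lborel" "{x. \<not> P x} \<subseteq> N"
    using assms by (auto simp: eventually_ae_filter)
  have [measurable]: "N \<in> sets borel" using N by auto
  let ?e = "axis i 1 :: real ^ 'n"
  have [measurable]: "(\<lambda>z :: (real ^ 'n) \<times> real. fst z + snd z *\<^sub>R ?e) \<in> borel_measurable (lborel \<Otimes>\<^sub>M lborel)"
    by measurable
  have m: "(\<lambda>(x, y). indicator N (x + y *\<^sub>R ?e) :: ennreal) \<in> borel_measurable (lborel \<Otimes>\<^sub>M lborel)"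
    by measurable
  have "(\<integral>\<^sup>+ x. indicator N (x + y *\<^sub>R ?e) \<partial>lborel) = (0 :: ennreal)" for y
    using nn_integral_lborel_shift[of "indicator N" "y *\<^sub>R ?e"] N
    by (simp add: add.commute null_setsD1)
  then have "(\<integral>\<^sup>+ x. \<integral>\<^sup>+ y. indicator N (x + y *\<^sub>R ?e) \<partial>lborel \<partial>lborel) = (0 :: ennreal)"
    using lborel_pair.Fubini'[OF m] by simp
  moreover have "(\<lambda>x. \<integral>\<^sup>+ y. indicator N (x + y *\<^sub>R ?e) \<partial>lborel :: ennreal) \<in> borel_measurable lborel"
    using m by (rule lborel.borel_measurable_nn_integral)
  ultimately have "AE x in lborel. (\<integral>\<^sup>+ y. indicator N (x + y *\<^sub>R ?e) \<partial>lborel) = (0 :: ennreal)"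
    by (simp add: nn_integral_0_iff_AE)
  then show ?thesis
  proof eventually_elim
    case (elim x)
    have "(\<integral>\<^sup>+ y. indicator N (upd x i y) \<partial>lborel) = (\<integral>\<^sup>+ y. indicator N (x + (- (x $ i) + y) *\<^sub>R ?e) \<partial>lborel)"
      by (simp add: upd_eq)
    also have "\<dots> = (\<integral>\<^sup>+ y. indicator N (x + y *\<^sub>R ?e) \<partial>lborel)"
      by (rule nn_integral_lborel_shift[of "\<lambda>y. indicator N (x + y *\<^sub>R ?e)"]) measurable
    finally have "(\<integral>\<^sup>+ y. indicator N (upd x i y) \<partial>lborel) = (0 :: ennreal)"
      using elim by simp
    moreover have "(\<lambda>y. indicator N (upd x i y) :: ennreal) \<in> borel_measurable lborel"
      using measurable_compose[OF measurable_upd1[of i x], of "indicator N :: _ \<Rightarrow> ennreal" borel] by simp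
    ultimately have "AE y in lborel. indicator N (upd x i y) = (0 :: ennreal)"
      by (simp add: nn_integral_0_iff_AE)
    then show ?case
      by (rule eventually_mono) (use N(2) in \<open>auto simp: indicator_def split: if_splits\<close>)
  qed
qed

text \<open>
  Arbitrary functions are admitted because some sections of a Lebesgue measurable function may fail to be measurable; this
  is the step that replaces such a function by a Borel one.
\<close>
lemma coord_norm_cong_AE:
  assumes "AE x in lborel. F x = G x"
  shows "AE x in lborel. coord_norm i s F x = coord_norm i s G x"
  using AE_upd[OF assms, of i]
proof eventually_elim
  case (elim x)
  then have "(\<integral>\<^sup>+ y. ennpow (F (upd x i y)) s \<partial>lborel) = (\<integral>\<^sup>+ y. ennpow (G (upd x i y)) s \<partial>lborel)"
    by (intro nn_integral_cong_AE) auto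
  then show ?case by (simp add: coord_norm_eq lnorm_def)
qed

lemma iter_norm_cong_AE:
  assumes "AE x in lborel. F x = G x"
  shows "AE x in lborel. iter_norm p is F x = iter_norm p is G x"
proof (induction "is" rule: rev_induct)
  case (snoc i "is")
  then show ?case by (simp add: iter_norm_snoc coord_norm_cong_AE)
qed (simp add: assms)

lemma iter_norm_agree:
  "(\<And>j. j \<notin> set is \<Longrightarrow> x $ j = x' $ j) \<Longrightarrow> iter_norm p is F x = iter_norm p is F x'"
proof (induction "is" arbitrary: x x' rule: rev_induct)
  case Nil
  then have "x = x'" by (simp add: vec_eq_iff)
  then show ?case by simp
next
  case (snoc i "is")
  have "iter_norm p is F (upd x i y) = iter_norm p is F (upd x' i y)" for y
    using snoc.prems by (intro snoc.IH) auto
  then show ?case by (simp add: iter_norm_snoc_eq)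
qed

lemma measurable_iter_norm:
  "F \<in> borel_measurable borel \<Longrightarrow> iter_norm p is F \<in> borel_measurable borel"
  by (induction "is" rule: rev_induct) (auto simp: iter_norm_snoc intro: measurable_coord_norm)

lemma iter_norm_mult_const:
  assumes [measurable]: "G \<in> borel_measurable borel" and p: "\<And>i. 0 < p $ i"
    and K: "\<And>x x'. (\<And>j. j \<notin> set is \<Longrightarrow> x $ j = x' $ j) \<Longrightarrow> K x = K x'"
  shows "iter_norm p is (\<lambda>x. K x * G x) x = K x * iter_norm p is G x"
  using K
proof (induction "is" arbitrary: x rule: rev_induct)
  case Nil
  show ?case by simp
next
  case (snoc i "is")
  have "iter_norm p is (\<lambda>x. K x * G x) x = K x * iter_norm p is G x" for x
    by (rule snoc.IH, rule snoc.prems) simp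
  then have "coord_norm i (p $ i) (iter_norm p is (\<lambda>x. K x * G x)) x
      = lnorm lborel (p $ i) (\<lambda>y. K (upd x i y) * iter_norm p is G (upd x i y))"
    by (simp add: coord_norm_eq)
  also have "(\<lambda>y. K (upd x i y) * iter_norm p is G (upd x i y)) = (\<lambda>y. K x * iter_norm p is G (upd x i y))"
    by (rule ext, rule arg_cong2[of _ _ _ _ "(*)"], rule snoc.prems) simp_all
  also have "lnorm lborel (p $ i) \<dots> = K x * coord_norm i (p $ i) (iter_norm p is G) x"
    unfolding coord_norm_eq
    using measurable_compose[OF measurable_upd1 measurable_iter_norm[OF assms(1)]] p
    by (intro lnorm_cmult) auto
  finally show ?case by (simp add: iter_norm_snoc)
qed

text \<open>
  With all exponents equal to one the iterated norm is an iterated integral.  Lebesgue measure is by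
  definition the image of a product measure indexed by the basis vectors, hence the coordinates are addressed
  as \<open>axis j 1\<close>.
\<close>
lemma iter_norm_1_PiM:
  fixes F :: "real ^ 'n \<Rightarrow> ennreal"
  assumes [measurable]: "F \<in> borel_measurable borel" and "distinct is"
  shows "iter_norm 1 is F x = (\<integral>\<^sup>+ f. F (\<chi> j. if j \<in> set is then f (axis j 1) else x $ j)
    \<partial>(\<Pi>\<^sub>M b\<in>(\<lambda>j. axis j 1 :: real ^ 'n) ` set is. lborel))"
  using assms(2)
proof (induction "is" arbitrary: x rule: rev_induct)
  case Nil
  show ?case by (simp add: PiM_empty nn_integral_count_space_finite)
next
  case (snoc i "is")
  interpret product_sigma_finite "\<lambda>_ :: real ^ 'n. lborel :: real measure" ..
  let ?ax = "\<lambda>j. axis j 1 :: real ^ 'n"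
  let ?g = "\<lambda>f. (\<chi> j. if j \<in> set (is @ [i]) then f (?ax j) else x $ j)"
  have inj: "?ax j = ?ax k \<longleftrightarrow> j = k" for j k
    by (auto simp: axis_eq_axis)
  have ni: "?ax i \<notin> ?ax ` set is"
    using snoc.prems inj by auto
  have "?g \<in> borel_measurable (\<Pi>\<^sub>M b\<in>?ax ` set (is @ [i]). lborel)"
  proof (subst borel_measurable_euclidean_space, safe)
    fix b :: "real ^ 'n" assume "b \<in> Basis"
    then obtain k where b: "b = ?ax k" by (auto simp: Basis_vec_def)
    show "(\<lambda>f. ?g f \<bullet> b) \<in> borel_measurable (\<Pi>\<^sub>M b\<in>?ax ` set (is @ [i]). lborel)"
    proof (cases "k \<in> set (is @ [i])")
      case True
      then have "(\<lambda>f. f (?ax k)) \<in> measurable (\<Pi>\<^sub>M b\<in>?ax ` set (is @ [i]). lborel) (lborel :: real measure)"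
        by (intro measurable_component_singleton) auto
      then show ?thesis using True by (simp add: b inner_axis)
    qed (simp add: b inner_axis)
  qed
  then have m: "(\<lambda>f. F (?g f)) \<in> borel_measurable (\<Pi>\<^sub>M b\<in>insert (?ax i) (?ax ` set is). lborel)"
    using measurable_compose[OF _ assms(1)] by simp
  have "iter_norm 1 (is @ [i]) F x = (\<integral>\<^sup>+ y. iter_norm 1 is F (upd x i y) \<partial>lborel)"
    by (simp add: iter_norm_snoc_eq lnorm_def)
  also have "\<dots> = (\<integral>\<^sup>+ y. \<integral>\<^sup>+ f. F (\<chi> j. if j \<in> set is then f (?ax j) else upd x i y $ j)
    \<partial>(\<Pi>\<^sub>M b\<in>?ax ` set is. lborel) \<partial>lborel)"
    using snoc by (intro nn_integral_cong) simp
  also have "\<dots> = (\<integral>\<^sup>+ y. \<integral>\<^sup>+ f. F (?g (f (?ax i := y))) \<partial>(\<Pi>\<^sub>M b\<in>?ax ` set is. lborel) \<partial>lborel)"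
    using snoc.prems by (intro nn_integral_cong arg_cong[of _ _ F] iffD2[OF vec_eq_iff] allI) (auto simp: inj)
  also have "\<dots> = (\<integral>\<^sup>+ f. F (?g f) \<partial>(\<Pi>\<^sub>M b\<in>insert (?ax i) (?ax ` set is). lborel))"
    using ni m by (subst product_nn_integral_insert_rev) auto
  finally show ?case by simp
qed

lemma iter_norm_1:
  fixes F :: "real ^ 'n \<Rightarrow> ennreal"
  assumes [measurable]: "F \<in> borel_measurable borel" and "distinct is" "set is = UNIV"
  shows "iter_norm 1 is F x = (\<integral>\<^sup>+ z. F z \<partial>lborel)"
proof -
  have B: "(\<lambda>j. axis j 1 :: real ^ 'n) ` UNIV = Basis"
    by (auto simp: Basis_vec_def)
  have "(\<Sum>b\<in>Basis. f b *\<^sub>R b) = (\<chi> j. f (axis j 1 :: real ^ 'n))" for f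
    by (rule euclidean_eqI) (auto simp: inner_sum_left inner_Basis if_distrib B[symmetric] inner_axis cong: if_cong
      simp del: B)
  then have e: "(\<lambda>f. \<Sum>b\<in>Basis. f b *\<^sub>R b) = (\<lambda>f. \<chi> j. f (axis j 1 :: real ^ 'n))"
    by (rule ext)
  have "(\<integral>\<^sup>+ z. F z \<partial>lborel) = (\<integral>\<^sup>+ f. F (\<Sum>b\<in>Basis. f b *\<^sub>R b) \<partial>(\<Pi>\<^sub>M b\<in>Basis. lborel))"
    by (subst lborel_eq) (rule nn_integral_distr; measurable)
  then have "(\<integral>\<^sup>+ z. F z \<partial>lborel) = (\<integral>\<^sup>+ f. F (\<chi> j. f (axis j 1 :: real ^ 'n)) \<partial>(\<Pi>\<^sub>M b\<in>Basis. lborel))"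
    by (simp only: e[THEN fun_cong])
  then show ?thesis
    using iter_norm_1_PiM[OF assms(1,2), of x] assms(3) B by simp
qed

lemma conj_vec_nth [simp]: "conj_vec p $ i = conj_exp (p $ i)"
  by (simp add: conj_vec_def)

text \<open>
  One application of Hoelder's inequality for each variable, from the innermost outwards.
\<close>
lemma Hoelder_iter_norm:
  assumes "F \<in> borel_measurable borel" "G \<in> borel_measurable borel" and p: "\<And>i. 1 < p $ i"
  shows "iter_norm 1 is (\<lambda>x. F x * G x) x \<le> iter_norm p is F x * iter_norm (conj_vec p) is G x"
proof (induction "is" arbitrary: x rule: rev_induct)
  case (snoc i "is")
  have [measurable]: "(\<lambda>y. iter_norm p is F (upd x i y)) \<in> borel_measurable lborel"
    "(\<lambda>y. iter_norm (conj_vec p) is G (upd x i y)) \<in> borel_measurable lborel"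
    using measurable_compose[OF measurable_upd1 measurable_iter_norm] assms by auto
  have "iter_norm 1 (is @ [i]) (\<lambda>x. F x * G x) x = (\<integral>\<^sup>+ y. iter_norm 1 is (\<lambda>x. F x * G x) (upd x i y) \<partial>lborel)"
    by (simp add: iter_norm_snoc_eq lnorm_def)
  also have "\<dots> \<le> (\<integral>\<^sup>+ y. iter_norm p is F (upd x i y) * iter_norm (conj_vec p) is G (upd x i y) \<partial>lborel)"
    by (intro nn_integral_mono snoc.IH)
  also have "\<dots> \<le> lnorm lborel (p $ i) (\<lambda>y. iter_norm p is F (upd x i y))
      * lnorm lborel (conj_exp (p $ i)) (\<lambda>y. iter_norm (conj_vec p) is G (upd x i y))"
    using p by (intro Hoelder_lnorm) auto
  finally show ?case by (simp add: iter_norm_snoc_eq)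
qed simp

text \<open>
  The case of equality in Hoelder's inequality: for \<open>n = \<parallel>H\<parallel>\<close> the function \<open>(H / n)\<^sup>s\<^sup>-\<^sup>1\<close> has conjugate norm one and its
  integral against \<open>H\<close> is \<open>n\<close>.  The value \<open>0\<close> in the degenerate cases keeps it finite everywhere.
\<close>
definition norming :: "real \<Rightarrow> ennreal \<Rightarrow> ennreal \<Rightarrow> ennreal" where
  "norming s n h = (if n = 0 \<or> n = top \<or> h = top then 0 else ennreal ((enn2real h / enn2real n) powr (s - 1)))"

lemma norming_finite: "norming s n h < top"
  by (simp add: norming_def)

lemma measurable_norming [measurable (raw)]:
  assumes [measurable]: "f \<in> borel_measurable M" "g \<in> borel_measurable M"
  shows "(\<lambda>x. norming s (f x) (g x)) \<in> borel_measurable M"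
  unfolding norming_def by measurable

lemma nn_integral_norming:
  assumes s: "1 < s" and [measurable]: "H \<in> borel_measurable M" and fin: "lnorm M s H < top"
  shows "(\<integral>\<^sup>+ x. H x * norming s (lnorm M s H) (H x) \<partial>M) = lnorm M s H"
proof (cases "lnorm M s H = 0")
  case True
  then show ?thesis by (simp add: norming_def)
next
  case False
  obtain n where n: "lnorm M s H = ennreal n" "0 < n"
    using fin False by (metis ennreal_cases ennreal_0 less_irrefl order_le_less)
  have I: "(\<integral>\<^sup>+ x. ennpow (H x) s \<partial>M) = ennreal (n powr s)"
    using n s by (metis ennpow_ennreal ennpow_inverse(2) less_imp_le lnorm_def less_trans zero_less_one)
  have "AE x in M. ennpow (H x) s \<noteq> \<infinity>"
    using I by (intro nn_integral_noteq_infinite) auto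
  then have "AE x in M. H x * norming s (lnorm M s H) (H x) = ennreal (n powr (1 - s)) * ennpow (H x) s"
  proof eventually_elim
    case (elim x)
    then obtain h where h: "H x = ennreal h" "0 \<le> h"
      by (cases "H x") auto
    have "h * (h / n) powr (s - 1) = n powr (1 - s) * h powr s"
    proof (cases "h = 0")
      case False
      then have "h * (h / n) powr (s - 1) = h powr 1 * h powr (s - 1) * n powr (- (s - 1))"
        using h n False powr_divide[of h n "s - 1"] powr_minus_divide[of n "s - 1"] by simp
      also have "h powr 1 * h powr (s - 1) = h powr s"
        by (subst powr_add[symmetric]) simp
      also have "h powr s * n powr (- (s - 1)) = n powr (1 - s) * h powr s"
        by simp
      finally show ?thesis .
    qed simp
    then show ?case
      using h n by (simp add: norming_def ennpow_ennreal ennreal_mult[symmetric])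
  qed
  then have "(\<integral>\<^sup>+ x. H x * norming s (lnorm M s H) (H x) \<partial>M)
      = (\<integral>\<^sup>+ x. ennreal (n powr (1 - s)) * ennpow (H x) s \<partial>M)"
    by (rule nn_integral_cong_AE)
  also have "\<dots> = ennreal (n powr (1 - s)) * ennreal (n powr s)"
    by (simp add: nn_integral_cmult I)
  also have "\<dots> = ennreal n"
    using n by (simp add: ennreal_mult[symmetric] powr_add[symmetric])
  finally show ?thesis using n by simp
qed

lemma lnorm_norming_le:
  assumes s: "1 < s" and [measurable]: "H \<in> borel_measurable M"
  shows "lnorm M (conj_exp s) (\<lambda>x. norming s (lnorm M s H) (H x)) \<le> 1"
proof (cases "lnorm M s H = 0 \<or> lnorm M s H = top")
  case True
  then have "norming s (lnorm M s H) h = 0" for h by (auto simp: norming_def)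
  then show ?thesis by (simp add: lnorm_def)
next
  case False
  then obtain n where n: "lnorm M s H = ennreal n" "0 < n"
    by (metis ennreal_cases ennreal_0 less_irrefl order_le_less)
  have I: "(\<integral>\<^sup>+ x. ennpow (H x) s \<partial>M) = ennreal (n powr s)"
    using n s by (metis ennpow_ennreal ennpow_inverse(2) less_imp_le lnorm_def less_trans zero_less_one)
  have "ennpow (norming s (lnorm M s H) (H x)) (conj_exp s) \<le> ennreal (n powr - s) * ennpow (H x) s" for x
  proof (cases "H x")
    case (real h)
    have e: "(s - 1) * conj_exp s = s"
      using s by (simp add: conj_exp_def)
    have "ennpow (norming s (lnorm M s H) (H x)) (conj_exp s) = ennreal ((h / n) powr s)"
      using real n by (simp add: norming_def ennpow_ennreal powr_powr e)
    also have "(h / n) powr s = n powr - s * h powr s"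
      using real n by (simp add: powr_divide powr_minus_divide)
    finally show ?thesis
      using real by (simp add: ennpow_ennreal ennreal_mult)
  qed (simp add: norming_def)
  then have "(\<integral>\<^sup>+ x. ennpow (norming s (lnorm M s H) (H x)) (conj_exp s) \<partial>M)
      \<le> (\<integral>\<^sup>+ x. ennreal (n powr - s) * ennpow (H x) s \<partial>M)"
    by (intro nn_integral_mono)
  also have "\<dots> = ennreal (n powr - s) * ennreal (n powr s)"
    by (simp add: nn_integral_cmult I)
  also have "\<dots> = 1"
    using n by (simp add: ennreal_mult[symmetric] powr_add[symmetric])
  finally show ?thesis
    using conj_exp_pos[OF s] by (simp add: lnorm_def ennpow_le_iff)
qed

text \<open>
  The extremal function for an iterated norm is the product of the extremal functions of the single steps.
  The factor \<open>K\<close> of the outermost variable \<open>i\<close> does not depend on the earlier variables, so it can be pulled out of their norms.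
  Finiteness of the norm at a point is assumed only there: it forces the inner norms to be finite almost
  everywhere along the \<open>i\<close>-th direction, which is all that the integral over this variable sees.
\<close>
lemma ex_norming_iter_norm:
  assumes F: "F \<in> borel_measurable borel" and p: "\<And>i. 1 < p $ i"
  shows "\<exists>G \<in> borel_measurable borel. (\<forall>x. G x < top) \<and> (\<forall>x. iter_norm (conj_vec p) is G x \<le> 1) \<and>
    (\<forall>x. iter_norm p is F x < top \<longrightarrow> iter_norm 1 is (\<lambda>x. F x * G x) x = iter_norm p is F x)"
proof (induction "is" rule: rev_induct)
  case Nil
  show ?case by (intro bexI[of _ "\<lambda>_. 1"]) auto
next
  case (snoc i "is")
  then obtain G where [measurable]: "G \<in> borel_measurable borel"
    and G: "\<And>x. G x < top" "\<And>x. iter_norm (conj_vec p) is G x \<le> 1"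
      "\<And>x. iter_norm p is F x < top \<Longrightarrow> iter_norm 1 is (\<lambda>x. F x * G x) x = iter_norm p is F x"
    by blast
  define H where "H = iter_norm p is F"
  define K where "K x = norming (p $ i) (coord_norm i (p $ i) H x) (H x)" for x
  note [measurable] = F
  have H [measurable]: "H \<in> borel_measurable borel"
    unfolding H_def by (rule measurable_iter_norm[OF F])
  have Hu [measurable]: "(\<lambda>y. H (upd x i y)) \<in> borel_measurable lborel" for x
    using measurable_compose[OF measurable_upd1 H] by simp
  note [measurable] = measurable_coord_norm[OF H]
  have K_m [measurable]: "K \<in> borel_measurable borel"
    unfolding K_def by measurable
  have K_agree: "K x = K x'" if "\<And>j. j \<notin> set is \<Longrightarrow> x $ j = x' $ j" for x x'
  proof -
    have "H x = H x'" "\<And>y. H (upd x i y) = H (upd x' i y)"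
      unfolding H_def using that by (auto intro!: iter_norm_agree)
    then show ?thesis by (simp add: K_def coord_norm_eq)
  qed
  have K_upd: "K (upd x i y) = norming (p $ i) (lnorm lborel (p $ i) (\<lambda>y. H (upd x i y))) (H (upd x i y))" for x y
    by (simp add: K_def coord_norm_const) (simp add: coord_norm_eq)
  have cp: "0 < conj_vec p $ j" for j
    using p by (simp add: conj_exp_pos)
  show ?case
  proof (intro bexI[of _ "\<lambda>x. K x * G x"] conjI allI impI)
    show "(\<lambda>x. K x * G x) \<in> borel_measurable borel" by measurable
    show "K x * G x < top" for x
      using G(1) norming_finite by (simp add: K_def ennreal_mult_less_top)
    fix x
    have "iter_norm (conj_vec p) is (\<lambda>x. K x * G x) z \<le> K z" for z
      using mult_left_mono[OF G(2), of "K z" z]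
      by (subst iter_norm_mult_const[OF _ cp K_agree]) auto
    then have "iter_norm (conj_vec p) (is @ [i]) (\<lambda>x. K x * G x) x
        \<le> lnorm lborel (conj_exp (p $ i)) (\<lambda>y. K (upd x i y))"
      using cp[of i] by (simp add: iter_norm_snoc_eq lnorm_mono)
    also have "\<dots> \<le> 1"
      unfolding K_upd using p by (intro lnorm_norming_le) auto
    finally show "iter_norm (conj_vec p) (is @ [i]) (\<lambda>x. K x * G x) x \<le> 1" .
    assume "iter_norm p (is @ [i]) F x < top"
    then have fin: "lnorm lborel (p $ i) (\<lambda>y. H (upd x i y)) < top"
      by (simp add: iter_norm_snoc_eq H_def)
    have one: "iter_norm 1 is (\<lambda>x. F x * (K x * G x)) z = K z * iter_norm 1 is (\<lambda>x. F x * G x) z" for z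
      using iter_norm_mult_const[of "\<lambda>x. F x * G x" 1 "is" K z, OF _ _ K_agree] by (simp add: mult_ac)
    have "K z * iter_norm 1 is (\<lambda>x. F x * G x) z = H z * K z" for z
      using G(3)[of z] by (cases "H z = top") (auto simp: H_def K_def norming_def less_top mult.commute)
    then have "iter_norm 1 (is @ [i]) (\<lambda>x. F x * (K x * G x)) x
        = (\<integral>\<^sup>+ y. H (upd x i y) * K (upd x i y) \<partial>lborel)"
      by (simp add: iter_norm_snoc_eq lnorm_def one)
    also have "\<dots> = lnorm lborel (p $ i) (\<lambda>y. H (upd x i y))"
      unfolding K_upd using p fin by (intro nn_integral_norming) auto
    finally show "iter_norm 1 (is @ [i]) (\<lambda>x. F x * (K x * G x)) x = iter_norm p (is @ [i]) F x"
      by (simp add: iter_norm_snoc_eq H_def)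
  qed
qed

section \<open>Two-point inequalities\<close>

lemma powr_superadditive:
  fixes x y \<alpha> :: real
  assumes "0 \<le> x" "0 \<le> y" "1 \<le> \<alpha>"
  shows "x powr \<alpha> + y powr \<alpha> \<le> (x + y) powr \<alpha>"
proof -
  have *: "z powr \<alpha> \<le> z * (x + y) powr (\<alpha> - 1)" if "0 \<le> z" "z \<le> x + y" for z
  proof (cases "z = 0")
    case False
    then have "z powr \<alpha> = z * z powr (\<alpha> - 1)"
      using that by (simp add: powr_mult_base)
    also have "\<dots> \<le> z * (x + y) powr (\<alpha> - 1)"
      using that assms by (intro mult_left_mono powr_mono2) auto
    finally show ?thesis .
  qed simp
  have "x powr \<alpha> + y powr \<alpha> \<le> x * (x + y) powr (\<alpha> - 1) + y * (x + y) powr (\<alpha> - 1)"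
    using assms by (intro add_mono *) auto
  also have "\<dots> = (x + y) powr \<alpha>"
    using assms by (cases "x + y = 0") (auto simp: powr_mult_base simp flip: distrib_right)
  finally show ?thesis .
qed

text \<open>
  Midpoint convexity of \<open>z\<^sup>q - q (q - 1) / 4 \<cdot> z\<^sup>2\<close> on \<open>(0, 2)\<close> at the points \<open>1 + x\<close> and \<open>1 - x\<close>; the second
  derivative is nonnegative since \<open>z\<^sup>q\<^sup>-\<^sup>2 \<ge> 2\<^sup>q\<^sup>-\<^sup>2 \<ge> 1/2\<close>.  At \<open>x = 1\<close> the point \<open>0\<close> lies outside this
  interval and the inequality is checked by hand.
\<close>
lemma two_point_lower_unit:
  fixes q x :: real
  assumes q: "1 < q" "q \<le> 2" and x: "0 \<le> x" "x \<le> 1"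
  shows "1 + q * (q - 1) / 4 * x\<^sup>2 \<le> ((1 + x) powr q + (1 - x) powr q) / 2"
proof (cases "x = 1")
  case True
  have "ln (1 / 2) \<le> 1 / 2 - (1 :: real)" by (rule ln_le_minus_one) simp
  then have ln2: "1 / 2 \<le> ln (2 :: real)" by (simp add: ln_div)
  have "1 + q * (q - 1) / 4 \<le> 1 + (q - 1) * (1 / 2)"
    using mult_right_mono[of q 2 "q - 1"] q by simp
  also have "\<dots> \<le> 1 + (q - 1) * ln 2"
    using q ln2 by (intro add_left_mono mult_left_mono) auto
  also have "\<dots> \<le> exp ((q - 1) * ln 2)" by (rule exp_ge_add_one_self)
  also have "\<dots> = 2 powr q / 2" by (simp add: powr_def left_diff_distrib exp_diff)
  finally show ?thesis using True by simp
next
  case False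
  define \<kappa> where "\<kappa> = q * (q - 1) / 4"
  have "convex_on {0<..<2} (\<lambda>z. z powr q - \<kappa> * z\<^sup>2)"
  proof (rule f''_ge0_imp_convex)
    fix z :: real assume z: "z \<in> {0<..<2}"
    show "((\<lambda>z. z powr q - \<kappa> * z\<^sup>2) has_real_derivative q * z powr (q - 1) - 2 * \<kappa> * z) (at z)"
      using z by (auto intro!: derivative_eq_intros)
    show "((\<lambda>z. q * z powr (q - 1) - 2 * \<kappa> * z) has_real_derivative q * ((q - 1) * z powr (q - 2)) - 2 * \<kappa>) (at z)"
      using z by (auto intro!: derivative_eq_intros)
    have "(1 / 2 :: real) = 2 powr (-1)" by (simp add: powr_minus)
    also have "\<dots> \<le> 2 powr (q - 2)" using q by (intro powr_mono) auto
    also have "\<dots> \<le> z powr (q - 2)" using z q by (intro powr_mono2') auto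
    finally have "q * (q - 1) * (1 / 2) \<le> q * (q - 1) * z powr (q - 2)"
      using q by (intro mult_left_mono) auto
    then show "0 \<le> q * ((q - 1) * z powr (q - 2)) - 2 * \<kappa>"
      by (simp add: \<kappa>_def mult.assoc)
  qed simp
  from convex_onD[OF this, of "1 / 2" "1 + x" "1 - x"]
  have "(1 :: real) powr q - \<kappa> * 1\<^sup>2 \<le> 1 / 2 * ((1 + x) powr q - \<kappa> * (1 + x)\<^sup>2) + 1 / 2 * ((1 - x) powr q - \<kappa> * (1 - x)\<^sup>2)"
    using x False by (simp add: field_simps)
  moreover have "\<kappa> * (1 + x)\<^sup>2 + \<kappa> * (1 - x)\<^sup>2 = 2 * \<kappa> + 2 * (\<kappa> * x\<^sup>2)"
    by (simp add: power2_eq_square algebra_simps)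
  ultimately have "1 + \<kappa> * x\<^sup>2 \<le> ((1 + x) powr q + (1 - x) powr q) / 2"
    unfolding powr_one_eq_one power_one by argo
  then show ?thesis by (simp add: \<kappa>_def)
qed

text \<open>
  As for the lower bound, with a quadratic function large enough to make the difference concave.
\<close>
lemma two_point_upper_unit:
  fixes s x :: real
  assumes s: "2 \<le> s" and x: "0 \<le> x" "x \<le> 1"
  shows "((1 + x) powr s + (1 - x) powr s) / 2 \<le> 1 + s * (s - 1) * 2 powr s * x\<^sup>2"
proof (cases "x = 1")
  case True
  have "2 * 1 \<le> s * (s - 1)"
    using s by (intro mult_mono) auto
  then have "1 * 2 powr s \<le> s * (s - 1) * 2 powr s"
    by (intro mult_right_mono) auto
  moreover have "(2 :: real) powr s \<ge> 0" by simp
  ultimately have "2 powr s / 2 \<le> 1 + s * (s - 1) * 2 powr s" by linarith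
  then show ?thesis using True by simp
next
  case False
  define \<kappa> where "\<kappa> = s * (s - 1) * 2 powr s"
  have "concave_on {0<..<2} (\<lambda>z. z powr s - \<kappa> * z\<^sup>2)"
  proof (rule f''_le0_imp_concave)
    fix z :: real assume z: "z \<in> {0<..<2}"
    show "((\<lambda>z. z powr s - \<kappa> * z\<^sup>2) has_real_derivative s * z powr (s - 1) - 2 * \<kappa> * z) (at z)"
      using z by (auto intro!: derivative_eq_intros)
    show "((\<lambda>z. s * z powr (s - 1) - 2 * \<kappa> * z) has_real_derivative s * ((s - 1) * z powr (s - 2)) - 2 * \<kappa>) (at z)"
      using z by (auto intro!: derivative_eq_intros)
    have "z powr (s - 2) \<le> 2 powr (s - 2)" using z s by (intro powr_mono2) auto
    also have "\<dots> \<le> 2 powr s" by (intro powr_mono) auto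
    also have "\<dots> \<le> 2 * 2 powr s" by simp
    finally have "s * (s - 1) * z powr (s - 2) \<le> s * (s - 1) * (2 * 2 powr s)"
      using s by (intro mult_left_mono) auto
    then show "s * ((s - 1) * z powr (s - 2)) - 2 * \<kappa> \<le> 0"
      by (simp add: \<kappa>_def mult.assoc)
  qed simp
  from concave_onD[OF this, of "1 / 2" "1 + x" "1 - x"]
  have "(1 :: real) powr s - \<kappa> * 1\<^sup>2 \<ge> 1 / 2 * ((1 + x) powr s - \<kappa> * (1 + x)\<^sup>2) + 1 / 2 * ((1 - x) powr s - \<kappa> * (1 - x)\<^sup>2)"
    using x False by (simp add: field_simps)
  moreover have "\<kappa> * (1 + x)\<^sup>2 + \<kappa> * (1 - x)\<^sup>2 = 2 * \<kappa> + 2 * (\<kappa> * x\<^sup>2)"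
    by (simp add: power2_eq_square algebra_simps)
  ultimately have "((1 + x) powr s + (1 - x) powr s) / 2 \<le> 1 + \<kappa> * x\<^sup>2"
    unfolding powr_one_eq_one power_one by argo
  then show ?thesis by (simp add: \<kappa>_def)
qed

text \<open>
  Scaling by the mean \<open>m\<close> turns two nonnegative numbers into \<open>1 + x\<close> and \<open>1 - x\<close>.
\<close>
lemma unit_reduction:
  fixes A B :: real
  assumes "0 \<le> A" "0 \<le> B" "0 < A + B"
  obtains m x where "0 < m" "0 \<le> x" "x \<le> 1" "m = (A + B) / 2" "((A - B) / 2)\<^sup>2 = m\<^sup>2 * x\<^sup>2"
    "\<And>e. A powr e + B powr e = m powr e * ((1 + x) powr e + (1 - x) powr e)"
proof
  define m where "m = (A + B) / 2"
  define x where "x = \<bar>(A - B) / 2\<bar> / m"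
  show m: "0 < m" using assms by (simp add: m_def)
  show x: "0 \<le> x" using m by (simp add: x_def)
  show x1: "x \<le> 1" using m assms by (simp add: x_def m_def divide_le_eq abs_le_iff)
  show "m = (A + B) / 2" by (simp add: m_def)
  show "((A - B) / 2)\<^sup>2 = m\<^sup>2 * x\<^sup>2" using m by (simp add: x_def power_divide)
  have e: "m * (1 + x) = m + \<bar>(A - B) / 2\<bar>" "m * (1 - x) = m - \<bar>(A - B) / 2\<bar>"
    using m by (simp_all add: x_def distrib_left right_diff_distrib)
  show "A powr e + B powr e = m powr e * ((1 + x) powr e + (1 - x) powr e)" for e
  proof -
    have "m powr e * ((1 + x) powr e + (1 - x) powr e) = (m * (1 + x)) powr e + (m * (1 - x)) powr e"
      using m x x1 by (subst (1 2) powr_mult) (simp_all add: distrib_left[symmetric])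
    also have "\<dots> = A powr e + B powr e"
      unfolding e by (cases "B \<le> A") (simp_all add: m_def field_simps)
    finally show ?thesis by simp
  qed
qed

lemma two_point_lower:
  fixes q A B :: real
  assumes q: "1 < q" "q \<le> 2" and A: "0 \<le> A" "0 \<le> B"
  shows "((A + B) / 2)\<^sup>2 + q * (q - 1) / 4 * ((A - B) / 2)\<^sup>2 \<le> ((A powr q + B powr q) / 2) powr (2 / q)"
proof (cases "A + B = 0")
  case True
  then have "A = 0" "B = 0" using A by auto
  then show ?thesis by simp
next
  case False
  then obtain m x where mx: "0 < m" "0 \<le> x" "x \<le> 1" "m = (A + B) / 2" "((A - B) / 2)\<^sup>2 = m\<^sup>2 * x\<^sup>2"
    "\<And>e. A powr e + B powr e = m powr e * ((1 + x) powr e + (1 - x) powr e)"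
    using unit_reduction[of A B] A by auto
  define y where "y = 1 + q * (q - 1) / 4 * x\<^sup>2"
  have y: "1 \<le> y" using q by (simp add: y_def)
  have "y = y powr 1" using y by simp
  also have "\<dots> \<le> y powr (2 / q)" using y q by (intro powr_mono) auto
  also have "\<dots> \<le> (((1 + x) powr q + (1 - x) powr q) / 2) powr (2 / q)"
    using two_point_lower_unit[OF q mx(2,3)] y q by (intro powr_mono2) (auto simp: y_def)
  finally have "m\<^sup>2 * y \<le> m\<^sup>2 * (((1 + x) powr q + (1 - x) powr q) / 2) powr (2 / q)"
    by (intro mult_left_mono) auto
  also have "m\<^sup>2 = (m powr q) powr (2 / q)"
    using mx q by (simp add: powr_powr)
  also have "\<dots> * (((1 + x) powr q + (1 - x) powr q) / 2) powr (2 / q) = ((A powr q + B powr q) / 2) powr (2 / q)"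
    using mx by (simp add: powr_mult[symmetric])
  finally show ?thesis
    unfolding mx(5) mx(4)[symmetric] using mx(1) q by (simp add: y_def powr_powr algebra_simps)
qed

lemma two_point_upper:
  fixes s A B :: real
  assumes s: "2 \<le> s" and A: "0 \<le> A" "0 \<le> B"
  shows "((A powr s + B powr s) / 2) powr (2 / s) \<le> ((A + B) / 2)\<^sup>2 + s * (s - 1) * 2 powr s * ((A - B) / 2)\<^sup>2"
proof (cases "A + B = 0")
  case True
  then have "A = 0" "B = 0" using A by auto
  then show ?thesis by simp
next
  case False
  then obtain m x where mx: "0 < m" "0 \<le> x" "x \<le> 1" "m = (A + B) / 2" "((A - B) / 2)\<^sup>2 = m\<^sup>2 * x\<^sup>2"
    "\<And>e. A powr e + B powr e = m powr e * ((1 + x) powr e + (1 - x) powr e)"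
    using unit_reduction[of A B] A by auto
  define y where "y = 1 + s * (s - 1) * 2 powr s * x\<^sup>2"
  have y: "1 \<le> y" using s by (simp add: y_def)
  have "((A powr s + B powr s) / 2) powr (2 / s) = (m powr s) powr (2 / s) * (((1 + x) powr s + (1 - x) powr s) / 2) powr (2 / s)"
    using mx by (simp add: powr_mult[symmetric])
  also have "(m powr s) powr (2 / s) = m\<^sup>2"
    using mx s by (simp add: powr_powr)
  also have "(((1 + x) powr s + (1 - x) powr s) / 2) powr (2 / s) \<le> y powr (2 / s)"
    using two_point_upper_unit[OF s mx(2,3)] y s by (intro powr_mono2) (auto simp: y_def)
  also have "y powr (2 / s) \<le> y powr 1" using y s by (intro powr_mono) auto
  also have "m\<^sup>2 * y powr 1 = ((A + B) / 2)\<^sup>2 + s * (s - 1) * 2 powr s * ((A - B) / 2)\<^sup>2"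
    unfolding mx(5) mx(4)[symmetric] using y by (simp add: y_def algebra_simps)
  finally show ?thesis by (simp add: mult_left_mono)
qed

lemma parallelogram_complex:
  fixes u v :: complex
  shows "(norm (u + v))\<^sup>2 + (norm (u - v))\<^sup>2 = 2 * ((norm u)\<^sup>2 + (norm v)\<^sup>2)"
  unfolding cmod_power2 by (simp add: power2_eq_square algebra_simps)

lemma half_powr_root:
  fixes X e :: real
  assumes "0 \<le> X"
  shows "(X / 2) powr (1 / e) = 2 powr (- 1 / e) * X powr (1 / e)"
proof -
  have "2 powr (- 1 / e) = 1 / 2 powr (1 / e)"
    using powr_minus_divide[of 2 "1 / e"] by simp
  then show ?thesis using assms by (simp add: powr_divide)
qed

text \<open>
  Let \<open>m\<close> and \<open>d\<close> be the mean and half the difference of \<open>\<bar>u + v\<bar>\<close> and \<open>\<bar>u - v\<bar>\<close>.  The parallelogram law says \<open>\<bar>u\<bar>\<^sup>2 + \<bar>v\<bar>\<^sup>2 = m\<^sup>2 + d\<^sup>2\<close>, and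
  \<open>\<bar>u\<bar> \<le> m\<close>, so \<open>\<bar>u\<bar>\<^sup>2 + \<kappa> \<bar>v\<bar>\<^sup>2 \<le> m\<^sup>2 + \<kappa> d\<^sup>2\<close> for \<open>\<kappa> \<le> 1\<close>.  This reduces the complex inequality to one
  between the nonnegative numbers \<open>\<bar>u + v\<bar>\<close> and \<open>\<bar>u - v\<bar>\<close>.
\<close>
lemma two_point_lower_complex:
  fixes u v :: complex
  assumes q: "1 < q" "q \<le> 2" and s: "2 \<le> s"
  shows "qsum s (ennreal (norm u)) (ennreal (sqrt (q * (q - 1) / 4)) * ennreal (norm v))
    \<le> ennreal (2 powr (- 1 / q)) * qsum q (ennreal (norm (u + v))) (ennreal (norm (u - v)))"
proof -
  define \<kappa> where "\<kappa> = q * (q - 1) / 4"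
  have \<kappa>: "0 \<le> \<kappa>" "\<kappa> \<le> 1"
    using q mult_mono[of q 2 "q - 1" 1] by (auto simp: \<kappa>_def)
  define A where "A = norm (u + v)"
  define B where "B = norm (u - v)"
  have AB: "0 \<le> A" "0 \<le> B" by (auto simp: A_def B_def)
  have pl: "(norm u)\<^sup>2 + (norm v)\<^sup>2 = ((A + B) / 2)\<^sup>2 + ((A - B) / 2)\<^sup>2"
    using parallelogram_complex[of u v] by (simp add: A_def B_def power2_eq_square field_simps)
  have "norm (2 * u) \<le> A + B"
    using norm_triangle_ineq[of "u + v" "u - v"] by (simp add: A_def B_def)
  then have "(norm u)\<^sup>2 \<le> ((A + B) / 2)\<^sup>2"
    by (intro power_mono) (auto simp: norm_mult)
  then have "(1 - \<kappa>) * (norm u)\<^sup>2 \<le> (1 - \<kappa>) * ((A + B) / 2)\<^sup>2"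
    using \<kappa> by (intro mult_left_mono) auto
  then have "(norm u)\<^sup>2 + \<kappa> * (norm v)\<^sup>2 \<le> ((A + B) / 2)\<^sup>2 + \<kappa> * ((A - B) / 2)\<^sup>2"
    using arg_cong[OF pl, of "\<lambda>z. \<kappa> * z"] by (simp only: algebra_simps)
  also have "\<dots> \<le> ((A powr q + B powr q) / 2) powr (2 / q)"
    unfolding \<kappa>_def by (rule two_point_lower[OF q AB])
  finally have *: "(norm u)\<^sup>2 + \<kappa> * (norm v)\<^sup>2 \<le> ((A powr q + B powr q) / 2) powr (2 / q)" .
  have "(norm u) powr s + (sqrt \<kappa> * norm v) powr s = ((norm u)\<^sup>2) powr (s / 2) + (\<kappa> * (norm v)\<^sup>2) powr (s / 2)"
  proof -
    have "x powr s = (x\<^sup>2) powr (s / 2)" if "0 \<le> x" for x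
      using that by (cases "x = 0") (auto simp: powr_powr simp flip: powr_numeral)
    then show ?thesis using \<kappa> by (simp add: power_mult_distrib)
  qed
  also have "\<dots> \<le> ((norm u)\<^sup>2 + \<kappa> * (norm v)\<^sup>2) powr (s / 2)"
    using \<kappa> s by (intro powr_superadditive) auto
  also have "\<dots> \<le> (((A powr q + B powr q) / 2) powr (2 / q)) powr (s / 2)"
    using * \<kappa> s by (intro powr_mono2) auto
  also have "\<dots> = ((A powr q + B powr q) / 2) powr (s / q)"
    by (simp add: powr_powr)
  finally have "((norm u) powr s + (sqrt \<kappa> * norm v) powr s) powr (1 / s) \<le> (((A powr q + B powr q) / 2) powr (s / q)) powr (1 / s)"
    using s by (intro powr_mono2) auto
  also have "\<dots> = 2 powr (- 1 / q) * (A powr q + B powr q) powr (1 / q)"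
    using s AB half_powr_root[of "A powr q + B powr q" q] by (simp add: powr_powr)
  finally show ?thesis
    unfolding \<kappa>_def[symmetric] A_def[symmetric] B_def[symmetric] using \<kappa> AB
    by (simp add: qsum_def ennpow_ennreal ennreal_mult[symmetric] ennreal_plus[symmetric] del: ennreal_plus)
qed

text \<open>
  Dual to the lower bound: here \<open>\<bar>d\<bar> \<le> \<bar>v\<bar>\<close> is used, and \<open>\<kappa> \<ge> 1\<close>.
\<close>
lemma two_point_upper_complex:
  fixes u v :: complex
  assumes q: "1 < q" "q \<le> 2" and s: "2 \<le> s"
  shows "ennreal (2 powr (- 1 / s)) * qsum s (ennreal (norm (u + v))) (ennreal (norm (u - v)))
    \<le> qsum q (ennreal (norm u)) (ennreal (sqrt (s * (s - 1) * 2 powr s)) * ennreal (norm v))"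
proof -
  define \<kappa> where "\<kappa> = s * (s - 1) * 2 powr s"
  have "1 * 1 * 1 \<le> \<kappa>"
    unfolding \<kappa>_def using s ge_one_powr_ge_zero[of 2 s] by (intro mult_mono) auto
  then have \<kappa>: "1 \<le> \<kappa>" by simp
  define A where "A = norm (u + v)"
  define B where "B = norm (u - v)"
  have AB: "0 \<le> A" "0 \<le> B" by (auto simp: A_def B_def)
  have pl: "((A + B) / 2)\<^sup>2 + ((A - B) / 2)\<^sup>2 = (norm u)\<^sup>2 + (norm v)\<^sup>2"
    using parallelogram_complex[of u v] by (simp add: A_def B_def power2_eq_square field_simps)
  have "\<bar>A - B\<bar> \<le> norm (2 * v)"
    using norm_triangle_ineq3[of "u + v" "u - v"] by (simp add: A_def B_def)
  then have "((A - B) / 2)\<^sup>2 \<le> (norm v)\<^sup>2"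
    by (subst abs_le_square_iff[symmetric]) (simp add: norm_mult)
  from mult_left_mono[OF this, of "\<kappa> - 1"]
  have "(\<kappa> - 1) * ((A - B) / 2)\<^sup>2 \<le> (\<kappa> - 1) * (norm v)\<^sup>2"
    using \<kappa> by simp
  then have *: "((A + B) / 2)\<^sup>2 + \<kappa> * ((A - B) / 2)\<^sup>2 \<le> (norm u)\<^sup>2 + \<kappa> * (norm v)\<^sup>2"
    using pl by (simp only: algebra_simps)
  have sq: "x\<^sup>2 = (x powr q) powr (2 / q)" if "0 \<le> x" for x :: real
    using that q by (cases "x = 0") (auto simp: powr_powr simp flip: powr_numeral)
  have "((A powr s + B powr s) / 2) powr (2 / s) \<le> (norm u)\<^sup>2 + \<kappa> * (norm v)\<^sup>2"
    using two_point_upper[OF s AB] * unfolding \<kappa>_def by (rule order_trans)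
  also have "\<dots> = ((norm u) powr q) powr (2 / q) + ((sqrt \<kappa> * norm v) powr q) powr (2 / q)"
    using \<kappa> by (simp add: sq[symmetric] power_mult_distrib)
  also have "\<dots> \<le> ((norm u) powr q + (sqrt \<kappa> * norm v) powr q) powr (2 / q)"
    using q by (intro powr_superadditive) auto
  finally have "(((A powr s + B powr s) / 2) powr (2 / s)) powr (1 / 2)
    \<le> (((norm u) powr q + (sqrt \<kappa> * norm v) powr q) powr (2 / q)) powr (1 / 2)"
    by (intro powr_mono2) auto
  then have "2 powr (- 1 / s) * (A powr s + B powr s) powr (1 / s)
    \<le> ((norm u) powr q + (sqrt \<kappa> * norm v) powr q) powr (1 / q)"
    using AB half_powr_root[of "A powr s + B powr s" s] by (simp add: powr_powr)
  then show ?thesis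
    unfolding \<kappa>_def[symmetric] A_def[symmetric] B_def[symmetric] using \<kappa> AB
    by (simp add: qsum_def ennpow_ennreal ennreal_mult[symmetric] ennreal_plus[symmetric] del: ennreal_plus)
qed

section \<open>Uniformly convex and smooth lattice norms\<close>

text \<open>
  If the series on the right diverges the bound is \<open>\<infinity>\<close>, so the estimate holds at every point,
  whatever value the sum on the left has there.
\<close>
lemma norm_telescope_le_suminf:
  fixes z :: "nat \<Rightarrow> complex"
  shows "ennreal (norm (z 0 + (\<Sum>k. z (Suc k) - z k) - z n)) \<le> (\<Sum>k. ennreal (norm (z (Suc (k + n)) - z (k + n))))"
proof (cases "summable (\<lambda>k. norm (z (Suc (k + n)) - z (k + n)))")
  case True
  let ?d = "\<lambda>k. z (Suc k) - z k"
  have s1: "summable (\<lambda>k. norm (?d k))"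
    using True summable_iff_shift[of "\<lambda>k. norm (?d k)" n] by simp
  then have "(\<Sum>k. ?d k) = (\<Sum>k. ?d (k + n)) + (\<Sum>k<n. ?d k)"
    using suminf_split_initial_segment[OF summable_norm_cancel[OF s1]] by blast
  also have "(\<Sum>k<n. ?d k) = z n - z 0"
    by (rule sum_lessThan_telescope)
  finally have "z 0 + (\<Sum>k. ?d k) - z n = (\<Sum>k. ?d (k + n))" by simp
  then have "norm (z 0 + (\<Sum>k. ?d k) - z n) \<le> (\<Sum>k. norm (?d (k + n)))"
    using summable_norm[of "\<lambda>k. ?d (k + n)"] True by simp
  then show ?thesis
    using True by (simp add: suminf_ennreal2 ennreal_leI)
next
  case False
  then have "(\<Sum>k. ennreal (norm (z (Suc (k + n)) - z (k + n)))) = top"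
    by (rule contrapos_np) (rule summable_suminf_not_top, simp_all)
  then show ?thesis by simp
qed

text \<open>
  The norm of a complex function is \<open>T\<close> applied to its modulus.  The bounds on \<open>a\<close> and \<open>b\<close> are those of the two-point
  inequalities.
\<close>
locale lattice_norm = norm_operator a b M "count_space (UNIV :: unit set)" T
  for a b :: real and M :: "'a measure" and T +
  assumes ab: "1 < a" "a \<le> 2" "2 \<le> b"
begin

definition fnorm :: "('a \<Rightarrow> complex) \<Rightarrow> ennreal" where
  "fnorm f = T (\<lambda>x. ennreal (norm (f x))) ()"

definition fspace :: "('a \<Rightarrow> complex) set" where
  "fspace = {f \<in> borel_measurable M. fnorm f < top}"

lemma fspace_measurable [measurable_dest]: "f \<in> fspace \<Longrightarrow> f \<in> borel_measurable M"
  by (simp add: fspace_def)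

lemma fnorm_cmult: "f \<in> borel_measurable M \<Longrightarrow> fnorm (\<lambda>x. c * f x) = ennreal (norm c) * fnorm f"
  using cmult_T[of "\<lambda>x. ennreal (norm (f x))" "norm c" "()"]
  by (simp add: fnorm_def norm_mult ennreal_mult)

lemma fnorm_zero [simp]: "fnorm (\<lambda>_. 0) = 0"
  by (simp add: fnorm_def)

lemma T_add_le:
  assumes "F \<in> borel_measurable M" "G \<in> borel_measurable M"
  shows "T (\<lambda>x. F x + G x) y \<le> T F y + T G y"
  using convex_T[of 1 F G y] assms ab by simp

lemma fnorm_add_le:
  assumes [measurable]: "f \<in> borel_measurable M" "g \<in> borel_measurable M"
  shows "fnorm (\<lambda>x. f x + g x) \<le> fnorm f + fnorm g"
proof -
  have "fnorm (\<lambda>x. f x + g x) \<le> T (\<lambda>x. ennreal (norm (f x)) + ennreal (norm (g x))) ()"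
    unfolding fnorm_def by (intro mono_T) (simp add: norm_triangle_ineq flip: ennreal_plus)
  also have "\<dots> \<le> fnorm f + fnorm g"
    unfolding fnorm_def by (intro T_add_le) auto
  finally show ?thesis .
qed

lemma fspace_add: "f \<in> fspace \<Longrightarrow> g \<in> fspace \<Longrightarrow> (\<lambda>x. f x + g x) \<in> fspace"
  using fnorm_add_le[of f g] by (auto simp: fspace_def intro: le_less_trans)

lemma fspace_cmult: "f \<in> fspace \<Longrightarrow> (\<lambda>x. c * f x) \<in> fspace"
  by (auto simp: fspace_def fnorm_cmult ennreal_mult_less_top)

lemma fspace_diff: "f \<in> fspace \<Longrightarrow> g \<in> fspace \<Longrightarrow> (\<lambda>x. f x - g x) \<in> fspace"
  using fspace_add[of f "\<lambda>x. (-1) * g x"] fspace_cmult[of g "-1"] by simp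

lemma fspace_zero: "(\<lambda>_. 0) \<in> fspace"
  by (simp add: fspace_def)

definition convexity_const :: real where "convexity_const = sqrt (a * (a - 1) / 4)"

definition smoothness_const :: real where "smoothness_const = sqrt (b * (b - 1) * 2 powr b)"

lemma convexity_const_bounds: "0 < convexity_const" "convexity_const \<le> 1"
  using ab mult_mono[of a 2 "a - 1" 1] by (auto simp: convexity_const_def real_le_lsqrt)

lemma smoothness_const_nonneg: "0 \<le> smoothness_const"
  using ab by (simp add: smoothness_const_def)

text \<open>
  Concavity of the norm, the two-point inequality under the norm, and convexity of the norm, in this order.  With
  \<open>f = u + v\<close> and \<open>g = u - v\<close> it says that points \<open>f\<close> and \<open>g\<close> of the unit ball are close when their midpoint has norm close to one.
\<close>
lemma uniformly_convex:
  assumes [measurable]: "u \<in> borel_measurable M" "v \<in> borel_measurable M"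
    and "fnorm (\<lambda>x. u x + v x) \<le> 1" "fnorm (\<lambda>x. u x - v x) \<le> 1"
  shows "qsum b (fnorm u) (ennreal convexity_const * fnorm v) \<le> 1"
proof -
  let ?n = "\<lambda>f x. ennreal (norm (f x :: complex))"
  have "qsum b (fnorm u) (ennreal convexity_const * fnorm v) = qsum b (T (?n u) ()) (T (\<lambda>x. ennreal convexity_const * ?n v x) ())"
    unfolding fnorm_def by (subst cmult_T) auto
  also have "\<dots> \<le> T (\<lambda>x. qsum b (?n u x) (ennreal convexity_const * ?n v x)) ()"
    using ab by (intro concave_T) auto
  also have "\<dots> \<le> T (\<lambda>x. ennreal (2 powr (- 1 / a)) * qsum a (?n (\<lambda>x. u x + v x) x) (?n (\<lambda>x. u x - v x) x)) ()"
    unfolding convexity_const_def using ab by (intro mono_T two_point_lower_complex)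
  also have "\<dots> = ennreal (2 powr (- 1 / a)) * T (\<lambda>x. qsum a (?n (\<lambda>x. u x + v x) x) (?n (\<lambda>x. u x - v x) x)) ()"
    by (intro cmult_T) measurable
  also have "\<dots> \<le> ennreal (2 powr (- 1 / a)) * qsum a (fnorm (\<lambda>x. u x + v x)) (fnorm (\<lambda>x. u x - v x))"
    unfolding fnorm_def using ab by (intro mult_left_mono convex_T) auto
  also have "\<dots> \<le> ennreal (2 powr (- 1 / a)) * qsum a 1 1"
    using assms ab by (intro mult_left_mono qsum_mono) auto
  also have "qsum a 1 1 = ennreal (2 powr (1 / a))"
    using ennpow_ennreal[of 2 "1 / a"] by (simp add: qsum_def)
  also have "ennreal (2 powr (- 1 / a)) * ennreal (2 powr (1 / a)) = 1"
    by (simp add: ennreal_mult[symmetric] powr_add[symmetric])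
  finally show ?thesis .
qed

lemma uniformly_smooth:
  assumes [measurable]: "u \<in> borel_measurable M" "v \<in> borel_measurable M"
  shows "ennreal (2 powr (- 1 / b)) * qsum b (fnorm (\<lambda>x. u x + v x)) (fnorm (\<lambda>x. u x - v x))
    \<le> qsum a (fnorm u) (ennreal smoothness_const * fnorm v)"
proof -
  let ?n = "\<lambda>f x. ennreal (norm (f x :: complex))"
  have "ennreal (2 powr (- 1 / b)) * qsum b (fnorm (\<lambda>x. u x + v x)) (fnorm (\<lambda>x. u x - v x))
      \<le> ennreal (2 powr (- 1 / b)) * T (\<lambda>x. qsum b (?n (\<lambda>x. u x + v x) x) (?n (\<lambda>x. u x - v x) x)) ()"
    unfolding fnorm_def using ab by (intro mult_left_mono concave_T) auto
  also have "\<dots> = T (\<lambda>x. ennreal (2 powr (- 1 / b)) * qsum b (?n (\<lambda>x. u x + v x) x) (?n (\<lambda>x. u x - v x) x)) ()"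
    by (intro cmult_T[symmetric]) measurable
  also have "\<dots> \<le> T (\<lambda>x. qsum a (?n u x) (ennreal smoothness_const * ?n v x)) ()"
    unfolding smoothness_const_def using ab by (intro mono_T two_point_upper_complex)
  also have "\<dots> \<le> qsum a (T (?n u) ()) (T (\<lambda>x. ennreal smoothness_const * ?n v x) ())"
    using ab by (intro convex_T) auto
  also have "\<dots> = qsum a (fnorm u) (ennreal smoothness_const * fnorm v)"
    unfolding fnorm_def by (subst cmult_T) auto
  finally show ?thesis .
qed

text \<open>
  Since \<open>a > 1\<close>, the sum exceeds \<open>2\<close> by a quantity of smaller order than the norm of \<open>h\<close>.
\<close>
lemma uniformly_smooth_real:
  assumes V: "f \<in> fspace" "h \<in> fspace" and f: "fnorm f \<le> 1"
  shows "enn2real (fnorm (\<lambda>x. f x + h x)) + enn2real (fnorm (\<lambda>x. f x - h x))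
    \<le> 2 * (1 + (smoothness_const * enn2real (fnorm h)) powr a)"
proof -
  note [measurable] = fspace_measurable[OF V(1)] fspace_measurable[OF V(2)]
  obtain A where A: "fnorm (\<lambda>x. f x + h x) = ennreal A" "0 \<le> A"
    using fspace_add[OF V] by (cases "fnorm (\<lambda>x. f x + h x)") (auto simp: fspace_def)
  obtain B where B: "fnorm (\<lambda>x. f x - h x) = ennreal B" "0 \<le> B"
    using fspace_diff[OF V] by (cases "fnorm (\<lambda>x. f x - h x)") (auto simp: fspace_def)
  obtain H where H: "fnorm h = ennreal H" "0 \<le> H"
    using V(2) by (cases "fnorm h") (auto simp: fspace_def)
  have "ennreal (2 powr (- 1 / b)) * qsum b (ennreal A) (ennreal B) \<le> qsum a (fnorm f) (ennreal smoothness_const * fnorm h)"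
    using uniformly_smooth[of f h] A B by simp
  also have "\<dots> \<le> qsum a 1 (ennreal (smoothness_const * H))"
    using f H smoothness_const_nonneg ab by (intro qsum_mono) (auto simp: ennreal_mult)
  also have "\<dots> = ennreal ((1 + (smoothness_const * H) powr a) powr (1 / a))"
    using H smoothness_const_nonneg by (simp add: qsum_def ennpow_ennreal ennreal_plus[symmetric] del: ennreal_plus flip: ennreal_1)
  also have "ennreal (2 powr (- 1 / b)) * qsum b (ennreal A) (ennreal B)
      = ennreal (2 powr (- 1 / b) * (A powr b + B powr b) powr (1 / b))"
    using A B by (simp add: qsum_def ennpow_ennreal ennreal_mult ennreal_plus[symmetric] del: ennreal_plus)
  also have "2 powr (- 1 / b) * (A powr b + B powr b) powr (1 / b) = ((A powr b + B powr b) / 2) powr (1 / b)"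
    using A B by (simp add: half_powr_root)
  finally have le: "((A powr b + B powr b) / 2) powr (1 / b) \<le> (1 + (smoothness_const * H) powr a) powr (1 / a)"
    by (simp add: ennreal_le_iff)
  have "(A + B) powr b \<le> 2 powr (b - 1) * (A powr b + B powr b)"
    using powr_add_le_weighted[of A B 1 1 b] A B ab by simp
  then have "((A + B) / 2) powr b \<le> (A powr b + B powr b) / 2"
    using A B by (simp add: powr_divide powr_diff field_simps)
  then have "(((A + B) / 2) powr b) powr (1 / b) \<le> ((A powr b + B powr b) / 2) powr (1 / b)"
    using ab by (intro powr_mono2) auto
  then have "(A + B) / 2 \<le> ((A powr b + B powr b) / 2) powr (1 / b)"
    using A B ab by (simp add: powr_powr)
  also note le
  also have "(1 + (smoothness_const * H) powr a) powr (1 / a) \<le> (1 + (smoothness_const * H) powr a) powr 1"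
    using ab by (intro powr_mono) auto
  finally show ?thesis using A B H by simp
qed

definition linear_on_fspace :: "(('a \<Rightarrow> complex) \<Rightarrow> complex) \<Rightarrow> bool" where
  "linear_on_fspace L \<longleftrightarrow> (\<forall>f\<in> fspace. \<forall>g\<in> fspace. L (\<lambda>x. f x + g x) = L f + L g) \<and> (\<forall>c. \<forall>f\<in> fspace. L (\<lambda>x. c * f x) = c * L f)"

lemma linear_on_fspace_diff:
  assumes "linear_on_fspace L" "f \<in> fspace" "g \<in> fspace"
  shows "L (\<lambda>x. f x - g x) = L f - L g"
proof -
  have "L (\<lambda>x. f x + (-1) * g x) = L f + (-1) * L g"
    using assms fspace_cmult unfolding linear_on_fspace_def by metis
  then show ?thesis by simp
qed

text \<open>
  If \<open>L1\<close> and \<open>L2\<close> differ at \<open>h\<close>, then \<open>L1 (f + \<epsilon> h) + L2 (f - \<epsilon> h)\<close> exceeds \<open>2\<close> by an amount linear in \<open>\<epsilon>\<close>, after a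
  rotation of \<open>h\<close>.  Smoothness only allows an excess of order \<open>\<epsilon>\<^sup>a\<close> with \<open>a > 1\<close>.
\<close>
lemma norming_functional_unique:
  assumes L: "linear_on_fspace L1" "linear_on_fspace L2"
    and le: "\<And>f. f \<in> fspace \<Longrightarrow> norm (L1 f) \<le> enn2real (fnorm f)" "\<And>f. f \<in> fspace \<Longrightarrow> norm (L2 f) \<le> enn2real (fnorm f)"
    and f: "f \<in> fspace" "fnorm f \<le> 1" "L1 f = 1" "L2 f = 1" and h: "h \<in> fspace"
  shows "L1 h = L2 h"
proof (rule ccontr)
  assume "L1 h \<noteq> L2 h"
  define D where "D = L1 h - L2 h"
  \<comment> \<open>The rotation that makes the difference of the two values positive.\<close>
  define \<omega> where "\<omega> = cnj (sgn D)"
  have D: "D \<noteq> 0" using \<open>L1 h \<noteq> L2 h\<close> by (simp add: D_def)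
  have "\<omega> * D = (D * cnj D) / complex_of_real (norm D)"
    by (simp add: \<omega>_def sgn_eq)
  then have \<omega>: "\<omega> * D = complex_of_real (norm D)"
    using D by (simp add: complex_norm_square[symmetric] power2_eq_square)
  define g where "g = (\<lambda>x. \<omega> * h x)"
  have g: "g \<in> fspace" unfolding g_def by (rule fspace_cmult[OF h])
  have Dg: "L1 g - L2 g = complex_of_real (norm D)"
    using L h \<omega> unfolding linear_on_fspace_def g_def by (simp add: D_def right_diff_distrib)
  define R where "R = smoothness_const * enn2real (fnorm g)"
  have R: "0 \<le> R" using smoothness_const_nonneg by (simp add: R_def)
  have main: "norm D \<le> 2 * R powr a * e powr (a - 1)" if e: "0 < e" for e :: real
  proof -
    let ?eg = "\<lambda>x. complex_of_real e * g x"
    have eg: "?eg \<in> fspace" by (rule fspace_cmult[OF g])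
    have "L1 (\<lambda>x. f x + ?eg x) = L1 f + of_real e * L1 g"
      using L f g eg unfolding linear_on_fspace_def by metis
    moreover have "L2 (\<lambda>x. f x - ?eg x) = L2 f - of_real e * L2 g"
      using linear_on_fspace_diff[OF L(2) f(1) eg] L g unfolding linear_on_fspace_def by metis
    ultimately have "L1 (\<lambda>x. f x + ?eg x) + L2 (\<lambda>x. f x - ?eg x) = of_real (2 + e * norm D)"
      using Dg f by (simp add: algebra_simps flip: distrib_left)
    then have "2 + e * norm D = norm (L1 (\<lambda>x. f x + ?eg x) + L2 (\<lambda>x. f x - ?eg x))"
      using e by (simp only: norm_of_real) (simp add: add_nonneg_nonneg)
    also have "\<dots> \<le> norm (L1 (\<lambda>x. f x + ?eg x)) + norm (L2 (\<lambda>x. f x - ?eg x))"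
      by (rule norm_triangle_ineq)
    also have "\<dots> \<le> enn2real (fnorm (\<lambda>x. f x + ?eg x)) + enn2real (fnorm (\<lambda>x. f x - ?eg x))"
      using fspace_add[OF f(1) eg] fspace_diff[OF f(1) eg] by (intro add_mono le)
    also have "\<dots> \<le> 2 * (1 + (smoothness_const * enn2real (fnorm ?eg)) powr a)"
      by (rule uniformly_smooth_real[OF f(1) eg f(2)])
    also have "enn2real (fnorm ?eg) = e * enn2real (fnorm g)"
      using fnorm_cmult[OF fspace_measurable[OF g], of "of_real e"] e by (simp add: enn2real_mult)
    also have "(smoothness_const * (e * enn2real (fnorm g))) powr a = R powr a * e powr a"
      using e R by (simp add: R_def powr_mult mult_ac)
    finally have "e * norm D \<le> 2 * (R powr a * e powr a)" by simp
    also have "e powr a = e * e powr (a - 1)"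
      using e by (simp add: powr_mult_base)
    finally have "e * norm D \<le> e * (2 * R powr a * e powr (a - 1))" by (simp add: mult_ac)
    then show ?thesis using e by (simp add: mult_le_cancel_left_pos)
  qed
  have "((\<lambda>e. 2 * R powr a * e powr (a - 1)) \<longlongrightarrow> 2 * R powr a * 0) (at_right 0)"
  proof (intro tendsto_intros)
    show "((\<lambda>e. e powr (a - 1)) \<longlongrightarrow> 0) (at_right (0 :: real))"
      using ab by (intro tendsto_zero_powrI[where b = "a - 1"] tendsto_ident_at tendsto_const)
        (auto simp: eventually_at_filter)
  qed
  moreover have "\<forall>\<^sub>F e in at_right 0. norm D \<le> 2 * R powr a * e powr (a - 1)"
    using main by (auto simp: eventually_at_filter)
  ultimately have "norm D \<le> 2 * R powr a * 0"
    by (intro tendsto_lowerbound) auto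
  then show False using D by simp
qed

lemma T_sum_le:
  fixes G :: "nat \<Rightarrow> 'a \<Rightarrow> ennreal"
  assumes "\<And>k. G k \<in> borel_measurable M"
  shows "T (\<lambda>x. \<Sum>k<n. G k x) y \<le> (\<Sum>k<n. T (G k) y)"
proof (induction n)
  case (Suc n)
  have "T (\<lambda>x. (\<Sum>k<n. G k x) + G n x) y \<le> T (\<lambda>x. \<Sum>k<n. G k x) y + T (G n) y"
    using assms by (intro T_add_le) auto
  also have "\<dots> \<le> (\<Sum>k<n. T (G k) y) + T (G n) y"
    by (intro add_right_mono Suc)
  finally show ?case by simp
qed simp

lemma T_suminf_le:
  fixes G :: "nat \<Rightarrow> 'a \<Rightarrow> ennreal"
  assumes [measurable]: "\<And>k. G k \<in> borel_measurable M"
  shows "T (\<lambda>x. \<Sum>k. G k x) y \<le> (\<Sum>k. T (G k) y)"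
proof -
  have "T (\<lambda>x. \<Sum>k. G k x) y = T (\<lambda>x. SUP n. \<Sum>k<n. G k x) y"
    by (simp add: suminf_eq_SUP)
  also have "\<dots> = (SUP n. T (\<lambda>x. \<Sum>k<n. G k x) y)"
    by (intro SUP_T) (auto simp: incseq_def le_fun_def intro!: sum_mono2)
  also have "\<dots> \<le> (\<Sum>k. T (G k) y)"
    by (intro SUP_least order_trans[OF T_sum_le] sum_le_suminf) auto
  finally show ?thesis .
qed

lemma complete_fspace:
  assumes f: "\<And>k. f k \<in> fspace" and d: "\<And>k. fnorm (\<lambda>x. f (Suc k) x - f k x) \<le> ennreal ((1 / 2) ^ k)"
  obtains f0 where "f0 \<in> fspace" "\<And>n. fnorm (\<lambda>x. f0 x - f n x) \<le> ennreal (2 * (1 / 2) ^ n)"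
proof
  note [measurable] = fspace_measurable[OF f]
  define f0 where "f0 x = f 0 x + (\<Sum>k. f (Suc k) x - f k x)" for x
  have [measurable]: "f0 \<in> borel_measurable M"
    unfolding f0_def by measurable
  show le: "fnorm (\<lambda>x. f0 x - f n x) \<le> ennreal (2 * (1 / 2) ^ n)" for n
  proof -
    have "fnorm (\<lambda>x. f0 x - f n x) \<le> T (\<lambda>x. \<Sum>k. ennreal (norm (f (Suc (k + n)) x - f (k + n) x))) ()"
      unfolding fnorm_def f0_def by (intro mono_T norm_telescope_le_suminf[of "\<lambda>k. f k x" for x])
    also have "\<dots> \<le> (\<Sum>k. fnorm (\<lambda>x. f (Suc (k + n)) x - f (k + n) x))"
      unfolding fnorm_def by (intro T_suminf_le) measurable
    also have "\<dots> \<le> (\<Sum>k. ennreal ((1 / 2) ^ (k + n)))"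
      by (intro suminf_le d) auto
    also have "\<dots> = ennreal (\<Sum>k. (1 / 2) ^ (k + n))"
      by (intro suminf_ennreal2) (auto simp: power_add intro!: summable_mult2 summable_geometric)
    also have "(\<Sum>k. (1 / 2) ^ (k + n)) = 2 * (1 / 2 :: real) ^ n"
      by (simp add: power_add suminf_mult2[symmetric] suminf_geometric summable_geometric)
    finally show ?thesis .
  qed
  show "f0 \<in> fspace"
  proof -
    have "fnorm f0 = fnorm (\<lambda>x. (f0 x - f 0 x) + f 0 x)" by simp
    also have "\<dots> \<le> fnorm (\<lambda>x. f0 x - f 0 x) + fnorm (f 0)"
      by (intro fnorm_add_le) auto
    also have "\<dots> < top"
      using le[of 0] f[of 0] by (auto simp: fspace_def top.not_eq_extremum intro: le_less_trans)
    finally show ?thesis by (simp add: fspace_def)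
  qed
qed

text \<open>
  Choose \<open>f k\<close> in the unit ball with \<open>L (f k) \<ge> N \<delta> k\<close> and \<open>\<delta> k \<rightarrow> 1\<close>.  The midpoint of \<open>f k\<close> and \<open>f (k + 1)\<close> then
  has norm at least \<open>\<delta> k\<close>, so by uniform convexity their distance is small, and completeness provides the limit.
\<close>
lemma norm_attained:
  assumes L: "linear_on_fspace L" and bounded: "\<And>f. f \<in> fspace \<Longrightarrow> norm (L f) \<le> C * enn2real (fnorm f)"
    and nonzero: "f1 \<in> fspace" "L f1 \<noteq> 0"
  obtains N f0 where "0 < N" "f0 \<in> fspace" "fnorm f0 \<le> 1" "L f0 = complex_of_real N"
    "\<And>f. f \<in> fspace \<Longrightarrow> norm (L f) \<le> N * enn2real (fnorm f)"
proof -
  define S where "S = {norm (L f) | f. f \<in> fspace \<and> fnorm f \<le> 1}"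
  define N where "N = Sup S"
  have hom: "L (\<lambda>x. c * f x) = c * L f" if "f \<in> fspace" for c f
    using L that by (simp add: linear_on_fspace_def)
  have "norm (L f) \<le> \<bar>C\<bar>" if "f \<in> fspace" "fnorm f \<le> 1" for f
  proof -
    have "enn2real (fnorm f) \<le> 1"
      using that by (intro enn2real_leI) auto
    then have "C * enn2real (fnorm f) \<le> \<bar>C\<bar> * 1"
      by (intro mult_mono) auto
    then show ?thesis using bounded[OF that(1)] by simp
  qed
  then have bdd: "bdd_above S"
    by (auto simp: S_def intro!: bdd_aboveI)
  have upper: "norm (L f) \<le> N" if "f \<in> fspace" "fnorm f \<le> 1" for f
    unfolding N_def using that by (intro cSup_upper bdd) (auto simp: S_def)
  have N: "norm (L f) \<le> N * enn2real (fnorm f)" if f: "f \<in> fspace" for f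
  proof (cases "fnorm f = 0")
    case True
    then show ?thesis using bounded[OF f] by simp
  next
    case False
    then obtain n where n: "fnorm f = ennreal n" "0 < n"
      using f by (cases "fnorm f") (auto simp: fspace_def order_le_less)
    have "fnorm (\<lambda>x. complex_of_real (1 / n) * f x) = 1"
      using n by (simp only: fnorm_cmult[OF fspace_measurable[OF f]])
        (simp add: norm_divide ennreal_mult[symmetric] del: of_real_divide)
    then have "norm (L (\<lambda>x. complex_of_real (1 / n) * f x)) \<le> N"
      using f by (intro upper fspace_cmult) auto
    then show ?thesis
      unfolding hom[OF f] using n by (simp add: norm_mult norm_divide field_simps)
  qed
  have "0 < N"
  proof -
    have "0 < norm (L f1)" using nonzero by simp
    also have "\<dots> \<le> N * enn2real (fnorm f1)" by (rule N[OF nonzero(1)])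
    finally show ?thesis using enn2real_nonneg[of "fnorm f1"] by (auto simp: zero_less_mult_iff)
  qed
  \<comment> \<open>Chosen so that uniform convexity puts consecutive terms at distance at most \<open>2\<^sup>-\<^sup>k\<close>.\<close>
  define \<theta> where "\<theta> k = (convexity_const * (1 / 2) ^ k / 2) powr b" for k :: nat
  have \<theta>: "0 < \<theta> k" "\<theta> k < 1" for k
  proof -
    have "convexity_const * (1 / 2) ^ k \<le> 1 * 1"
      using convexity_const_bounds by (intro mult_mono) (auto simp: power_le_one)
    then have *: "0 < convexity_const * (1 / 2) ^ k / 2" "convexity_const * (1 / 2) ^ k / 2 < 1"
      using convexity_const_bounds by auto
    then show "0 < \<theta> k" using convexity_const_bounds by (simp add: \<theta>_def)
    show "\<theta> k < 1"
      unfolding \<theta>_def using * ab powr_less_mono2[of b "convexity_const * (1 / 2) ^ k / 2" 1] by simp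
  qed
  define \<delta> where "\<delta> k = (1 - \<theta> k) powr (1 / b)" for k
  have \<delta>: "0 < \<delta> k" "\<delta> k < 1" "\<delta> k powr b = 1 - \<theta> k" for k
    using \<theta>[of k] ab powr_less_mono2[of "1 / b" "1 - \<theta> k" 1] by (auto simp: \<delta>_def powr_powr)
  have \<delta>_mono: "\<delta> k \<le> \<delta> (Suc k)" for k
    unfolding \<delta>_def
  proof (intro powr_mono2)
    have "\<theta> (Suc k) \<le> \<theta> k"
      unfolding \<theta>_def using convexity_const_bounds ab by (intro powr_mono2) (auto simp: field_simps)
    then show "1 - \<theta> k \<le> 1 - \<theta> (Suc k)" by simp
  qed (use ab \<theta>[of k] in auto)
  have "\<exists>f. f \<in> fspace \<and> fnorm f \<le> 1 \<and> (\<exists>l\<ge>N * \<delta> k. L f = complex_of_real l)" for k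
  proof -
    have "N * \<delta> k < N * 1"
      using \<open>0 < N\<close> \<delta> by (intro mult_strict_left_mono) auto
    then have "N * \<delta> k < Sup S" by (simp add: N_def)
    moreover have "S \<noteq> {}" using fspace_zero by (auto simp: S_def intro!: exI[of _ "\<lambda>_. 0"])
    ultimately obtain g where g: "g \<in> fspace" "fnorm g \<le> 1" "N * \<delta> k < norm (L g)"
      using less_cSup_iff[OF _ bdd] by (auto simp: S_def)
    have n: "norm (cnj (sgn (L g))) \<le> 1" by (simp add: norm_sgn)
    \<comment> \<open>Rotate \<open>g\<close> so that the functional takes a positive real value.\<close>
    have "cnj (sgn (L g)) * L g = (L g * cnj (L g)) / complex_of_real (norm (L g))"
      by (simp add: sgn_eq)
    also have "\<dots> = complex_of_real (norm (L g))"
      by (simp add: complex_norm_square[symmetric] power2_eq_square)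
    finally have "L (\<lambda>x. cnj (sgn (L g)) * g x) = complex_of_real (norm (L g))"
      by (simp add: hom[OF g(1)])
    moreover have "fnorm (\<lambda>x. cnj (sgn (L g)) * g x) \<le> 1 * 1"
      unfolding fnorm_cmult[OF fspace_measurable[OF g(1)]] using n g(2)
      by (intro mult_mono) (simp_all del: complex_mod_cnj)
    ultimately show ?thesis
      using g fspace_cmult[OF g(1)] by (intro exI[of _ "\<lambda>x. cnj (sgn (L g)) * g x"]) (auto intro!: exI[of _ "norm (L g)"])
  qed
  then obtain f l where f: "\<And>k. f k \<in> fspace" "\<And>k. fnorm (f k) \<le> 1" "\<And>k. N * \<delta> k \<le> l k" "\<And>k. L (f k) = complex_of_real (l k)"
    by metis
  have "fnorm (\<lambda>x. f (Suc k) x - f k x) \<le> ennreal ((1 / 2) ^ k)" for k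
  proof -
    let ?u = "\<lambda>x. (1 / 2) * (f (Suc k) x + f k x)" and ?v = "\<lambda>x. (1 / 2) * (f (Suc k) x - f k x)"
    have V: "?u \<in> fspace" "?v \<in> fspace"
      by (intro fspace_cmult fspace_add fspace_diff f(1))+
    have "(\<lambda>x. ?u x + ?v x) = f (Suc k)" "(\<lambda>x. ?u x - ?v x) = f k"
      by (auto simp: field_simps)
    then have uc: "qsum b (fnorm ?u) (ennreal convexity_const * fnorm ?v) \<le> 1"
      using f by (intro uniformly_convex fspace_measurable V) auto
    obtain U where U: "fnorm ?u = ennreal U" "0 \<le> U"
      using V by (cases "fnorm ?u") (auto simp: fspace_def)
    obtain W where W: "fnorm ?v = ennreal W" "0 \<le> W"
      using V by (cases "fnorm ?v") (auto simp: fspace_def)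
    have "L (\<lambda>x. f (Suc k) x + f k x) = L (f (Suc k)) + L (f k)"
      using L f(1) by (simp add: linear_on_fspace_def)
    then have "L ?u = (1 / 2) * (L (f (Suc k)) + L (f k))"
      using hom[OF fspace_add[OF f(1)[of "Suc k"] f(1)[of k]], of "1 / 2"] by argo
    then have "norm (L ?u) = (l (Suc k) + l k) / 2"
    proof -
      have "0 \<le> l k" "0 \<le> l (Suc k)"
        using f(3)[of k] f(3)[of "Suc k"] \<delta>(1)[of k] \<delta>(1)[of "Suc k"] \<open>0 < N\<close>
        by (meson less_imp_le mult_nonneg_nonneg order_trans)+
      moreover have "L ?u = complex_of_real ((l (Suc k) + l k) / 2)"
        using \<open>L ?u = _\<close> by (simp add: f(4))
      ultimately show ?thesis by (simp only: norm_of_real) simp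
    qed
    moreover have "N * \<delta> k \<le> N * \<delta> (Suc k)"
      using \<delta>_mono \<open>0 < N\<close> by (intro mult_left_mono) auto
    ultimately have "N * \<delta> k \<le> norm (L ?u)"
      using f(3)[of k] f(3)[of "Suc k"] by simp
    also have "\<dots> \<le> N * U" using N[OF V(1)] U by simp
    finally have "\<delta> k \<le> U" using \<open>0 < N\<close> by simp
    have "ennpow (ennreal U) b + ennpow (ennreal (convexity_const * W)) b \<le> 1"
      using uc U W convexity_const_bounds ab by (simp add: qsum_def ennpow_le_iff ennreal_mult)
    then have "ennreal (U powr b + (convexity_const * W) powr b) \<le> ennreal 1"
      using U W convexity_const_bounds by (simp add: ennpow_ennreal)
    then have "U powr b + (convexity_const * W) powr b \<le> 1"
      by (subst (asm) ennreal_le_iff) auto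
    moreover have "\<delta> k powr b \<le> U powr b"
      using \<open>\<delta> k \<le> U\<close> \<delta>(1)[of k] ab by (intro powr_mono2) auto
    ultimately have "(convexity_const * W) powr b \<le> \<theta> k"
      using \<delta>(3)[of k] by simp
    then have "((convexity_const * W) powr b) powr (1 / b) \<le> \<theta> k powr (1 / b)"
      using ab by (intro powr_mono2) auto
    then have "convexity_const * W \<le> convexity_const * (1 / 2) ^ k / 2"
      using W convexity_const_bounds ab by (simp add: \<theta>_def powr_powr)
    then have "W \<le> (1 / 2) ^ k / 2"
      using convexity_const_bounds by (simp add: field_simps)
    have "fnorm (\<lambda>x. f (Suc k) x - f k x) = fnorm (\<lambda>x. 2 * ?v x)" 
      by (intro arg_cong[of _ _ fnorm] ext) simp
    also have "\<dots> = ennreal 2 * fnorm ?v"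
      using fnorm_cmult[OF fspace_measurable[OF V(2)], of 2] by simp
    also have "\<dots> = ennreal (2 * W)" using W by (simp add: ennreal_mult)
    also have "\<dots> \<le> ennreal ((1 / 2) ^ k)"
      using \<open>W \<le> _\<close> by (intro ennreal_leI) simp
    finally show ?thesis .
  qed
  from complete_fspace[OF f(1) this]
  obtain f0 where f0: "f0 \<in> fspace" "\<And>n. fnorm (\<lambda>x. f0 x - f n x) \<le> ennreal (2 * (1 / 2) ^ n)"
    by blast
  have lim0: "(\<lambda>n. 2 * (1 / 2 :: real) ^ n) \<longlonglongrightarrow> 0"
    by (intro tendsto_mult_right_zero LIMSEQ_power_zero) simp
  have "fnorm f0 \<le> 1"
  proof -
    have "fnorm f0 \<le> 1 + ennreal (2 * (1 / 2) ^ n)" for n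
    proof -
      have "fnorm f0 = fnorm (\<lambda>x. f n x + (f0 x - f n x))" by simp
      also have "\<dots> \<le> fnorm (f n) + fnorm (\<lambda>x. f0 x - f n x)"
        using fspace_measurable f0(1) f(1) by (intro fnorm_add_le) (auto intro: fspace_diff)
      also have "\<dots> \<le> 1 + ennreal (2 * (1 / 2) ^ n)"
        by (intro add_mono f0 f)
      finally show ?thesis .
    qed
    moreover have "(\<lambda>n. 1 + ennreal (2 * (1 / 2) ^ n)) \<longlonglongrightarrow> 1 + ennreal 0"
      by (intro tendsto_add tendsto_const tendsto_ennrealI lim0)
    ultimately have "fnorm f0 \<le> 1 + ennreal 0"
      by (intro LIMSEQ_le_const) auto
    then show ?thesis by simp
  qed
  have "(\<lambda>n. L (f n)) \<longlonglongrightarrow> L f0"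
  proof (rule Lim_null[THEN iffD2, OF Lim_null_comparison])
    have "norm (L (f n) - L f0) \<le> N * (2 * (1 / 2) ^ n)" for n
    proof -
      have "norm (L (f n) - L f0) = norm (L (\<lambda>x. f0 x - f n x))"
        using linear_on_fspace_diff[OF L f0(1) f(1)] by (simp add: norm_minus_commute)
      also have "\<dots> \<le> N * enn2real (fnorm (\<lambda>x. f0 x - f n x))"
        by (rule N[OF fspace_diff[OF f0(1) f(1)]])
      also have "\<dots> \<le> N * (2 * (1 / 2) ^ n)"
        using \<open>0 < N\<close> f0(2)[of n] by (intro mult_left_mono enn2real_leI) auto
      finally show ?thesis .
    qed
    then show "\<forall>\<^sub>F n in sequentially. norm (L (f n) - L f0) \<le> N * (2 * (1 / 2) ^ n)" by simp
    show "(\<lambda>n. N * (2 * (1 / 2) ^ n)) \<longlonglongrightarrow> 0"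
      using tendsto_mult_right_zero[OF lim0] by simp
  qed
  moreover have "(\<lambda>n. L (f n)) \<longlonglongrightarrow> complex_of_real N"
  proof -
    have "(\<lambda>k. convexity_const * (1 / 2) ^ k / 2) \<longlonglongrightarrow> convexity_const * 0 / 2"
      by (intro tendsto_intros LIMSEQ_power_zero) auto
    then have "\<theta> \<longlonglongrightarrow> 0"
      unfolding \<theta>_def using ab convexity_const_bounds by (intro tendsto_zero_powrI[where b = b]) auto
    then have "\<delta> \<longlonglongrightarrow> (1 - 0) powr (1 / b)"
      unfolding \<delta>_def by (intro tendsto_intros) auto
    then have "(\<lambda>k. N * \<delta> k) \<longlonglongrightarrow> N * 1"
      by (intro tendsto_intros) simp
    moreover have "l k \<le> N" for k
      using upper[OF f(1,2), of k] f(4)[of k] by simp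
    ultimately have "l \<longlonglongrightarrow> N"
      using f(3) by (intro tendsto_sandwich[where f = "\<lambda>k. N * \<delta> k" and h = "\<lambda>_. N" and g = l]) auto
    then show ?thesis by (simp add: f(4) tendsto_of_real)
  qed
  ultimately have "L f0 = complex_of_real N"
    using LIMSEQ_unique by blast
  with that \<open>0 < N\<close> f0(1) \<open>fnorm f0 \<le> 1\<close> N show ?thesis by blast
qed

end

section \<open>The Bourgain-Morrey norm as a lattice norm\<close>

lemma nn_integral_count_space_eq_infsum:
  fixes f :: "'i \<Rightarrow> ennreal"
  assumes "countable A" "infinite A"
  shows "(\<integral>\<^sup>+ x. f x \<partial>count_space A) = (\<Sum>\<^sub>\<infinity>x\<in>A. f x)"
proof -
  have bij: "bij_betw (from_nat_into A) UNIV A"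
    using assms by (rule bij_betw_from_nat_into)
  have "(\<lambda>k. f (from_nat_into A k)) summable_on UNIV"
    by (rule nonneg_summable_on_complete) simp
  then have "(\<Sum>k. f (from_nat_into A k)) = (\<Sum>\<^sub>\<infinity>k. f (from_nat_into A k))"
    by (intro sums_unique[symmetric] has_sum_imp_sums has_sum_infsum)
  then show ?thesis
    using nn_integral_bij_count_space[OF bij, of f] infsum_reindex_bij_betw[OF bij, of f]
    by (simp add: nn_integral_count_space_nat)
qed

lemma has_sum_of_nn_integral_finite:
  fixes s :: "'i \<Rightarrow> real"
  assumes "\<And>i. 0 \<le> s i" "(\<integral>\<^sup>+ i. ennreal (s i) \<partial>count_space UNIV) < top"
  shows "(s has_sum enn2real (\<integral>\<^sup>+ i. ennreal (s i) \<partial>count_space UNIV)) UNIV"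
proof -
  have "integrable (count_space UNIV) s"
    using assms by (intro integrableI_nonneg) auto
  then have "Infinite_Set_Sum.abs_summable_on s UNIV"
    by (simp add: Infinite_Set_Sum.abs_summable_on_def)
  moreover from this have "s summable_on UNIV"
    by (simp add: abs_summable_equivalent[symmetric] abs_summable_summable)
  ultimately have "(s has_sum infsetsum s UNIV) UNIV"
    by (simp add: infsetsum_infsum abs_summable_equivalent)
  then show ?thesis
    using assms by (simp add: infsetsum_def integral_eq_nn_integral)
qed

lemma nn_integral_finite_of_summable_on:
  fixes s :: "'i \<Rightarrow> real"
  assumes "\<And>i. 0 \<le> s i" "s summable_on UNIV"
  shows "(\<integral>\<^sup>+ i. ennreal (s i) \<partial>count_space UNIV) < top"
proof -
  have "Infinite_Set_Sum.abs_summable_on s UNIV"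
    using assms by (simp add: abs_summable_equivalent[symmetric])
  then have "integrable (count_space UNIV) s"
    by (simp add: Infinite_Set_Sum.abs_summable_on_def)
  then show ?thesis
    using assms by (simp add: integrable_iff_bounded)
qed

lemma norm_has_sum_le_nn_integral:
  fixes f :: "'i \<Rightarrow> complex"
  assumes "(f has_sum S) UNIV"
  shows "ennreal (norm S) \<le> (\<integral>\<^sup>+ i. ennreal (norm (f i)) \<partial>count_space UNIV)"
proof (rule tendsto_upperbound)
  show "((\<lambda>F. ennreal (norm (sum f F))) \<longlongrightarrow> ennreal (norm S)) (finite_subsets_at_top UNIV)"
    using assms unfolding has_sum_def by (intro tendsto_ennrealI tendsto_norm)
  have "ennreal (norm (sum f F)) \<le> (\<integral>\<^sup>+ i. ennreal (norm (f i)) \<partial>count_space UNIV)" if "finite F" for F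
  proof -
    have "ennreal (norm (sum f F)) \<le> ennreal (\<Sum>i\<in>F. norm (f i))"
      by (intro ennreal_leI norm_sum)
    also have "\<dots> = (\<integral>\<^sup>+ i. ennreal (norm (f i)) \<partial>count_space F)"
      using that by (simp add: nn_integral_count_space_finite sum_ennreal)
    also have "\<dots> = (\<integral>\<^sup>+ i. ennreal (norm (f i)) * indicator F i \<partial>count_space UNIV)"
      by (rule nn_integral_count_space_indicator) (simp add: NO_MATCH_def)
    also have "\<dots> \<le> (\<integral>\<^sup>+ i. ennreal (norm (f i)) \<partial>count_space UNIV)"
      by (intro nn_integral_mono) (auto simp: indicator_def)
    finally show ?thesis .
  qed
  then show "\<forall>\<^sub>F F in finite_subsets_at_top UNIV. ennreal (norm (sum f F)) \<le> (\<integral>\<^sup>+ i. ennreal (norm (f i)) \<partial>count_space UNIV)"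
    by (intro eventually_finite_subsets_at_top_weakI) auto
qed simp

lemma borel_representative:
  fixes f :: "'a::euclidean_space \<Rightarrow> complex"
  assumes "f \<in> borel_measurable lebesgue"
  obtains f' where "f' \<in> borel_measurable borel" "AE x in lborel. f x = f' x"
proof -
  have "(\<lambda>x. Re (f x)) \<in> borel_measurable lebesgue" "(\<lambda>x. Im (f x)) \<in> borel_measurable lebesgue"
    using assms by (auto intro: measurable_compose)
  then obtain u v where uv: "u \<in> borel_measurable lborel" "AE x in lborel. Re (f x) = u x"
      "v \<in> borel_measurable lborel" "AE x in lborel. Im (f x) = v x"
    using completion_ex_borel_measurable_real by blast
  show thesis
  proof
    show "(\<lambda>x. Complex (u x) (v x)) \<in> borel_measurable borel"
      using uv by (simp add: borel_measurable_complex_iff)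
    show "AE x in lborel. f x = Complex (u x) (v x)"
      using uv(2,4) by eventually_elim (simp add: complex_eq_iff)
  qed
qed

abbreviation cube :: "int \<times> (int, 'n) vec \<Rightarrow> (real ^ 'n) set" where
  "cube jk \<equiv> dyadic_cube (fst jk) (snd jk)"

text \<open>
  A cube determines its lower corner, because each of two equal cubes contains the corner of the other; and it determines its
  side, because the corner shifted by the smaller side along the diagonal lies in the cube of larger side only.
\<close>
lemma dyadic_cube_eqD:
  fixes m m' :: "(int, 'n::finite) vec"
  assumes "dyadic_cube j m = dyadic_cube j' m'"
  shows "j = j' \<and> m = m'"
proof -
  define c where "c j m = (\<chi> i. (2 :: real) powi (- j) * of_int (m $ i))" for j and m :: "(int, 'n) vec"
  have pos: "0 < (2 :: real) powi (- j)" for j by simp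
  have c: "c j m \<in> dyadic_cube j m" for j m
    using pos[of j] by (simp add: c_def dyadic_cube_def)
  have corner: "c j m $ i \<le> c j' m' $ i" if "dyadic_cube j m = dyadic_cube j' m'" for j j' m m' i
  proof -
    have "c j' m' \<in> dyadic_cube j m" using c[of j' m'] that by simp
    then show ?thesis by (simp add: dyadic_cube_def c_def)
  qed
  have cc: "c j m = c j' m'"
    using corner[OF assms] corner[OF assms[symmetric]] by (simp add: vec_eq_iff order_antisym)
  have side: "(2 :: real) powi (- j') \<le> 2 powi (- j)" if "dyadic_cube j m = dyadic_cube j' m'" "c j m = c j' m'" for j j' m m'
  proof (rule ccontr)
    assume "\<not> (2 :: real) powi (- j') \<le> 2 powi (- j)"
    then have lt: "(2 :: real) powi (- j) < 2 powi (- j')" by simp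
    let ?x = "\<chi> i. c j m $ i + 2 powi (- j)"
    have "?x \<in> dyadic_cube j' m'"
      unfolding that(2) using lt pos[of j] by (simp add: dyadic_cube_def c_def algebra_simps)
    moreover have "?x \<notin> dyadic_cube j m"
      by (simp add: dyadic_cube_def c_def algebra_simps)
    ultimately show False using that(1) by simp
  qed
  have e: "(2 :: real) powi (- j) = 2 powi (- j')"
    using side[OF assms cc] side[OF assms[symmetric] cc[symmetric]] by simp
  then have "- j = - j'"
    using power_int_strict_increasing[of "- j" "- j'" "2 :: real"]
      power_int_strict_increasing[of "- j'" "- j" "2 :: real"] by linarith
  then have "j = j'" by simp
  moreover have "m = m'"
    using cc pos[of j'] unfolding \<open>j = j'\<close> by (simp add: c_def vec_eq_iff)
  ultimately show ?thesis by simp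
qed

lemma bij_betw_cube: "bij_betw cube UNIV (dyadic_cubes :: (real ^ 'n) set set)"
proof (rule bij_betw_imageI)
  show "inj_on cube (UNIV :: (int \<times> (int, 'n) vec) set)"
    by (auto simp: inj_on_def dest: dyadic_cube_eqD)
  show "range cube = (dyadic_cubes :: (real ^ 'n) set set)"
    by (fastforce simp: dyadic_cubes_def image_iff)
qed

lemma countable_indices: "countable (UNIV :: (int \<times> (int, 'n::finite) vec) set)"
proof -
  have "countable {V :: int ^ 'n. \<forall>i. V $ i \<in> UNIV}"
    by (rule countable_vector) auto
  then have "countable (UNIV :: (int ^ 'n) set)" by simp
  then show ?thesis
    by (metis UNIV_Times_UNIV countable_SIGMA countableI_type)
qed

lemma infinite_indices: "infinite (UNIV :: (int \<times> (int, 'n::finite) vec) set)"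
  using infinite_UNIV_int by (simp add: finite_prod)

lemma sets_dyadic_cube [measurable]: "dyadic_cube j m \<in> sets borel"
proof -
  have "dyadic_cube j m = (\<Inter>i. {x. 2 powi (- j) * of_int (m $ i) \<le> x $ i} \<inter> {x. x $ i < 2 powi (- j) * (of_int (m $ i) + 1)})"
    by (auto simp: dyadic_cube_def)
  also have "\<dots> \<in> sets borel"
    by (intro sets.finite_INT sets.Int borel_closed borel_open closed_Collect_le open_Collect_less continuous_intros) auto
  finally show ?thesis .
qed

abbreviation coords :: "'n::{finite,linorder} list" where
  "coords \<equiv> sorted_list_of_set UNIV"

definition mnorm :: "real ^ 'n::{finite,linorder} \<Rightarrow> ((real, 'n) vec \<Rightarrow> ennreal) \<Rightarrow> ennreal" where
  "mnorm p F = iter_norm p coords F 0"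

definition cube_weight :: "real ^ 'n \<Rightarrow> real \<Rightarrow> int \<times> (int, 'n) vec \<Rightarrow> real" where
  "cube_weight p t jk = measure lebesgue (cube jk) powr (1 / t - 1 / real CARD('n) * sum_recip p)"

definition bm_functional :: "real ^ 'n::{finite,linorder} \<Rightarrow> real \<Rightarrow> real \<Rightarrow> ((real, 'n) vec \<Rightarrow> ennreal) \<Rightarrow> ennreal" where
  "bm_functional p t r F = lnorm (count_space UNIV) r
    (\<lambda>jk. ennreal (cube_weight p t jk) * mnorm p (\<lambda>x. F x * indicator (cube jk) x))"

lemma mixed_norm_eq_mnorm: "mixed_norm p f = mnorm p (\<lambda>x. ennreal (norm (f x)))"
  by (simp add: mixed_norm_def mnorm_def iter_norm_def)

text \<open>
  Both sides are values of iterated norms that are constant functions, and constants that agree almost everywhere are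
  equal.
\<close>
lemma mnorm_cong_AE:
  fixes F G :: "real ^ 'n::{finite,linorder} \<Rightarrow> ennreal"
  assumes "AE x in lborel. F x = G x"
  shows "mnorm p F = mnorm p G"
proof -
  have "AE x in lborel. iter_norm p coords F x = iter_norm p coords G x"
    by (rule iter_norm_cong_AE[OF assms])
  moreover have "iter_norm p coords H x = mnorm p H" for H x
    unfolding mnorm_def by (rule iter_norm_agree) simp
  ultimately have "AE x in (lborel :: (real, 'n) vec measure). mnorm p F = mnorm p G"
    by simp
  moreover have "ae_filter (lborel :: (real, 'n) vec measure) \<noteq> bot"
    by (simp add: ae_filter_eq_bot_iff)
  ultimately show ?thesis
    by (simp add: eventually_const)
qed

lemma bm_norm_eq_bm_functional:
  fixes p :: "real ^ 'n::{finite,linorder}"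
  assumes "0 < r"
  shows "bm_norm p t r f = bm_functional p t r (\<lambda>x. ennreal (norm (f x)))"
proof -
  have n: "ennreal (norm (f x * indicator Q x)) = ennreal (norm (f x)) * indicator Q x" for Q x
    by (simp add: indicator_def)
  have e: "r / t - r / real CARD('n) * sum_recip p = (1 / t - 1 / real CARD('n) * sum_recip p) * r"
    by (simp add: field_simps)
  have "(\<Sum>\<^sub>\<infinity>Q\<in>dyadic_cubes. ennreal (measure lebesgue Q powr (r / t - r / real CARD('n) * sum_recip p)) *
          ennpow (mixed_norm p (\<lambda>x. f x * indicator Q x)) r)
      = (\<Sum>\<^sub>\<infinity>jk\<in>UNIV. ennreal (measure lebesgue (cube jk) powr (r / t - r / real CARD('n) * sum_recip p)) *
          ennpow (mixed_norm p (\<lambda>x. f x * indicator (cube jk) x)) r)"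
    by (rule infsum_reindex_bij_betw[OF bij_betw_cube, symmetric])
  also have "\<dots> = (\<Sum>\<^sub>\<infinity>jk\<in>UNIV. ennpow (ennreal (cube_weight p t jk) * mnorm p (\<lambda>x. ennreal (norm (f x)) * indicator (cube jk) x)) r)"
    unfolding e using assms
    by (simp add: ennpow_mult cube_weight_def ennpow_ennreal powr_powr mixed_norm_eq_mnorm n)
  also have "\<dots> = (\<integral>\<^sup>+ jk. ennpow (ennreal (cube_weight p t jk) * mnorm p (\<lambda>x. ennreal (norm (f x)) * indicator (cube jk) x)) r \<partial>count_space UNIV)"
    by (rule nn_integral_count_space_eq_infsum[OF countable_indices infinite_indices, symmetric])
  finally show ?thesis
    by (simp add: bm_norm_def bm_functional_def lnorm_def)
qed

lemma bm_functional_cong_AE: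
  assumes "AE x in lborel. F x = G x"
  shows "bm_functional p t r F = bm_functional p t r G"
proof -
  have "mnorm p (\<lambda>x. F x * indicator (cube jk) x) = mnorm p (\<lambda>x. G x * indicator (cube jk) x)" for jk
    using assms by (intro mnorm_cong_AE) (auto elim: eventually_mono)
  then show ?thesis by (simp add: bm_functional_def)
qed

lemma mnorm_mono: 
  assumes "\<And>i. 0 < p $ i" "\<And>x. F x \<le> G x"
  shows "mnorm p F \<le> mnorm p G"
proof -
  interpret norm_operator "Min (range (($) p))" "Max (range (($) p))" borel borel "iter_norm p coords"
    using assms by (intro norm_operator_iter_norm) auto
  show ?thesis unfolding mnorm_def by (rule mono_T[OF assms(2)])
qed

lemma mnorm_cmult:
  assumes "\<And>i. 0 < p $ i" "F \<in> borel_measurable borel"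
  shows "mnorm p (\<lambda>x. ennreal c * F x) = ennreal c * mnorm p F"
proof -
  interpret norm_operator "Min (range (($) p))" "Max (range (($) p))" borel borel "iter_norm p coords"
    using assms by (intro norm_operator_iter_norm) auto
  show ?thesis unfolding mnorm_def by (rule cmult_T[OF assms(2)])
qed

lemma Hoelder_mnorm:
  assumes [measurable]: "F \<in> borel_measurable borel" "G \<in> borel_measurable borel" and p: "\<And>i. 1 < p $ i"
  shows "(\<integral>\<^sup>+ x. F x * G x \<partial>lborel) \<le> mnorm p F * mnorm (conj_vec p) G"
proof -
  have "(\<integral>\<^sup>+ x. F x * G x \<partial>lborel) = iter_norm 1 coords (\<lambda>x. F x * G x) 0"
    by (rule iter_norm_1[symmetric]) auto
  also have "\<dots> \<le> mnorm p F * mnorm (conj_vec p) G"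
    unfolding mnorm_def using p by (intro Hoelder_iter_norm) auto
  finally show ?thesis .
qed

lemma ex_norming_mnorm:
  assumes [measurable]: "F \<in> borel_measurable borel" and p: "\<And>i. 1 < p $ i"
  obtains G where "G \<in> borel_measurable borel" "\<And>x. G x < top" "mnorm (conj_vec p) G \<le> 1"
    "mnorm p F < top \<Longrightarrow> (\<integral>\<^sup>+ x. F x * G x \<partial>lborel) = mnorm p F"
proof -
  obtain G where G [measurable]: "G \<in> borel_measurable borel" and "\<And>x. G x < top"
      "\<And>x. iter_norm (conj_vec p) coords G x \<le> 1"
      "\<And>x. iter_norm p coords F x < top \<Longrightarrow> iter_norm 1 coords (\<lambda>x. F x * G x) x = iter_norm p coords F x"
    using ex_norming_iter_norm[OF assms(1) p, of coords] by blast
  moreover have "iter_norm 1 coords (\<lambda>x. F x * G x) 0 = (\<integral>\<^sup>+ x. F x * G x \<partial>lborel)"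
    by (rule iter_norm_1) auto
  ultimately show thesis
    by (intro that[of G]) (auto simp: mnorm_def)
qed

lemma lattice_norm_bm_functional:
  fixes p :: "real ^ 'n::{finite,linorder}"
  assumes p: "\<And>i. 1 < p $ i" and r: "1 < r"
  obtains a b where "lattice_norm a b borel (\<lambda>F _. bm_functional p t r F)"
proof -
  define a where "a = Min (insert 2 (insert r (range (($) p))))"
  define b where "b = Max (insert 2 (insert r (range (($) p))))"
  have "1 < a"
    unfolding a_def using p r by (subst Min_gr_iff) auto
  have a: "a \<le> 2" "a \<le> r" "a \<le> p $ i" for i
    unfolding a_def by (rule Min_le; simp)+
  have b: "2 \<le> b" "r \<le> b" "p $ i \<le> b" for i
    unfolding b_def by (rule Max_ge; simp)+
  have "norm_operator a b borel borel (iter_norm p coords)"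
    using \<open>1 < a\<close> a b by (intro norm_operator_iter_norm) auto
  then have "norm_operator a b borel (count_space UNIV)
      (\<lambda>F jk. ennreal (cube_weight p t jk) * iter_norm p coords (\<lambda>x. F x * indicator (cube jk) x) 0)"
    by (intro norm_operator_family) auto
  moreover have "norm_operator a b (count_space UNIV) (count_space (UNIV :: unit set))
      (\<lambda>F _. lnorm (count_space (UNIV :: (int \<times> (int, 'n) vec) set)) r F)"
    using \<open>1 < a\<close> a b by (intro norm_operator_lnorm) auto
  ultimately have "norm_operator a b borel (count_space (UNIV :: unit set)) (\<lambda>F _. bm_functional p t r F)"
    unfolding bm_functional_def mnorm_def by (rule norm_operator_comp)
  then show thesis
    using \<open>1 < a\<close> a b by (intro that[of a b]) (simp add: lattice_norm_def lattice_norm_axioms_def)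
qed

section \<open>Duality with the block space\<close>

text \<open>
  Hoelder's inequality on every cube bounds the sum by \<open>\<Sum> \<lambda>\<^sub>Q w\<^sub>Q \<parallel>F \<chi>\<^sub>Q\<parallel>\<close>, where \<open>w\<^sub>Q\<close> is the power of \<open>\<bar>Q\<bar>\<close> that occurs both
  in the size condition of a block and in the Bourgain-Morrey norm; Hoelder's inequality for sums does the rest.
\<close>
lemma series_pairing_le:
  fixes p :: "real ^ 'n::{finite,linorder}" and B :: "int \<times> (int, 'n) vec \<Rightarrow> (real, 'n) vec \<Rightarrow> ennreal"
  assumes p: "\<And>i. 1 < p $ i" and r: "1 < r"
    and [measurable]: "F \<in> borel_measurable borel" "\<And>jk. B jk \<in> borel_measurable borel"
    and supp: "\<And>jk. AE x in lborel. x \<notin> cube jk \<longrightarrow> B jk x = 0"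
    and B: "\<And>jk. mnorm (conj_vec p) (B jk) \<le> ennreal (cube_weight p t jk)"
  shows "(\<integral>\<^sup>+ x. F x * (\<integral>\<^sup>+ jk. lam jk * B jk x \<partial>count_space UNIV) \<partial>lborel)
    \<le> lnorm (count_space UNIV) (conj_exp r) lam * bm_functional p t r F"
proof -
  have "(\<integral>\<^sup>+ x. F x * (\<integral>\<^sup>+ jk. lam jk * B jk x \<partial>count_space UNIV) \<partial>lborel)
      = (\<integral>\<^sup>+ x. \<integral>\<^sup>+ jk. F x * (lam jk * B jk x) \<partial>count_space UNIV \<partial>lborel)"
    by (simp add: nn_integral_cmult)
  also have "\<dots> = (\<integral>\<^sup>+ jk. \<integral>\<^sup>+ x. F x * (lam jk * B jk x) \<partial>lborel \<partial>count_space UNIV)"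
    by (rule nn_integral_count_space_nn_integral[OF countable_indices]) measurable
  also have "\<dots> \<le> (\<integral>\<^sup>+ jk. lam jk * (ennreal (cube_weight p t jk) * mnorm p (\<lambda>x. F x * indicator (cube jk) x)) \<partial>count_space UNIV)"
  proof (intro nn_integral_mono)
    fix jk :: "int \<times> (int, 'n) vec"
    have "AE x in lborel. F x * (lam jk * B jk x) = lam jk * ((F x * indicator (cube jk) x) * B jk x)"
      using supp[of jk] by eventually_elim (auto simp: indicator_def mult_ac)
    then have "(\<integral>\<^sup>+ x. F x * (lam jk * B jk x) \<partial>lborel)
        = (\<integral>\<^sup>+ x. lam jk * ((F x * indicator (cube jk) x) * B jk x) \<partial>lborel)"
      by (rule nn_integral_cong_AE)
    also have "\<dots> = lam jk * (\<integral>\<^sup>+ x. (F x * indicator (cube jk) x) * B jk x \<partial>lborel)"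
      by (rule nn_integral_cmult) measurable
    also have "\<dots> \<le> lam jk * (mnorm p (\<lambda>x. F x * indicator (cube jk) x) * mnorm (conj_vec p) (B jk))"
      using p by (intro mult_left_mono Hoelder_mnorm) auto
    also have "\<dots> \<le> lam jk * (mnorm p (\<lambda>x. F x * indicator (cube jk) x) * ennreal (cube_weight p t jk))"
      by (intro mult_left_mono B) auto
    finally show "(\<integral>\<^sup>+ x. F x * (lam jk * B jk x) \<partial>lborel)
        \<le> lam jk * (ennreal (cube_weight p t jk) * mnorm p (\<lambda>x. F x * indicator (cube jk) x))"
      by (simp add: mult_ac)
  qed
  also have "\<dots> = (\<integral>\<^sup>+ jk. (ennreal (cube_weight p t jk) * mnorm p (\<lambda>x. F x * indicator (cube jk) x)) * lam jk \<partial>count_space UNIV)"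
    by (simp add: mult_ac)
  also have "\<dots> \<le> bm_functional p t r F * lnorm (count_space UNIV) (conj_exp r) lam"
    unfolding bm_functional_def using r by (intro Hoelder_lnorm) auto
  finally show ?thesis by (simp add: mult.commute)
qed

text \<open>
  The blocks are replaced by Borel functions, simultaneously for the countably many cubes.
\<close>
lemma block_pairing_le:
  fixes p :: "real ^ 'n::{finite,linorder}" and b :: "int \<times> (int, 'n) vec \<Rightarrow> (real, 'n) vec \<Rightarrow> complex"
  assumes p: "\<And>i. 1 < p $ i" and r: "1 < r"
    and f: "f \<in> borel_measurable lebesgue"
    and b: "\<And>j k. is_block p t (dyadic_cube j k) (b (j, k))"
    and g: "AE x in lebesgue. ((\<lambda>jk. lam jk * b jk x) has_sum g x) UNIV"
  shows "(\<integral>\<^sup>+ x. ennreal (norm (f x * g x)) \<partial>lebesgue)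
    \<le> lnorm (count_space UNIV) (conj_exp r) (\<lambda>jk. ennreal (norm (lam jk))) * bm_norm p t r f"
proof -
  obtain f' where f' [measurable]: "f' \<in> borel_measurable borel" and ff': "AE x in lborel. f x = f' x"
    using borel_representative[OF f] by blast
  have bl: "b jk \<in> borel_measurable lebesgue" "AE x in lebesgue. x \<notin> cube jk \<longrightarrow> b jk x = 0"
      "mixed_norm (conj_vec p) (b jk) \<le> ennreal (cube_weight p t jk)" for jk
    using b[of "fst jk" "snd jk"] by (auto simp: is_block_def cube_weight_def)
  have "\<exists>b'. b' \<in> borel_measurable borel \<and> (AE x in lborel. b jk x = b' x)" for jk
    using borel_representative[OF bl(1)] by metis
  then obtain b' where b' [measurable]: "\<And>jk. b' jk \<in> borel_measurable borel" and bb': "\<And>jk. AE x in lborel. b jk x = b' jk x"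
    by metis
  have all: "AE x in lborel. \<forall>jk. b jk x = b' jk x"
    using AE_ball_countable'[OF bb' countable_indices] by simp
  have g': "AE x in lborel. ((\<lambda>jk. lam jk * b jk x) has_sum g x) UNIV"
    using g by (simp add: AE_completion_iff)
  have "(\<integral>\<^sup>+ x. ennreal (norm (f x * g x)) \<partial>lebesgue) = (\<integral>\<^sup>+ x. ennreal (norm (f x * g x)) \<partial>lborel)"
    by (rule nn_integral_completion)
  also have "\<dots> \<le> (\<integral>\<^sup>+ x. ennreal (norm (f' x)) * (\<integral>\<^sup>+ jk. ennreal (norm (lam jk)) * ennreal (norm (b' jk x)) \<partial>count_space UNIV) \<partial>lborel)"
  proof (rule nn_integral_mono_AE)
    show "AE x in lborel. ennreal (norm (f x * g x))
      \<le> ennreal (norm (f' x)) * (\<integral>\<^sup>+ jk. ennreal (norm (lam jk)) * ennreal (norm (b' jk x)) \<partial>count_space UNIV)"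
      using ff' all g'
    proof eventually_elim
      case (elim x)
      have "ennreal (norm (g x)) \<le> (\<integral>\<^sup>+ jk. ennreal (norm (lam jk)) * ennreal (norm (b' jk x)) \<partial>count_space UNIV)"
        using norm_has_sum_le_nn_integral[OF elim(3)] elim(2) by (simp add: norm_mult ennreal_mult)
      then show ?case
        using elim(1) by (simp add: norm_mult ennreal_mult mult_left_mono)
    qed
  qed
  also have "\<dots> \<le> lnorm (count_space UNIV) (conj_exp r) (\<lambda>jk. ennreal (norm (lam jk))) * bm_functional p t r (\<lambda>x. ennreal (norm (f' x)))"
  proof (rule series_pairing_le[OF p r])
    fix jk
    show "AE x in lborel. x \<notin> cube jk \<longrightarrow> ennreal (norm (b' jk x)) = 0"
      using bl(2)[of jk, unfolded AE_completion_iff] bb'[of jk] by eventually_elim auto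
    have "mnorm (conj_vec p) (\<lambda>x. ennreal (norm (b' jk x))) = mixed_norm (conj_vec p) (b jk)"
      unfolding mixed_norm_eq_mnorm using bb'[of jk] by (intro mnorm_cong_AE) (auto elim: eventually_mono)
    then show "mnorm (conj_vec p) (\<lambda>x. ennreal (norm (b' jk x))) \<le> ennreal (cube_weight p t jk)"
      using bl(3) by simp
  qed measurable
  also have "bm_functional p t r (\<lambda>x. ennreal (norm (f' x))) = bm_norm p t r f"
    using r ff' by (subst bm_norm_eq_bm_functional) (auto intro!: bm_functional_cong_AE elim: eventually_mono)
  finally show ?thesis .
qed

lemma block_space_pairing:
  fixes p :: "real ^ 'n::{finite,linorder}"
  assumes p: "\<And>i. 1 < p $ i" and r: "1 < r"
    and g [measurable]: "g \<in> borel_measurable lebesgue"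
    and b: "\<And>j k. is_block p t (dyadic_cube j k) (b (j, k))"
    and sum: "AE x in lebesgue. ((\<lambda>jk. lam jk * b jk x) has_sum g x) UNIV"
    and fin: "lnorm (count_space UNIV) (conj_exp r) (\<lambda>jk. ennreal (norm (lam jk))) < top"
    and f: "f \<in> bm_space p t r"
  shows "integrable lebesgue (\<lambda>x. f x * g x)"
    and "norm (pairing g f) \<le> enn2real (lnorm (count_space UNIV) (conj_exp r) (\<lambda>jk. ennreal (norm (lam jk)))) * enn2real (bm_norm p t r f)"
proof -
  have f' [measurable]: "f \<in> borel_measurable lebesgue" and fb: "bm_norm p t r f < top"
    using f by (auto simp: bm_space_def)
  note le = block_pairing_le[OF p r f' b sum]
  have fin': "lnorm (count_space UNIV) (conj_exp r) (\<lambda>jk. ennreal (norm (lam jk))) * bm_norm p t r f < top"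
    using fin fb by (simp add: ennreal_mult_less_top)
  show int: "integrable lebesgue (\<lambda>x. f x * g x)"
    using le fin' by (intro integrableI_bounded) (auto intro: le_less_trans)
  have "ennreal (norm (pairing g f)) \<le> (\<integral>\<^sup>+ x. ennreal (norm (f x * g x)) \<partial>lebesgue)"
    unfolding pairing_def by (rule integral_norm_bound_ennreal[OF int])
  also note le
  finally have "ennreal (norm (pairing g f)) \<le> lnorm (count_space UNIV) (conj_exp r) (\<lambda>jk. ennreal (norm (lam jk))) * bm_norm p t r f" .
  from enn2real_mono[OF this fin']
  show "norm (pairing g f) \<le> enn2real (lnorm (count_space UNIV) (conj_exp r) (\<lambda>jk. ennreal (norm (lam jk)))) * enn2real (bm_norm p t r f)"
    by (simp add: enn2real_mult)
qed

lemma lnorm_finite_of_summable: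
  assumes "(\<lambda>jk. norm (lam jk) powr s) summable_on UNIV"
  shows "lnorm (count_space UNIV) s (\<lambda>jk. ennreal (norm (lam jk))) < top"
  using nn_integral_finite_of_summable_on[OF _ assms] by (simp add: lnorm_def ennpow_ennreal)

lemma summable_of_lnorm_finite:
  assumes "lnorm (count_space UNIV) s (\<lambda>jk. ennreal (norm (lam jk))) < top"
  shows "(\<lambda>jk. norm (lam jk) powr s) summable_on UNIV"
  using has_sum_of_nn_integral_finite[of "\<lambda>jk. norm (lam jk) powr s"] assms
  by (auto simp: lnorm_def ennpow_ennreal summable_on_def)

lemma pairing_in_bm_dual:
  fixes p :: "real ^ 'n::{finite,linorder}"
  assumes p: "\<And>i. 1 < p $ i" and r: "1 < r" and g: "g \<in> block_space p t r"
  shows "\<forall>f\<in>bm_space p t r. integrable lebesgue (\<lambda>x. f x * g x)" and "pairing g \<in> bm_dual p t r"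
proof -
  obtain lam b where *: "g \<in> borel_measurable lebesgue" "(\<lambda>jk. norm (lam jk) powr conj_exp r) summable_on UNIV"
      "\<And>j k. is_block p t (dyadic_cube j k) (b (j, k))"
      "AE x in lebesgue. ((\<lambda>jk. lam jk * b jk x) has_sum g x) UNIV"
    using g unfolding block_space_def by blast
  note bp = block_space_pairing[OF p r *(1,3,4) lnorm_finite_of_summable[OF *(2)]]
  show int: "\<forall>f\<in>bm_space p t r. integrable lebesgue (\<lambda>x. f x * g x)"
    using bp(1) by blast
  show "pairing g \<in> bm_dual p t r"
    unfolding bm_dual_def
  proof (intro CollectI conjI ballI allI)
    show "pairing g (\<lambda>x. f x + h x) = pairing g f + pairing g h" if "f \<in> bm_space p t r" "h \<in> bm_space p t r" for f h
      using int that by (simp add: pairing_def distrib_right)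
    show "pairing g (\<lambda>x. c * f x) = c * pairing g f" for c f
      by (simp add: pairing_def mult.assoc)
    show "\<exists>C. \<forall>f\<in>bm_space p t r. norm (pairing g f) \<le> C * enn2real (bm_norm p t r f)"
      using bp(2) by blast
  qed
qed

lemma block_space_cmult:
  assumes "g \<in> block_space p t r"
  shows "(\<lambda>x. c * g x) \<in> block_space p t r"
proof -
  obtain lam b where *: "g \<in> borel_measurable lebesgue" "(\<lambda>jk. norm (lam jk) powr conj_exp r) summable_on UNIV"
      "\<forall>j k. is_block p t (dyadic_cube j k) (b (j, k))"
      "AE x in lebesgue. ((\<lambda>jk. lam jk * b jk x) has_sum g x) UNIV"
    using assms unfolding block_space_def by blast
  have "(\<lambda>jk. norm (c * lam jk) powr conj_exp r) summable_on UNIV"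
    using summable_on_cmult_right[OF *(2), of "norm c powr conj_exp r"] by (simp add: norm_mult powr_mult)
  moreover have "AE x in lebesgue. ((\<lambda>jk. c * lam jk * b jk x) has_sum c * g x) UNIV"
    using *(4) by eventually_elim (simp add: mult.assoc has_sum_cmult_right)
  moreover have "(\<lambda>x. c * g x) \<in> borel_measurable lebesgue"
    using *(1) by measurable
  ultimately show ?thesis
    using *(3) unfolding block_space_def by (auto intro!: exI[of _ "\<lambda>jk. c * lam jk"] exI[of _ b])
qed

lemma measurable_nn_integral_indices:
  assumes [measurable]: "\<And>jk. h jk \<in> borel_measurable M"
  shows "(\<lambda>x. \<integral>\<^sup>+ jk. h jk x \<partial>count_space (UNIV :: (int \<times> (int, 'n::finite) vec) set)) \<in> borel_measurable M"
proof -
  have bij: "bij_betw (from_nat_into UNIV) UNIV (UNIV :: (int \<times> (int, 'n) vec) set)"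
    using countable_indices infinite_indices by (rule bij_betw_from_nat_into)
  have "(\<lambda>x. \<integral>\<^sup>+ jk. h jk x \<partial>count_space (UNIV :: (int \<times> (int, 'n) vec) set))
      = (\<lambda>x. \<Sum>k. h (from_nat_into UNIV k) x)"
    using nn_integral_bij_count_space[OF bij, of "\<lambda>jk. h jk x" for x] by (simp add: nn_integral_count_space_nat)
  then show ?thesis by simp
qed

text \<open>
  On each cube take an extremal function \<open>G\<^sub>Q\<close> for \<open>f\<^sub>0 \<chi>\<^sub>Q\<close>, and let \<open>\<Lambda>\<close> be the extremal sequence for
  \<open>X\<^sub>Q = w\<^sub>Q \<parallel>f\<^sub>0 \<chi>\<^sub>Q\<parallel>\<close>.  The blocks are \<open>w\<^sub>Q G\<^sub>Q \<chi>\<^sub>Q\<close> with the phase conjugate to that of \<open>f\<^sub>0\<close>.  Their series converges where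
  \<open>f\<^sub>0\<close> vanishes, since all terms are zero there, and almost everywhere else, since
  \<open>\<integral> \<bar>f\<^sub>0\<bar> \<Sum> \<Lambda>\<^sub>Q w\<^sub>Q G\<^sub>Q \<chi>\<^sub>Q = \<Sum> \<Lambda>\<^sub>Q X\<^sub>Q = 1\<close>.
\<close>
lemma ex_norming_block_series:
  fixes p :: "real ^ 'n::{finite,linorder}"
  assumes p: "\<And>i. 1 < p $ i" and r: "1 < r"
    and f0 [measurable]: "f0 \<in> borel_measurable borel"
    and norm1: "bm_functional p t r (\<lambda>x. ennreal (norm (f0 x))) = 1"
  obtains g where "g \<in> block_space p t r" "pairing g f0 = 1"
    "\<And>f. f \<in> bm_space p t r \<Longrightarrow> norm (pairing g f) \<le> enn2real (bm_norm p t r f)"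
proof -
  let ?C = "count_space (UNIV :: (int \<times> (int, 'n) vec) set)"
  define F where "F jk x = ennreal (norm (f0 x)) * indicator (cube jk) x" for jk x
  define X where "X jk = ennreal (cube_weight p t jk) * mnorm p (F jk)" for jk
  define \<Lambda> where "\<Lambda> jk = norming r 1 (X jk)" for jk
  have F [measurable]: "F jk \<in> borel_measurable borel" for jk
    unfolding F_def by measurable
  have "\<exists>G. G \<in> borel_measurable borel \<and> (\<forall>x. G x < top) \<and> mnorm (conj_vec p) G \<le> 1 \<and>
      (mnorm p (F jk) < top \<longrightarrow> (\<integral>\<^sup>+ x. F jk x * G x \<partial>lborel) = mnorm p (F jk))" for jk
    using ex_norming_mnorm[OF F p] by metis
  then obtain G where G [measurable]: "\<And>jk. G jk \<in> borel_measurable borel"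
    and G': "\<And>jk x. G jk x < top" "\<And>jk. mnorm (conj_vec p) (G jk) \<le> 1"
      "\<And>jk. mnorm p (F jk) < top \<Longrightarrow> (\<integral>\<^sup>+ x. F jk x * G jk x \<partial>lborel) = mnorm p (F jk)"
    by metis
  define B where "B jk x = ennreal (cube_weight p t jk) * (G jk x * indicator (cube jk) x)" for jk x
  define S where "S x = (\<integral>\<^sup>+ jk. \<Lambda> jk * B jk x \<partial>?C)" for x
  have B [measurable]: "B jk \<in> borel_measurable borel" for jk
    unfolding B_def by measurable
  have S [measurable]: "S \<in> borel_measurable borel"
    unfolding S_def by (rule measurable_nn_integral_indices) measurable
  have X: "lnorm ?C r X = 1"
    using norm1 by (simp add: bm_functional_def X_def[abs_def] F_def[abs_def])
  have fin: "\<Lambda> jk < top" "B jk x < top" for jk x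
    using G'(1)[of jk x] by (auto simp: \<Lambda>_def norming_finite B_def ennreal_mult_less_top indicator_def)
  have \<Lambda>B: "ennreal (enn2real (\<Lambda> jk) * enn2real (B jk x)) = \<Lambda> jk * B jk x" for jk x
    using fin by (simp add: ennreal_mult)
  have \<Lambda>X: "\<Lambda> jk * (\<integral>\<^sup>+ x. ennreal (norm (f0 x)) * B jk x \<partial>lborel) = X jk * \<Lambda> jk" for jk
  proof -
    have "(\<integral>\<^sup>+ x. ennreal (norm (f0 x)) * B jk x \<partial>lborel) = (\<integral>\<^sup>+ x. ennreal (cube_weight p t jk) * (F jk x * G jk x) \<partial>lborel)"
      by (simp add: B_def F_def mult_ac)
    also have "\<dots> = ennreal (cube_weight p t jk) * (\<integral>\<^sup>+ x. F jk x * G jk x \<partial>lborel)"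
      by (rule nn_integral_cmult) measurable
    finally have e: "(\<integral>\<^sup>+ x. ennreal (norm (f0 x)) * B jk x \<partial>lborel) = ennreal (cube_weight p t jk) * (\<integral>\<^sup>+ x. F jk x * G jk x \<partial>lborel)" .
    \<comment> \<open>\<open>G jk\<close> is known to be extremal only if the mixed norm is finite.\<close>
    consider "X jk = top" | "ennreal (cube_weight p t jk) = 0" | "mnorm p (F jk) < top"
      by (auto simp: X_def ennreal_mult_eq_top_iff less_top[symmetric])
    then show ?thesis
    proof cases
      case 1
      then have "\<Lambda> jk = 0" by (simp add: \<Lambda>_def norming_def)
      then show ?thesis by simp
    next
      case 2
      then show ?thesis unfolding e by (simp add: X_def)
    next
      case 3
      then show ?thesis unfolding e by (simp add: X_def G'(3) mult.commute)
    qed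
  qed
  have total: "(\<integral>\<^sup>+ x. ennreal (norm (f0 x)) * S x \<partial>lborel) = 1"
  proof -
    have "(\<integral>\<^sup>+ x. ennreal (norm (f0 x)) * S x \<partial>lborel)
        = (\<integral>\<^sup>+ x. \<integral>\<^sup>+ jk. ennreal (norm (f0 x)) * (\<Lambda> jk * B jk x) \<partial>?C \<partial>lborel)"
      unfolding S_def by (simp add: nn_integral_cmult)
    also have "\<dots> = (\<integral>\<^sup>+ jk. \<integral>\<^sup>+ x. ennreal (norm (f0 x)) * (\<Lambda> jk * B jk x) \<partial>lborel \<partial>?C)"
      by (rule nn_integral_count_space_nn_integral[OF countable_indices]) measurable
    also have "\<dots> = (\<integral>\<^sup>+ jk. \<integral>\<^sup>+ x. \<Lambda> jk * (ennreal (norm (f0 x)) * B jk x) \<partial>lborel \<partial>?C)"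
      by (simp add: mult.left_commute)
    also have "\<dots> = (\<integral>\<^sup>+ jk. \<Lambda> jk * (\<integral>\<^sup>+ x. ennreal (norm (f0 x)) * B jk x \<partial>lborel) \<partial>?C)"
      by (intro nn_integral_cong nn_integral_cmult) measurable
    also have "\<dots> = (\<integral>\<^sup>+ jk. X jk * norming r (lnorm ?C r X) (X jk) \<partial>?C)"
      unfolding \<Lambda>X unfolding X \<Lambda>_def ..
    also have "\<dots> = 1"
      using nn_integral_norming[OF r, of X ?C] X by simp
    finally show ?thesis .
  qed
  have AE_fin: "AE x in lborel. ennreal (norm (f0 x)) * S x \<noteq> \<infinity>"
    using total by (intro nn_integral_noteq_infinite) auto
  define ph where "ph x = cnj (sgn (f0 x))" for x
  have ph [measurable]: "ph \<in> borel_measurable borel"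
  proof -
    have "(\<lambda>x. sgn (f0 x)) \<in> borel_measurable borel"
      unfolding sgn_div_norm by measurable
    moreover have "cnj \<in> borel_measurable borel"
      by (intro borel_measurable_continuous_onI continuous_on_cnj continuous_on_id)
    ultimately show ?thesis
      unfolding ph_def[abs_def] by (rule measurable_compose)
  qed
  have ph_norm: "norm (ph x) \<le> 1" for x
    by (simp add: ph_def norm_sgn)
  have ph_f0: "f0 x * ph x = complex_of_real (norm (f0 x))" for x
  proof -
    have "f0 x * ph x = (f0 x * cnj (f0 x)) / complex_of_real (norm (f0 x))"
      by (simp add: ph_def sgn_eq)
    then show ?thesis
      by (simp add: complex_norm_square[symmetric] power2_eq_square)
  qed
  define b where "b jk x = ph x * complex_of_real (enn2real (B jk x))" for jk x
  define g where "g x = ph x * complex_of_real (enn2real (S x))" for x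
  define lam where "lam jk = complex_of_real (enn2real (\<Lambda> jk))" for jk
  have lam: "ennreal (norm (lam jk)) = \<Lambda> jk" for jk
    using fin by (simp add: lam_def)
  have lam_le: "lnorm ?C (conj_exp r) (\<lambda>jk. ennreal (norm (lam jk))) \<le> 1"
    unfolding lam \<Lambda>_def using lnorm_norming_le[OF r, of X ?C] X by simp
  have g_m: "g \<in> borel_measurable lebesgue"
    unfolding g_def by (rule measurable_completion) measurable
  have block: "is_block p t (dyadic_cube j k) (b (j, k))" for j k
    unfolding is_block_def
  proof (intro conjI)
    show "b (j, k) \<in> borel_measurable lebesgue"
      unfolding b_def by (rule measurable_completion) measurable
    show "AE x in lebesgue. x \<notin> dyadic_cube j k \<longrightarrow> b (j, k) x = 0"
      by (simp add: b_def B_def)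
    have cp: "0 < conj_vec p $ i" for i
      using p by (simp add: conj_exp_pos)
    have le: "ennreal (norm (b (j, k) x)) \<le> ennreal (cube_weight p t (j, k)) * G (j, k) x" for x
    proof -
      have "norm (b (j, k) x) \<le> 1 * enn2real (B (j, k) x)"
        unfolding b_def norm_mult using ph_norm by (intro mult_mono) auto
      then have "ennreal (norm (b (j, k) x)) \<le> B (j, k) x"
        using fin(2)[of "(j, k)" x] by (metis ennreal_enn2real ennreal_leI mult_1)
      also have "\<dots> \<le> ennreal (cube_weight p t (j, k)) * G (j, k) x"
        by (auto simp: B_def indicator_def)
      finally show ?thesis .
    qed
    have "mixed_norm (conj_vec p) (b (j, k)) \<le> mnorm (conj_vec p) (\<lambda>x. ennreal (cube_weight p t (j, k)) * G (j, k) x)"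
      unfolding mixed_norm_eq_mnorm by (rule mnorm_mono[OF cp le])
    also have "\<dots> = ennreal (cube_weight p t (j, k)) * mnorm (conj_vec p) (G (j, k))"
      by (rule mnorm_cmult[OF cp G])
    also have "\<dots> \<le> ennreal (cube_weight p t (j, k)) * 1"
      by (intro mult_left_mono G') auto
    finally show "mixed_norm (conj_vec p) (b (j, k))
        \<le> ennreal (measure lebesgue (dyadic_cube j k) powr (1 / t - 1 / real CARD('n) * sum_recip p))"
      by (simp add: cube_weight_def)
  qed
  have sum: "AE x in lebesgue. ((\<lambda>jk. lam jk * b jk x) has_sum g x) UNIV"
    unfolding AE_completion_iff using AE_fin
  proof eventually_elim
    case (elim x)
    show ?case
    proof (cases "f0 x = 0")
      case True
      then show ?thesis by (simp add: b_def g_def ph_def)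
    next
      case False
      then have "S x < top"
        using elim by (auto simp: ennreal_mult_eq_top_iff less_top[symmetric])
      then have "((\<lambda>jk. enn2real (\<Lambda> jk) * enn2real (B jk x)) has_sum enn2real (S x)) UNIV"
        using has_sum_of_nn_integral_finite[of "\<lambda>jk. enn2real (\<Lambda> jk) * enn2real (B jk x)"]
        by (simp add: \<Lambda>B S_def)
      from has_sum_cmult_right[OF has_sum_of_real[OF this, where 'a = complex], of "ph x"]
      show ?thesis
        by (simp add: lam_def b_def g_def mult_ac)
    qed
  qed
  have "g \<in> block_space p t r"
    unfolding block_space_def using g_m block sum summable_of_lnorm_finite[OF le_less_trans[OF lam_le]]
    by auto
  moreover have "pairing g f0 = 1"
  proof -
    have "(\<integral>\<^sup>+ x. ennreal (enn2real (ennreal (norm (f0 x)) * S x)) \<partial>lborel) = (\<integral>\<^sup>+ x. ennreal (norm (f0 x)) * S x \<partial>lborel)"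
      using AE_fin by (intro nn_integral_cong_AE) (auto simp: less_top elim!: eventually_mono)
    then have "(\<integral> x. enn2real (ennreal (norm (f0 x)) * S x) \<partial>lborel) = 1"
      using total by (subst integral_eq_nn_integral) auto
    moreover have "f0 x * g x = complex_of_real (enn2real (ennreal (norm (f0 x)) * S x))" for x
    proof -
      have "f0 x * g x = (f0 x * ph x) * complex_of_real (enn2real (S x))"
        by (simp add: g_def)
      then show ?thesis by (simp add: ph_f0 enn2real_mult)
    qed
    then have "pairing g f0 = (\<integral> x. complex_of_real (enn2real (ennreal (norm (f0 x)) * S x)) \<partial>lborel)"
      unfolding pairing_def by (subst integral_completion) auto
    ultimately show ?thesis by simp
  qed
  moreover have "norm (pairing g f) \<le> enn2real (bm_norm p t r f)" if f: "f \<in> bm_space p t r" for f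
  proof -
    have "norm (pairing g f) \<le> enn2real (lnorm ?C (conj_exp r) (\<lambda>jk. ennreal (norm (lam jk)))) * enn2real (bm_norm p t r f)"
      using lam_le by (intro block_space_pairing[OF p r g_m block sum _ f]) (auto intro: le_less_trans)
    also have "\<dots> \<le> 1 * enn2real (bm_norm p t r f)"
      using lam_le by (intro mult_right_mono enn2real_leI) auto
    finally show ?thesis by simp
  qed
  ultimately show thesis by (rule that)
qed

lemma zero_in_block_space:
  fixes p :: "real ^ 'n::{finite,linorder}"
  assumes p: "\<And>i. 1 < p $ i"
  shows "(\<lambda>_. 0) \<in> block_space p t r"
proof -
  have "0 < conj_vec p $ i" for i
    using p by (simp add: conj_exp_pos)
  then have "mnorm (conj_vec p) (\<lambda>_. 0) = 0"
    using mnorm_cmult[of "conj_vec p" "\<lambda>_. 0" 0] by simp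
  then have "is_block p t Q (\<lambda>_. 0)" for Q
    by (simp add: is_block_def mixed_norm_eq_mnorm)
  then show ?thesis
    unfolding block_space_def by (auto intro!: exI[of _ "\<lambda>_. 0"] exI[of _ "\<lambda>_ _. 0"])
qed

text \<open>
  A bounded functional agrees on functions that are equal almost everywhere, so it is enough to represent it on Borel functions.
\<close>
lemma bm_dual_representation:
  fixes p :: "real ^ 'n::{finite,linorder}"
  assumes p: "\<And>i. 1 < p $ i" and r: "1 < r" and L: "L \<in> bm_dual p t r"
  shows "\<exists>g\<in>block_space p t r. \<forall>f\<in>bm_space p t r. L f = pairing g f"
proof -
  obtain a b where "lattice_norm a b borel (\<lambda>F _. bm_functional p t r F)"
    using lattice_norm_bm_functional[OF p r] by blast
  then interpret lattice_norm a b borel "\<lambda>F _. bm_functional p t r F" .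
  have fnorm: "fnorm f = bm_norm p t r f" for f
    using r by (simp add: fnorm_def bm_norm_eq_bm_functional)
  have V_sub: "f \<in> bm_space p t r" if "f \<in> fspace" for f
    using that by (auto simp: fspace_def bm_space_def fnorm intro: measurable_completion)
  obtain C where C: "\<And>f. f \<in> bm_space p t r \<Longrightarrow> norm (L f) \<le> C * enn2real (bm_norm p t r f)"
    and add: "\<And>f g. f \<in> bm_space p t r \<Longrightarrow> g \<in> bm_space p t r \<Longrightarrow> L (\<lambda>x. f x + g x) = L f + L g"
    and mult: "\<And>c f. f \<in> bm_space p t r \<Longrightarrow> L (\<lambda>x. c * f x) = c * L f"
    using L unfolding bm_dual_def by blast
  have lin: "linear_on_fspace L"
    using add mult V_sub by (simp add: linear_on_fspace_def)
  have rep: "\<exists>f'\<in> fspace. L f = L f' \<and> (AE x in lborel. f x = f' x)" if f: "f \<in> bm_space p t r" for f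
  proof -
    have f_m [measurable]: "f \<in> borel_measurable lebesgue" using f by (simp add: bm_space_def)
    obtain f' where f'_m: "f' \<in> borel_measurable borel" and ae: "AE x in lborel. f x = f' x"
      using borel_representative[OF f_m] by blast
    have "bm_norm p t r f = bm_norm p t r f'"
      using r ae by (simp add: bm_norm_eq_bm_functional) (rule bm_functional_cong_AE, auto elim: eventually_mono)
    then have "f' \<in> fspace"
      using f f'_m by (simp add: fspace_def fnorm bm_space_def)
    have "AE x in lborel. ennreal (norm (f x + (-1) * f' x)) = 0"
      using ae by eventually_elim simp
    then have "bm_functional p t r (\<lambda>x. ennreal (norm (f x + (-1) * f' x))) = bm_functional p t r (\<lambda>_. 0)"
      by (rule bm_functional_cong_AE)
    then have z: "bm_norm p t r (\<lambda>x. f x + (-1) * f' x) = 0"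
      using r zero_T by (simp add: bm_norm_eq_bm_functional)
    have [measurable]: "f' \<in> borel_measurable lebesgue"
      using f'_m by (auto intro: measurable_completion)
    have "(\<lambda>x. f x + (-1) * f' x) \<in> bm_space p t r"
      using z by (simp add: bm_space_def)
    from C[OF this] have "L (\<lambda>x. f x + (-1) * f' x) = 0"
      unfolding z by simp
    moreover have "(\<lambda>x. (-1) * f' x) \<in> bm_space p t r"
      by (rule V_sub[OF fspace_cmult[OF \<open>f' \<in> fspace\<close>]])
    ultimately have "L f = L f'"
      using add[OF f, of "\<lambda>x. (-1) * f' x"] mult[OF V_sub[OF \<open>f' \<in> fspace\<close>], of "-1"] by simp
    then show ?thesis using \<open>f' \<in> fspace\<close> ae by blast
  qed
  have "\<exists>g\<in>block_space p t r. \<forall>h\<in> fspace. L h = pairing g h"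
  proof (cases "\<forall>h\<in> fspace. L h = 0")
    case True
    then show ?thesis
      using zero_in_block_space[OF p] by (intro bexI[of _ "\<lambda>_. 0"]) (auto simp: pairing_def)
  next
    case False
    then obtain f1 where "f1 \<in> fspace" "L f1 \<noteq> 0" by blast
    then obtain N f0 where N: "0 < N" and f0: "f0 \<in> fspace" "fnorm f0 \<le> 1" "L f0 = complex_of_real N"
      and bound: "\<And>f. f \<in> fspace \<Longrightarrow> norm (L f) \<le> N * enn2real (fnorm f)"
      using norm_attained[OF lin, of C f1] C V_sub unfolding fnorm by metis
    have "N \<le> N * enn2real (fnorm f0)"
      using bound[OF f0(1)] f0(3) N by simp
    then have "1 \<le> enn2real (fnorm f0)" using N by simp
    then have "fnorm f0 = 1"
      using f0(2) by (cases "fnorm f0") auto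
    then obtain g where g: "g \<in> block_space p t r" "pairing g f0 = 1"
      "\<And>f. f \<in> bm_space p t r \<Longrightarrow> norm (pairing g f) \<le> enn2real (bm_norm p t r f)"
      using ex_norming_block_series[OF p r fspace_measurable[OF f0(1)]] unfolding fnorm_def by metis
    have dual: "pairing g \<in> bm_dual p t r"
      by (rule pairing_in_bm_dual[OF p r g(1)])
    have "L h = pairing (\<lambda>x. complex_of_real N * g x) h" if h: "h \<in> fspace" for h
    proof -
      have "L h / complex_of_real N = pairing g h"
      proof (rule norming_functional_unique[of "\<lambda>f. L f / complex_of_real N" "pairing g" f0 h])
        show "linear_on_fspace (\<lambda>f. L f / complex_of_real N)"
          using lin by (simp add: linear_on_fspace_def add_divide_distrib)
        show "linear_on_fspace (pairing g)"
          using dual V_sub by (simp add: linear_on_fspace_def bm_dual_def)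
        show "norm (L f / complex_of_real N) \<le> enn2real (fnorm f)" if "f \<in> fspace" for f
          using bound[OF that] N by (simp add: norm_divide divide_le_eq mult.commute)
        show "norm (pairing g f) \<le> enn2real (fnorm f)" if "f \<in> fspace" for f
          using g(3)[OF V_sub[OF that]] by (simp add: fnorm)
        show "L f0 / complex_of_real N = 1"
          using f0(3) N by simp
      qed (fact f0 g h)+
      then have "L h = complex_of_real N * pairing g h"
        using N by (simp add: field_simps)
      also have "\<dots> = pairing (\<lambda>x. complex_of_real N * g x) h"
        by (simp add: pairing_def mult.left_commute)
      finally show ?thesis .
    qed
    then show ?thesis
      using block_space_cmult[OF g(1)] by blast
  qed
  then obtain g where g: "g \<in> block_space p t r" "\<And>h. h \<in> fspace \<Longrightarrow> L h = pairing g h"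
    by blast
  have [measurable]: "g \<in> borel_measurable lebesgue"
    using g(1) by (simp add: block_space_def)
  have "L f = pairing g f" if f: "f \<in> bm_space p t r" for f
  proof -
    obtain f' where f': "f' \<in> fspace" "L f = L f'" "AE x in lborel. f x = f' x"
      using rep[OF f] by blast
    have [measurable]: "f \<in> borel_measurable lebesgue" "f' \<in> borel_measurable lebesgue"
      using f V_sub[OF f'(1)] by (auto simp: bm_space_def)
    have "pairing g f = pairing g f'"
      unfolding pairing_def using f'(3) 
      by (intro integral_cong_AE) (auto simp: AE_completion_iff elim: eventually_mono)
    then show ?thesis using f' g by simp
  qed
  then show ?thesis using g(1) by blast
qed

theorem theorem5p13:
  fixes p :: "real ^ 'n::{finite,linorder}" and t r :: real
  assumes "\<forall>i. 1 < p $ i"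
    and "1 < real CARD('n) / sum_recip p"
    and "real CARD('n) / sum_recip p < t"
    and "t < r"
  shows "(\<forall>g\<in>block_space p t r.
            (\<forall>f\<in>bm_space p t r. integrable lebesgue (\<lambda>x. f x * g x)) \<and>
            pairing g \<in> bm_dual p t r) \<and>
         (\<forall>L\<in>bm_dual p t r. \<exists>g\<in>block_space p t r. \<forall>f\<in>bm_space p t r. L f = pairing g f)"
proof -
  have p: "\<And>i. 1 < p $ i" and r: "1 < r"
    using assms by auto
  show ?thesis
    using pairing_in_bm_dual[OF p r] bm_dual_representation[OF p r] by blast
qed

end
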